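(* Let $k\ge2$ be an integer and let $\mathcal{T}_k$ be the scaling limit of the growing $k$-ary trees $T_n(k)$ (see context). The Hausdorff dimension of the tree $\mathcal{T}_k$ is almost surely equal to $k$.
   Context: Growing trees. $T_0(k)$ is the tree with one edge and two vertices, a root and one leaf. Given $T_{n-1}(k)$, choose one of its edges uniformly at random, split it into two edges separated by a new vertex, and attach $k-1$ new edges (each ending in a new leaf) to this new vertex; the result is $T_n(k)$. Each $T_n(k)$ is seen as a compact rooted $\mathbb{R}$-tree with edges of length $1$, endowed with the uniform probability $\mu_n(k)$ on its leaves. The tree $\mathcal{T}_k$. $(\mathcal{T}_k,\mu_k)$ is the random compact rooted measured $\mathbb{R}$-tree which is the limit in probability, for the Gromov–Hausdorff–Prokhorov topology, of $(n^{-1/k}T_n(k),\mu_n(k))$ as $n\to\infty$ ($n^{-1/k}T$ means that the metric is multiplied by $n^{-1/k}$). Its distribution is that of the fragmentation tree with index of self-similarity $-1/k$, zero erosion, and dislocation measure supported on $\mathcal{S}_k=\{\mathbf{s}\in[0,1]^k:\sum_{i=1}^k s_i=1\}$ given by $$\nu_k^{\downarrow}(\mathrm{d}\mathbf{s})=\frac{(k-1)!}{k\,\Gamma(1/k)^{k-1}}\prod_{i=1}^k s_i^{-(1-1/k)}\left(\sum_{i=1}^k\frac{1}{1-s_i}\right)\mathbf{1}_{\{s_1\ge\dots\ge s_k\}}\,\mathrm{d}\mathbf{s},\qquad \mathrm{d}\mathbf{s}=\prod_{i=1}^{k-1}\mathrm{d}s_i .$$ Fragmentation trees. Let $\alpha<0$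 and let $\nu$ be a $\sigma$-finite measure on the set of nonincreasing nonnegative sequences $\mathbf{s}$ with $\sum_i s_i\le 1$, with $\nu(\{(1,0,0,\dots)\})=0$ and $\int(1-s_1)\,\nu(\mathrm{d}\mathbf{s})<\infty$ (finite sequences are completed by zeros). For such $\mathbf{s}$, let $\kappa_{\mathbf{s}}$ be the law of the random partition of $\mathbb{N}$ obtained from i.i.d. $(U_i)$ with $\mathbb{P}(U_i=m)=s_m$ ($m\ge1$), $\mathbb{P}(U_i=0)=1-\sum_m s_m$, where $i\neq j$ are in the same block iff $U_i=U_j\ge1$. Let $\kappa_\nu=\int\kappa_{\mathbf{s}}\,\nu(\mathrm{d}\mathbf{s})$. The homogeneous fragmentation $\Pi^0$ starts from the one-block partition of $\mathbb{N}$; given a Poisson point process $((\Delta(t),i(t)),t\ge0)$ with intensity $\mathrm{d}t\otimes\kappa_\nu\otimes\#$ ($\#$ the counting measure on $\mathbb{N}$), at each atom time $t$ the $i(t)$-th block $B$ of $\Pi^0(t^-)$ (blocks ordered by least element) is replaced by the blocks $B\cap\Delta_m(t)$, where $\Delta_m(t)$ are the blocks of $\Delta(t)$. Let $\Pi^0_{(i)}(t)$ be the block containing $i$, $|\cdot|$ the asymptotic frequency, $\tau_i(t)=\inf\{u\ge0:\int_0^u|\Pi^0_{(i)}(r)|^{-\alpha}\mathrm{d}r>t\}$, and let $\Pi$ be the process such that the block of $\Pi(t)$ containing $i$ is $\Pi^0_{(i)}(\tau_i(t))$ (or $\{i\}$ if $\tau_i(t)=\infty$). Let $D_i=\inf\{t:\{i\}\in\Pi(t)\}$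 and $D_{i,j}=\inf\{t: i,j \text{ not in the same block of }\Pi(t)\}$. The fragmentation tree with index $\alpha$ and dislocation measure $\nu$ is (in distribution) the smallest complete $\mathbb{R}$-tree, rooted at $\rho$, containing points $Q_i$ ($i\in\mathbb{N}$) with $d(\rho,Q_i)=D_i$ and $d(Q_i,Q_j)=D_i+D_j-2D_{i,j}$ for $i\neq j$, endowed with $\mu=\lim_{n}\frac1n\sum_{i\le n}\delta_{Q_i}$ (weak limit). *)

theory Defs
  imports "HOL-Probability.Probability"
begin

section \<open>Compact rooted measured metric spaces and real trees\<close>

definition metric_borel :: "'a metric \<Rightarrow> 'a measure" where
  "metric_borel m = sigma (mspace m) {U. openin (mtopology_of m) U}"

record 'a rmm_space =
  metr :: "'a metric"
  rt :: 'a
  mass :: "'a measure"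

definition compact_rmm :: "'a rmm_space \<Rightarrow> bool" where
  "compact_rmm X \<longleftrightarrow>
     compact_space (mtopology_of (metr X)) \<and> rt X \<in> mspace (metr X) \<and>
     sets (mass X) = sets (metric_borel (metr X)) \<and> prob_space (mass X)"

definition geodesic :: "'a metric \<Rightarrow> 'a \<Rightarrow> 'a \<Rightarrow> (real \<Rightarrow> 'a) \<Rightarrow> bool" where
  "geodesic m x y \<phi> \<longleftrightarrow>
     \<phi> 0 = x \<and> \<phi> (mdist m x y) = y \<and> \<phi> ` {0..mdist m x y} \<subseteq> mspace m \<and>
     (\<forall>s\<in>{0..mdist m x y}. \<forall>t\<in>{0..mdist m x y}. mdist m (\<phi> s) (\<phi> t) = \<bar>s - t\<bar>)"

text \<open>Any two points are joined by a unique geodesic, and the range of any injective path between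
  them is the range of that geodesic.\<close>

definition real_tree :: "'a metric \<Rightarrow> bool" where
  "real_tree m \<longleftrightarrow>
     (\<forall>x\<in>mspace m. \<forall>y\<in>mspace m.
        (\<exists>\<phi>. geodesic m x y \<phi>) \<and>
        (\<forall>\<phi> \<psi>. geodesic m x y \<phi> \<longrightarrow> geodesic m x y \<psi> \<longrightarrow> (\<forall>t\<in>{0..mdist m x y}. \<phi> t = \<psi> t)) \<and>
        (\<forall>\<phi> c. geodesic m x y \<phi> \<longrightarrow>
           continuous_map (top_of_set {0..1::real}) (mtopology_of m) c \<longrightarrow> inj_on c {0..1} \<longrightarrow>
           c 0 = x \<longrightarrow> c 1 = y \<longrightarrow> c ` {0..1} = \<phi> ` {0..mdist m x y}))"

definition rescale :: "real \<Rightarrow> 'a rmm_space \<Rightarrow> 'a rmm_space" where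
  "rescale c X = X\<lparr>metr := metric (mspace (metr X), \<lambda>x y. c * mdist (metr X) x y)\<rparr>"

lemma rescale_sel [simp]:
  "rt (rescale c X) = rt X" "mass (rescale c X) = mass X"
  by (simp_all add: rescale_def)

lemma rescale_metr:
  assumes "c > 0"
  shows "mspace (metr (rescale c X)) = mspace (metr X)"
    and "mdist (metr (rescale c X)) = (\<lambda>x y. c * mdist (metr X) x y)"
proof -
  interpret X: Metric_space "mspace (metr X)" "mdist (metr X)"
    by simp
  have "Metric_space (mspace (metr X)) (\<lambda>x y. c * mdist (metr X) x y)"
    using assms X.triangle
    by (unfold_locales) (auto simp: X.commute simp flip: distrib_left)
  then show "mspace (metr (rescale c X)) = mspace (metr X)"
    and "mdist (metr (rescale c X)) = (\<lambda>x y. c * mdist (metr X) x y)"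
    by (simp_all add: rescale_def Metric_space.mspace_metric Metric_space.mdist_metric)
qed


section \<open>Gromov--Hausdorff--Prokhorov distance and convergence in probability\<close>

definition hausdorff_dist :: "'a metric \<Rightarrow> 'a set \<Rightarrow> 'a set \<Rightarrow> real" where
  "hausdorff_dist m A B =
     Inf {\<epsilon>. \<epsilon> > 0 \<and> (\<forall>a\<in>A. \<exists>b\<in>B. mdist m a b < \<epsilon>) \<and> (\<forall>b\<in>B. \<exists>a\<in>A. mdist m a b < \<epsilon>)}"

definition prokhorov_dist :: "'a metric \<Rightarrow> 'a measure \<Rightarrow> 'a measure \<Rightarrow> real" where
  "prokhorov_dist m \<mu> \<nu> =
     Inf {\<epsilon>. \<epsilon> > 0 \<and> (\<forall>C. closedin (mtopology_of m) C \<longrightarrow>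
        measure \<mu> C \<le> measure \<nu> {y \<in> mspace m. \<exists>x\<in>C. mdist m x y < \<epsilon>} + \<epsilon> \<and>
        measure \<nu> C \<le> measure \<mu> {y \<in> mspace m. \<exists>x\<in>C. mdist m x y < \<epsilon>} + \<epsilon>)}"

definition isometric_embedding :: "'a metric \<Rightarrow> 'b metric \<Rightarrow> ('a \<Rightarrow> 'b) \<Rightarrow> bool" where
  "isometric_embedding m m' \<phi> \<longleftrightarrow>
     \<phi> \<in> mspace m \<rightarrow> mspace m' \<and>
     (\<forall>x\<in>mspace m. \<forall>y\<in>mspace m. mdist m' (\<phi> x) (\<phi> y) = mdist m x y)"

text \<open>The infimum is over all isometric embeddings into a common metric space \<open>Z\<close>. Taking the points
  of \<open>Z\<close> in the sum type is no restriction: only the union of the two images matters, and it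
  injects into the sum type.\<close>

definition ghp_dist :: "'a rmm_space \<Rightarrow> 'b rmm_space \<Rightarrow> real" where
  "ghp_dist X Y =
     Inf {max (hausdorff_dist Z (\<phi> ` mspace (metr X)) (\<psi> ` mspace (metr Y)))
            (max (mdist Z (\<phi> (rt X)) (\<psi> (rt Y)))
                 (prokhorov_dist Z (distr (mass X) (metric_borel Z) \<phi>)
                                   (distr (mass Y) (metric_borel Z) \<psi>)))
          | (Z :: ('a + 'b) metric) \<phi> \<psi>.
            isometric_embedding (metr X) Z \<phi> \<and> isometric_embedding (metr Y) Z \<psi>}"

text \<open>Measurability for the Borel sets of the separable space of isometry classes under
  \<^const>\<open>ghp_dist\<close> is measurability of all distances to fixed spaces. As a compact metric space embeds
  isometrically into the bounded real sequences, the type \<^typ>\<open>nat \<Rightarrow> real\<close> of points already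
  yields every isometry class.\<close>

definition random_real_tree :: "'w measure \<Rightarrow> ('w \<Rightarrow> 'a rmm_space) \<Rightarrow> bool" where
  "random_real_tree M X \<longleftrightarrow>
     (\<forall>\<omega>\<in>space M. compact_rmm (X \<omega>) \<and> real_tree (metr (X \<omega>))) \<and>
     (\<forall>K :: (nat \<Rightarrow> real) rmm_space. compact_rmm K \<longrightarrow> (\<lambda>\<omega>. ghp_dist K (X \<omega>)) \<in> borel_measurable M)"

definition ghp_tendsto_in_prob ::
    "'w measure \<Rightarrow> (nat \<Rightarrow> 'w \<Rightarrow> 'a rmm_space) \<Rightarrow> ('w \<Rightarrow> 'b rmm_space) \<Rightarrow> bool" where
  "ghp_tendsto_in_prob M X Y \<longleftrightarrow>
     (\<forall>\<epsilon>>0. (\<lambda>n. measure M {\<omega>\<in>space M. ghp_dist (X n \<omega>) (Y \<omega>) > \<epsilon>}) \<longlonglongrightarrow> 0)"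


section \<open>Growing trees\<close>

text \<open>A rooted tree is its set of edges, oriented away from the root. Step \<open>n\<close> uses the fresh
  labels \<open>2 + k * n\<close> (new inner vertex) and \<open>2 + k * n + j\<close> with \<open>1 \<le> j < k\<close> (new leaves).\<close>

definition split_edge :: "nat \<Rightarrow> nat \<Rightarrow> nat \<times> nat \<Rightarrow> (nat \<times> nat) set \<Rightarrow> (nat \<times> nat) set" where
  "split_edge k w e E =
     (E - {e}) \<union> {(fst e, w), (w, snd e)} \<union> (\<lambda>j. (w, w + j)) ` {1..<k}"

primrec growing_tree :: "nat \<Rightarrow> (nat \<Rightarrow> nat \<times> nat) \<Rightarrow> nat \<Rightarrow> (nat \<times> nat) set" where
  "growing_tree k h 0 = {(0, 1)}"
| "growing_tree k h (Suc n) = split_edge k (2 + k * n) (h n) (growing_tree k h n)"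

text \<open>\<open>e n\<close> is the edge chosen in the tree after \<open>n\<close> steps: conditionally on the previous choices, it
  is uniform on the edges of this tree.\<close>

definition uniform_growth :: "nat \<Rightarrow> 'w measure \<Rightarrow> (nat \<Rightarrow> 'w \<Rightarrow> nat \<times> nat) \<Rightarrow> bool" where
  "uniform_growth k M e \<longleftrightarrow>
     prob_space M \<and>
     (\<forall>n. e n \<in> measurable M (count_space UNIV)) \<and>
     (\<forall>n. \<forall>\<omega>\<in>space M. e n \<omega> \<in> growing_tree k (\<lambda>i. e i \<omega>) n) \<and>
     (\<forall>n h. h n \<in> growing_tree k h n \<longrightarrow>
        measure M {\<omega>\<in>space M. \<forall>i\<le>n. e i \<omega> = h i} =
        measure M {\<omega>\<in>space M. \<forall>i<n. e i \<omega> = h i} / real (card (growing_tree k h n)))"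

definition leaves :: "(nat \<times> nat) set \<Rightarrow> nat set" where
  "leaves E = Range E - Domain E"

text \<open>The real tree with unit edges spanned by \<open>E\<close>, inside \<open>\<ell>\<^sup>1\<close>. Edges are indexed by their lower
  endpoint; a point \<open>x\<close> is encoded by the function giving, for each edge, the length of this edge
  that is covered by the path from the root to \<open>x\<close>. The paths from the root to \<open>x\<close> and to \<open>y\<close> share
  an initial segment and then separate, so the length of the path from \<open>x\<close> to \<open>y\<close> is
  the \<open>\<ell>\<^sup>1\<close> distance of their codes.\<close>

definition vertex_point :: "(nat \<times> nat) set \<Rightarrow> nat \<Rightarrow> nat \<Rightarrow> real" where
  "vertex_point E v = (\<lambda>w. if w \<in> Range E \<and> (w, v) \<in> E\<^sup>* then 1 else 0)"

definition tree_points :: "(nat \<times> nat) set \<Rightarrow> (nat \<Rightarrow> real) set" where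
  "tree_points E = {(vertex_point E u)(v := t) | u v t. (u, v) \<in> E \<and> 0 \<le> t \<and> t \<le> 1}"

definition tree_metric :: "(nat \<times> nat) set \<Rightarrow> (nat \<Rightarrow> real) metric" where
  "tree_metric E = metric (tree_points E, \<lambda>x y. \<Sum>v\<in>Range E. \<bar>x v - y v\<bar>)"

definition tree_space :: "(nat \<times> nat) set \<Rightarrow> (nat \<Rightarrow> real) rmm_space" where
  "tree_space E =
     \<lparr>metr = tree_metric E,
      rt = vertex_point E 0,
      mass = distr (uniform_count_measure (leaves E)) (metric_borel (tree_metric E)) (vertex_point E)\<rparr>"

lemma finite_growing_tree: "finite (growing_tree k h n)"
  by (induction n) (auto simp: split_edge_def)

lemma tree_metric_sel:
  assumes "finite E"
  shows "mspace (tree_metric E) = tree_points E"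
    and "mdist (tree_metric E) = (\<lambda>x y. \<Sum>v\<in>Range E. \<bar>x v - y v\<bar>)"
proof -
  have fin: "finite (Range E)"
    using assms by (simp add: finite_Range)
  have supp: "x v = 0" if "x \<in> tree_points E" "v \<notin> Range E" for x v
    using that by (auto simp: tree_points_def vertex_point_def)
  have "Metric_space (tree_points E) (\<lambda>x y. \<Sum>v\<in>Range E. \<bar>x v - y v\<bar>)"
  proof
    fix x y z :: "nat \<Rightarrow> real"
    show "0 \<le> (\<Sum>v\<in>Range E. \<bar>x v - y v\<bar>)"
      by (simp add: sum_nonneg)
    show "(\<Sum>v\<in>Range E. \<bar>x v - y v\<bar>) = (\<Sum>v\<in>Range E. \<bar>y v - x v\<bar>)"
      by (simp add: abs_minus_commute)
    show "(\<Sum>v\<in>Range E. \<bar>x v - z v\<bar>) \<le>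
          (\<Sum>v\<in>Range E. \<bar>x v - y v\<bar>) + (\<Sum>v\<in>Range E. \<bar>y v - z v\<bar>)"
      unfolding sum.distrib[symmetric] by (rule sum_mono) simp
    assume "x \<in> tree_points E" "y \<in> tree_points E"
    then have "(\<forall>v\<in>Range E. x v = y v) \<longleftrightarrow> x = y"
      using supp by (metis ext)
    then show "((\<Sum>v\<in>Range E. \<bar>x v - y v\<bar>) = 0) = (x = y)"
      using fin by (simp add: sum_nonneg_eq_0_iff)
  qed
  then show "mspace (tree_metric E) = tree_points E"
    and "mdist (tree_metric E) = (\<lambda>x y. \<Sum>v\<in>Range E. \<bar>x v - y v\<bar>)"
    by (simp_all add: tree_metric_def Metric_space.mspace_metric Metric_space.mdist_metric)
qed


section \<open>Hausdorff dimension\<close>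

definition mdiameter :: "'a metric \<Rightarrow> 'a set \<Rightarrow> real" where
  "mdiameter m U = (if U = {} then 0 else SUP p\<in>U \<times> U. mdist m (fst p) (snd p))"

text \<open>Only used for \<open>s > 0\<close>, so that the empty set contributes \<open>0 powr s = 0\<close>.\<close>

definition hausdorff_premeasure :: "'a metric \<Rightarrow> real \<Rightarrow> real \<Rightarrow> 'a set \<Rightarrow> ennreal" where
  "hausdorff_premeasure m s \<delta> A =
     Inf {\<Sum>i. ennreal (mdiameter m (U i) powr s) | U :: nat \<Rightarrow> 'a set.
            (\<forall>i. U i \<subseteq> mspace m \<and> (\<forall>x\<in>U i. \<forall>y\<in>U i. mdist m x y \<le> \<delta>)) \<and> A \<subseteq> (\<Union>i. U i)}"

definition hausdorff_measure :: "'a metric \<Rightarrow> real \<Rightarrow> 'a set \<Rightarrow> ennreal" where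
  "hausdorff_measure m s A = (SUP \<delta>\<in>{0<..}. hausdorff_premeasure m s \<delta> A)"

definition hausdorff_dim :: "'a metric \<Rightarrow> ennreal" where
  "hausdorff_dim m = Inf {ennreal s | s. s > 0 \<and> hausdorff_measure m s (mspace m) = 0}"

end

theory Submission
  imports Defs
begin

text \<open>The growth chooses uniformly among finitely many histories, and both bounds on the dimension come
  from one-step drift inequalities for functionals of the discrete tree \<open>T\<^sub>n\<close>, which has
  \<open>kn + 1\<close> edges. When the chosen edge is split, the distance \<open>d\<close> of two given vertices grows by one
  with probability \<open>d / (kn + 1)\<close>.

  Lower bound: for \<open>s < k\<close> the energy of all pairs of vertices, with a weight decaying like
  \<open>d\<^bsup>-s\<^esup>\<close>, satisfies \<open>E S' \<le> (1 + (2k - s) / (kn + 1)) S + k\<^sup>2\<close>, so that its mean is of order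
  \<open>n\<^bsup>2 - s/k\<^esup>\<close>. A cover of the limit tree by sets \<open>U\<^sub>i\<close> induces one of \<open>T\<^sub>n\<close>, and the
  Cauchy--Schwarz inequality bounds the sum of the \<open>diam(U\<^sub>i)\<^sup>s\<close> from below by the inverse of the energy.

  Upper bound: the \<open>p\<close>-th moments of the distance in \<open>T\<^sub>n\<close> between a vertex of \<open>T\<^bsub>2m\<^esub>\<close> and the
  vertices of \<open>T\<^sub>m\<close> are of order \<open>(n / m)\<^bsup>p/k\<^esup>\<close>. For large \<open>p\<close>, chaining over dyadic \<open>m\<close> shows that
  the \<open>km + 1\<close> vertices of \<open>T\<^sub>m\<close> form a net of \<open>T\<^sub>n\<close> of mesh about \<open>n\<^bsup>1/k\<^esup> m\<^bsup>-\<beta>\<^esup>\<close>, for each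
  \<open>\<beta> < 1 / k\<close>.

  A nonnegative functional with bounded mean almost surely stays bounded along infinitely many \<open>n\<close> for
  which \<open>T\<^sub>n\<close> is as close to the limit tree as desired, and this transfers both estimates. Only the
  Hausdorff part of the Gromov--Hausdorff--Prokhorov distance is needed.\<close>

section \<open>Ancestors and distances under edge splitting\<close>

text \<open>An edge is named by its lower endpoint, so \<open>anc E x\<close> stands for the edges
  on the path from the root to \<open>x\<close>. A vertex without incoming edge, such as the root,
  gets the empty set.\<close>

definition anc :: "(nat \<times> nat) set \<Rightarrow> nat \<Rightarrow> nat set" where
  "anc E x = {w \<in> Range E. (w, x) \<in> E\<^sup>*}"

text \<open>Two paths from the root agree up to a branch point and are disjoint afterwards. The
  symmetric difference thus consists of the edges between \<open>x\<close> and \<open>y\<close>, and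
  its cardinality is the graph distance.\<close>

definition edist :: "(nat \<times> nat) set \<Rightarrow> nat \<Rightarrow> nat \<Rightarrow> nat" where
  "edist E x y = card (sym_diff (anc E x) (anc E y))"

text \<open>Invariants of a tree after \<open>n\<close> steps. Injectivity of \<open>snd\<close> is
  uniqueness of the parent, and the potential \<open>r\<close> encodes acyclicity; its values are
  real because a split inserts a vertex between two given values. The bound on the labels makes
  those of the next step fresh.\<close>

definition grown :: "nat \<Rightarrow> nat \<Rightarrow> (nat \<times> nat) set \<Rightarrow> bool" where
  "grown k n E \<longleftrightarrow>
     finite E \<and> card E = k * n + 1 \<and> inj_on snd E \<and> (\<exists>r :: nat \<Rightarrow> real. \<forall>(u, v)\<in>E. r u < r v) \<and>
     Field E \<subseteq> {..<2 + k * n} \<and> 0 \<in> Domain E \<and> 1 \<in> Range E - Domain E"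

lemma Range_split_edge:
  assumes "e \<in> E" "k \<ge> 1"
  shows "Range (split_edge k w e E) = Range E \<union> {w..<w + k}"
proof -
  have *: "y \<in> insert w ((\<lambda>j. w + j) ` {1..<k})" if "y \<in> {w..<w + k}" for y
    using that by (auto intro!: image_eqI[of _ _ "y - w"])
  show ?thesis
  proof (intro equalityI subsetI)
    fix y assume "y \<in> Range (split_edge k w e E)"
    then show "y \<in> Range E \<union> {w..<w + k}"
      using assms by (cases e) (auto simp: split_edge_def)
  next
    fix y assume "y \<in> Range E \<union> {w..<w + k}"
    then consider x where "(x, y) \<in> E" | "y \<in> insert w ((\<lambda>j. w + j) ` {1..<k})"
      using * by blast
    then have "\<exists>z. (z, y) \<in> split_edge k w e E"
    proof cases
      case (1 x)
      \<comment> \<open>An edge into \<open>y\<close> survives unless it is the split one, in which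
        case its lower half now enters \<open>y\<close>.\<close>
      then have "(if (x, y) = e then w else x, y) \<in> split_edge k w e E"
        by (auto simp: split_edge_def)
      then show ?thesis ..
    next
      case 2
      then show ?thesis
        unfolding split_edge_def by blast
    qed
    then show "y \<in> Range (split_edge k w e E)"
      by blast
  qed
qed

lemma grown_split_edge:
  assumes "grown k n E" "e \<in> E" "k \<ge> 1"
  shows "grown k (Suc n) (split_edge k (2 + k * n) e E)"
proof -
  define w where "w = 2 + k * n"
  obtain u v where e: "e = (u, v)"
    by (cases e)
  obtain r :: "nat \<Rightarrow> real" where r: "\<And>x y. (x, y) \<in> E \<Longrightarrow> r x < r y"
    using assms(1) unfolding grown_def by blast
  have fin: "finite E" and card: "card E = k * n + 1" and inj: "inj_on snd E"
    and fld: "Field E \<subseteq> {..<w}" and dom: "0 \<in> Domain E" "1 \<in> Range E" "1 \<notin> Domain E"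
    using assms(1) by (auto simp: grown_def w_def)
  have fresh: "x < w" "y < w" if "(x, y) \<in> E" for x y
    using that fld by (auto simp: Field_def)
  have uv: "(u, v) \<in> E" "u < w" "v < w"
    using assms(2) e fresh by auto
  let ?E = "split_edge k w e E"
  have E: "?E = (E - {(u, v)}) \<union> ({(u, w), (w, v)} \<union> (\<lambda>j. (w, w + j)) ` {1..<k})"
    by (auto simp: split_edge_def e)
  have "card ({(u, w), (w, v)} \<union> (\<lambda>j. (w, w + j)) ` {1..<k}) = 2 + card ((\<lambda>j. (w, w + j)) ` {1..<k})"
    using uv by (subst card_Un_disjoint) auto
  also have "\<dots> = k + 1"
    using assms(3) by (subst card_image) (auto simp: inj_on_def)
  finally have "card ?E = (card E - 1) + (k + 1)"
    unfolding E using fin uv fresh by (subst card_Un_disjoint) (auto dest: fresh)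
  then have c: "card ?E = k * Suc n + 1"
    using card by simp
  have "a = b" if "(a, x) \<in> E" "(b, x) \<in> E" for a b x
    using inj_onD[OF inj _ that] by simp
  then have i: "inj_on snd ?E"
    using uv unfolding E inj_on_def by (fastforce dest: fresh)
  \<comment> \<open>The midpoint puts the new vertex strictly between the ends of the split edge,
    and \<open>r v\<close> exceeds it, so that this value serves all new leaves.\<close>
  define r' where "r' x = (if x < w then r x else if x = w then (r u + r v) / 2 else r v)" for x
  have "\<forall>(x, y)\<in>?E. r' x < r' y"
    using r[of u v] uv unfolding E by (auto simp: r'_def r dest: fresh)
  moreover have "x < w + k" "y < w + k" if "(x, y) \<in> ?E" for x y
    using that uv assms(3) fresh[of x y] unfolding E by auto
  then have "Field ?E \<subseteq> {..<2 + k * Suc n}"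
    by (force simp: Field_def w_def)
  moreover have "0 \<in> Domain ?E"
    using dom uv unfolding E by (auto simp: Domain_iff)
  moreover have "1 \<in> Range ?E"
    using dom assms by (subst Range_split_edge) auto
  moreover have "1 \<notin> Domain ?E"
    using dom uv unfolding E by (auto simp: w_def)
  moreover have "finite ?E"
    using fin by (simp add: E)
  ultimately show ?thesis
    using c i unfolding grown_def w_def[symmetric] by blast
qed

lemma grown_0: "grown k 0 {(0, 1)}"
  unfolding grown_def by (auto intro!: exI[of _ real] simp: Field_def)

locale grown_tree =
  fixes k n E
  assumes grown: "grown k n E" and k1: "k \<ge> 1"
begin

lemma finite_E [simp]: "finite E"
  using grown by (simp add: grown_def)

lemma finite_Range_E [simp]: "finite (Range E)"
  by (simp add: finite_Range)

lemma card_E: "card E = k * n + 1"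
  using grown by (simp add: grown_def)

lemma inj_snd: "inj_on snd E"
  using grown by (simp add: grown_def)

lemma parent_unique: "(a, x) \<in> E \<Longrightarrow> (b, x) \<in> E \<Longrightarrow> a = b"
  using inj_onD[OF inj_snd, of "(a, x)" "(b, x)"] by simp

lemma card_Range: "card (Range E) = k * n + 1"
  using card_image[OF inj_snd] card_E by (simp add: Range_snd)

lemma sum_edges: "(\<Sum>e\<in>E. F (snd e)) = (\<Sum>v\<in>Range E. F v :: real)"
  using sum.reindex[OF inj_snd, of F] by (simp add: Range_snd)

lemma fresh: "x \<in> Field E \<Longrightarrow> x < 2 + k * n"
  using grown by (auto simp: grown_def)

lemma acyclic_E: "acyclic E"
proof -
  obtain r :: "nat \<Rightarrow> real" where r: "\<And>x y. (x, y) \<in> E \<Longrightarrow> r x < r y"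
    using grown unfolding grown_def by blast
  have "r x < r y" if "(x, y) \<in> E\<^sup>+" for x y
    using that by (induction) (auto dest: r)
  then show ?thesis
    by (auto simp: acyclic_def)
qed

lemma wf_E: "wf E"
  using acyclic_E by (simp add: finite_acyclic_wf)

lemma anc_subset: "anc E x \<subseteq> Range E"
  by (auto simp: anc_def)

lemma finite_anc [simp]: "finite (anc E x)"
  using anc_subset finite_subset by fastforce

text \<open>The parent being unique, every nontrivial path to \<open>v\<close> arrives through
  \<open>u\<close>.\<close>

lemma anc_edge:
  assumes "(u, v) \<in> E"
  shows "anc E v = insert v (anc E u)"
proof -
  have "(a, v) \<in> E\<^sup>* \<longleftrightarrow> a = v \<or> (a, u) \<in> E\<^sup>*" for a
    using assms parent_unique by (metis rtrancl.simps)
  then show ?thesis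
    using assms by (auto simp: anc_def)
qed

lemma anc_nonrange: "x \<notin> Range E \<Longrightarrow> anc E x = {}"
  by (auto simp: anc_def elim: rtranclE)

lemma not_anc_parent:
  assumes "(u, v) \<in> E"
  shows "v \<notin> anc E u"
proof
  assume "v \<in> anc E u"
  then have "(v, u) \<in> E\<^sup>*"
    by (simp add: anc_def)
  then have "(v, v) \<in> E\<^sup>+"
    using assms by (rule rtrancl_into_trancl1)
  then show False
    using acyclic_E by (simp add: acyclic_def)
qed

lemma anc_self: "v \<in> Range E \<Longrightarrow> v \<in> anc E v"
  by (simp add: anc_def)

lemma anc_mono: "v \<in> anc E y \<Longrightarrow> anc E v \<subseteq> anc E y"
  by (auto simp: anc_def)

lemma edist_commute: "edist E x y = edist E y x"
  by (simp add: edist_def Un_commute)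

lemma edist_self [simp]: "edist E x x = 0"
  by (simp add: edist_def)

lemma edist_triangle: "edist E x z \<le> edist E x y + edist E y z"
proof -
  have "edist E x z \<le> card (sym_diff (anc E x) (anc E y) \<union> sym_diff (anc E y) (anc E z))"
    unfolding edist_def by (rule card_mono) auto
  also have "\<dots> \<le> edist E x y + edist E y z"
    unfolding edist_def by (rule card_Un_le)
  finally show ?thesis .
qed

end

section \<open>The effect of one split on ancestor sets and distances\<close>

locale split_tree = grown_tree +
  fixes u v
  assumes edge: "(u, v) \<in> E"
begin

definition "mid = 2 + k * n"
definition "E' = split_edge k mid (u, v) E"

sublocale split: grown_tree k "Suc n" E'
  unfolding E'_def mid_def using grown_split_edge[OF grown edge k1] k1
  by unfold_locales

lemma Range_E': "Range E' = Range E \<union> {mid..<mid + k}"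
  unfolding E'_def by (rule Range_split_edge[OF edge k1])

lemma E'_edges:
  "(u, mid) \<in> E'" "(mid, v) \<in> E'" "1 \<le> j \<Longrightarrow> j < k \<Longrightarrow> (mid, mid + j) \<in> E'"
  "e \<in> E \<Longrightarrow> e \<noteq> (u, v) \<Longrightarrow> e \<in> E'"
  by (auto simp: E'_def split_edge_def)

text \<open>Induction from parent to child. The only parent edge that changes is
  \<open>(u, v)\<close>: its lower half hangs below \<open>mid\<close>, so \<open>mid\<close> joins
  the ancestors of \<open>v\<close> and, through the induction, those of everything below
  \<open>v\<close>.\<close>

lemma anc_old:
  assumes "x < mid"
  shows "anc E' x = anc E x \<union> (if v \<in> anc E x then {mid} else {})"
  using wf_E assms
proof (induction x rule: wf_induct_rule)
  case (less x)
  show ?case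
  proof (cases "x \<in> Range E")
    case False
    then have "x \<notin> Range E'"
      using less.prems by (simp add: Range_E')
    then show ?thesis
      using False by (simp add: anc_nonrange split.anc_nonrange)
  next
    case True
    then obtain a where a: "(a, x) \<in> E"
      by auto
    have "a < mid"
      using fresh[of a] a by (auto simp: mid_def Field_def)
    note IH = less.IH[OF a this]
    show ?thesis
    proof (cases "x = v")
      case True
      then have au: "a = u"
        using a edge parent_unique by blast
      have "anc E' v = insert v (insert mid (anc E' u))"
        using E'_edges by (simp add: split.anc_edge)
      then show ?thesis
        using IH not_anc_parent[OF edge] anc_edge[OF edge] unfolding True au by auto
    next
      case False
      then have "(a, x) \<in> E'"
        using a E'_edges(4) by blast
      then show ?thesis
        using IH False anc_edge[OF a] by (auto simp: split.anc_edge)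
    qed
  qed
qed

lemma anc_mid: "anc E' mid = insert mid (anc E u)"
proof -
  have "u < mid"
    using fresh[of u] edge by (auto simp: mid_def Field_def)
  then show ?thesis
    using split.anc_edge[OF E'_edges(1)] anc_old not_anc_parent[OF edge] by auto
qed

lemma anc_leaf:
  assumes "1 \<le> j" "j < k"
  shows "anc E' (mid + j) = insert (mid + j) (insert mid (anc E u))"
  using split.anc_edge[OF E'_edges(3)[OF assms]] anc_mid by simp

lemma Range_less: "x \<in> Range E \<Longrightarrow> x < mid"
  using fresh[of x] by (auto simp: mid_def Field_def)

lemma anc_less: "y \<in> anc E x \<Longrightarrow> y < mid"
  using anc_subset Range_less by blast

text \<open>By \<open>anc_old\<close>, \<open>mid\<close> lies in the same new ancestor sets as
  \<open>v\<close>. It enters the symmetric difference exactly when \<open>v\<close> does, that is,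
  when the split edge lies on the path from \<open>x\<close> to \<open>y\<close>.\<close>

lemma edist_old:
  assumes "x \<in> Range E" "y \<in> Range E"
  shows "edist E' x y = edist E x y + (if v \<in> sym_diff (anc E x) (anc E y) then 1 else 0)"
proof -
  have *: "mid \<notin> anc E z" for z
    using anc_less by blast
  have "sym_diff (anc E' x) (anc E' y) =
      (if v \<in> sym_diff (anc E x) (anc E y) then insert mid (sym_diff (anc E x) (anc E y))
       else sym_diff (anc E x) (anc E y))"
    using assms[THEN Range_less] * by (auto simp: anc_old)
  then show ?thesis
    using * by (simp add: edist_def)
qed

text \<open>In the ancestor set of the new vertex, \<open>mid\<close> takes the place of
  \<open>v\<close>. If \<open>y\<close> lies at or below \<open>v\<close>, then \<open>v\<close>
  still belongs to the ancestors of \<open>y\<close> and separates it from \<open>mid\<close>, which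
  costs one; otherwise \<open>mid\<close> simply replaces \<open>v\<close> in the symmetric
  difference.\<close>

lemma edist_mid:
  assumes "y \<in> Range E"
  shows "edist E' mid y = edist E v y + (if v \<in> anc E y then 1 else 0)"
proof -
  have y: "y < mid"
    using assms Range_less by blast
  have m: "mid \<notin> anc E z" for z
    using anc_less by blast
  have v: "v \<notin> anc E u" "anc E v = insert v (anc E u)"
    using not_anc_parent anc_edge edge by auto
  show ?thesis
  proof (cases "v \<in> anc E y")
    case True
    then have "anc E v \<subseteq> anc E y"
      by (rule anc_mono)
    then have "sym_diff (anc E' mid) (anc E' y) = insert v (sym_diff (anc E v) (anc E y))"
      using True y m v by (auto simp: anc_old anc_mid)
    moreover have "v \<notin> sym_diff (anc E v) (anc E y)"
      using True v by auto
    ultimately show ?thesis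
      using True by (simp add: edist_def)
  next
    case False
    let ?D = "sym_diff (anc E u) (anc E y)"
    have "sym_diff (anc E' mid) (anc E' y) = insert mid ?D"
         "sym_diff (anc E v) (anc E y) = insert v ?D"
      using False y m v by (auto simp: anc_old anc_mid)
    moreover have "mid \<notin> ?D" "v \<notin> ?D"
      using m v False by auto
    ultimately show ?thesis
      using False by (simp add: edist_def)
  qed
qed

lemma edist_leaf:
  assumes "y \<in> Range E" "1 \<le> j" "j < k"
  shows "edist E' (mid + j) y = edist E' mid y + 1"
proof -
  have y: "y < mid"
    using assms Range_less by blast
  have "mid + j \<notin> anc E z" for z
    using anc_less[of "mid + j" z] by auto
  then have j: "mid + j \<notin> anc E' y" "mid + j \<notin> anc E' mid"
    using assms y by (auto simp: anc_old anc_mid)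
  have "sym_diff (anc E' (mid + j)) (anc E' y) = insert (mid + j) (sym_diff (anc E' mid) (anc E' y))"
    using j assms by (auto simp: anc_leaf anc_mid)
  then show ?thesis
    using j by (simp add: edist_def)
qed

text \<open>A decreasing weight needs lower bounds on the new distances. The maximum with 1 records
  the case \<open>y = v\<close>, where \<open>mid\<close> lies one edge above
  \<open>v\<close>.\<close>

lemma edist_mid_ge: "y \<in> Range E \<Longrightarrow> edist E' mid y \<ge> max 1 (edist E v y)"
proof -
  assume y: "y \<in> Range E"
  have "edist E v y = 0 \<Longrightarrow> v \<in> anc E y"
    using edge anc_self[of v] by (auto simp: edist_def)
  then show ?thesis
    using edist_mid[OF y] by (cases "edist E v y = 0") auto
qed

end

section \<open>Averages over growth histories\<close>

text \<open>Histories are lists with the latest edge at the head, so that dropping entries from the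
  front yields the history of an earlier tree. Compared with the infinite sequences read by
  \<open>growing_tree\<close>, they give a finite set to average over.\<close>

primrec htree :: "nat \<Rightarrow> (nat \<times> nat) list \<Rightarrow> (nat \<times> nat) set" where
  "htree k [] = {(0, 1)}"
| "htree k (e # h) = split_edge k (2 + k * length h) e (htree k h)"

primrec histories :: "nat \<Rightarrow> nat \<Rightarrow> (nat \<times> nat) list set" where
  "histories k 0 = {[]}"
| "histories k (Suc n) = (\<lambda>(h, e). e # h) ` (SIGMA h:histories k n. htree k h)"

text \<open>The number of edges after \<open>n\<close> steps does not depend on the history, so
  uniform choices make all histories of length \<open>n\<close> equally likely (see
  \<open>prob_hist\<close>), and \<open>avg k n\<close> is the expectation over the growth.\<close>

definition avg :: "nat \<Rightarrow> nat \<Rightarrow> ((nat \<times> nat) list \<Rightarrow> real) \<Rightarrow> real" where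
  "avg k n \<Phi> = (\<Sum>h\<in>histories k n. \<Phi> h) / real (card (histories k n))"

lemma histories_grown:
  assumes "k \<ge> 1" "h \<in> histories k n"
  shows "length h = n" "grown k n (htree k h)"
proof -
  have "length h = n \<and> grown k n (htree k h)"
    using assms(2)
  proof (induction n arbitrary: h)
    case (Suc n)
    then obtain e h' where h: "h = e # h'" "h' \<in> histories k n" "e \<in> htree k h'"
      by auto
    then show ?case
      using Suc.IH[OF h(2)] grown_split_edge[OF _ h(3) assms(1)] by simp
  qed (use grown_0 in simp)
  then show "length h = n" "grown k n (htree k h)"
    by auto
qed

lemma histories_grown_tree:
  assumes "k \<ge> 1" "h \<in> histories k n"
  shows "grown_tree k n (htree k h)"
  using histories_grown[OF assms] assms(1) by (simp add: grown_tree_def)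

lemma finite_histories: "k \<ge> 1 \<Longrightarrow> finite (histories k n)"
  by (induction n) (auto intro!: finite_imageI finite_SigmaI simp: grown_tree.finite_E[OF histories_grown_tree])

lemma sum_histories_Suc:
  assumes "k \<ge> 1"
  shows "(\<Sum>h\<in>histories k (Suc n). \<Phi> h) = (\<Sum>h\<in>histories k n. \<Sum>e\<in>htree k h. \<Phi> (e # h))"
proof -
  have "inj_on (\<lambda>(h, e). e # h) (SIGMA h:histories k n. htree k h)"
    by (auto simp: inj_on_def)
  then have "(\<Sum>h\<in>histories k (Suc n). \<Phi> h) = (\<Sum>(h, e)\<in>(SIGMA h:histories k n. htree k h). \<Phi> (e # h))"
    by (simp add: sum.reindex case_prod_unfold)
  also have "\<dots> = (\<Sum>h\<in>histories k n. \<Sum>e\<in>htree k h. \<Phi> (e # h))"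
    using assms finite_histories grown_tree.finite_E[OF histories_grown_tree]
    by (subst sum.Sigma) auto
  finally show ?thesis .
qed

lemma card_histories_Suc:
  assumes "k \<ge> 1"
  shows "card (histories k (Suc n)) = (k * n + 1) * card (histories k n)"
  using sum_histories_Suc[OF assms, of "\<lambda>_. 1 :: nat" n] assms
    grown_tree.card_E[OF histories_grown_tree]
  by simp

lemma card_histories_pos: "k \<ge> 1 \<Longrightarrow> card (histories k n) > 0"
  by (induction n) (simp_all add: card_histories_Suc del: histories.simps(2))

text \<open>Every history of length \<open>n\<close> has the same number \<open>k * n + 1\<close> of
  continuations, so dividing the summed drift inequality by the number of histories of length
  \<open>Suc n\<close> gives a recursion for the means.\<close>

lemma avg_step:
  assumes "k \<ge> 1"
    and step: "\<And>h. h \<in> histories k n \<Longrightarrow>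
      (\<Sum>e\<in>htree k h. \<Phi>' (e # h)) \<le> real (k * n + 1) * (a * \<Phi> h + b)"
  shows "avg k (Suc n) \<Phi>' \<le> a * avg k n \<Phi> + b"
proof -
  let ?N = "real (card (histories k n))" and ?P = "real (k * n + 1)"
  have N: "?N > 0" "?P > 0"
    using card_histories_pos[OF assms(1)] by (auto simp: add_pos_nonneg)
  have "(\<Sum>h\<in>histories k (Suc n). \<Phi>' h) \<le> (\<Sum>h\<in>histories k n. ?P * (a * \<Phi> h + b))"
    unfolding sum_histories_Suc[OF assms(1)] by (rule sum_mono) (rule step)
  also have "\<dots> = ?P * (a * (\<Sum>h\<in>histories k n. \<Phi> h) + ?N * b)"
    by (simp add: sum_distrib_left sum.distrib flip: sum_distrib_left)
  finally have "avg k (Suc n) \<Phi>' \<le> ?P * (a * (\<Sum>h\<in>histories k n. \<Phi> h) + ?N * b) / (?P * ?N)"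
    unfolding avg_def card_histories_Suc[OF assms(1)] of_nat_mult[symmetric]
    by (rule divide_right_mono) simp
  also have "\<dots> = a * avg k n \<Phi> + b"
    using N(1) nonzero_mult_divide_mult_cancel_left[of ?P] N(2)
    by (simp add: avg_def add_divide_distrib del: of_nat_add)
  finally show ?thesis .
qed

lemma avg_mono: "(\<And>h. h \<in> histories k n \<Longrightarrow> \<Phi> h \<le> \<Psi> h) \<Longrightarrow> avg k n \<Phi> \<le> avg k n \<Psi>"
  by (simp add: avg_def divide_right_mono sum_mono)

lemma avg_cmult: "avg k n (\<lambda>h. c * \<Phi> h) = c * avg k n \<Phi>"
  by (simp add: avg_def flip: sum_distrib_left)

lemma avg_sum: "avg k n (\<lambda>h. \<Sum>i\<in>I. c i * \<Phi> i h) = (\<Sum>i\<in>I. c i * avg k n (\<Phi> i))"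
proof -
  have "(\<Sum>h\<in>histories k n. \<Sum>i\<in>I. c i * \<Phi> i h) = (\<Sum>i\<in>I. c i * (\<Sum>h\<in>histories k n. \<Phi> i h))"
    by (subst sum.swap) (simp add: sum_distrib_left)
  then show ?thesis
    by (simp add: avg_def sum_divide_distrib[where A = I])
qed

text \<open>With \<open>V\<close> the edges and \<open>D\<close> those on a path,
  \<open>card D\<close> choices of the split edge hit the path and replace \<open>F (card D)\<close>
  by \<open>F (card D + 1)\<close>; the others miss it.\<close>

lemma sum_edge_shift:
  fixes F :: "nat \<Rightarrow> real"
  assumes "finite V" "D \<subseteq> V"
  shows "(\<Sum>v\<in>V. F (card D + (if v \<in> D then 1 else 0))) =
    real (card V) * F (card D) + real (card D) * (F (card D + 1) - F (card D))"
proof -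
  have "(\<Sum>v\<in>V. F (card D + (if v \<in> D then 1 else 0))) =
      (\<Sum>v\<in>V. F (card D) + (if v \<in> D then F (card D + 1) - F (card D) else 0))"
    by (rule sum.cong) auto
  also have "\<dots> = real (card V) * F (card D) + (\<Sum>v\<in>V \<inter> D. F (card D + 1) - F (card D))"
    using assms(1) by (simp add: sum.distrib sum.If_cases Int_def)
  also have "V \<inter> D = D"
    using assms(2) by auto
  finally show ?thesis
    by simp
qed

lemma (in grown_tree) sum_split_edist:
  fixes F :: "nat \<Rightarrow> real"
  assumes "x \<in> Range E" "y \<in> Range E"
  shows "(\<Sum>v\<in>Range E. F (edist E x y + (if v \<in> sym_diff (anc E x) (anc E y) then 1 else 0))) =
    real (k * n + 1) * F (edist E x y) + real (edist E x y) * (F (edist E x y + 1) - F (edist E x y))"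
proof -
  have "sym_diff (anc E x) (anc E y) \<subseteq> Range E"
    using anc_subset by auto
  then show ?thesis
    using sum_edge_shift[of "Range E" "sym_diff (anc E x) (anc E y)" F]
    unfolding edist_def card_Range by simp
qed

text \<open>Bernoulli's inequality for a real exponent, from the weighted arithmetic-geometric mean
  inequality for \<open>1 + q / x\<close> and \<open>1\<close> with weights \<open>1 / q\<close> and
  \<open>1 - 1 / q\<close>. It lets products of factors \<open>1 + q / x\<close> telescope.\<close>

lemma one_plus_le_powr:
  fixes x q :: real
  assumes "x > 0" "q \<ge> 1"
  shows "1 + q / x \<le> ((x + 1) / x) powr q"
proof -
  have pos: "0 < 1 + q / x"
    using assms by (smt (verit) divide_pos_pos)
  have "(1 + q / x) powr (1 / q) * 1 powr (1 - 1 / q) \<le> 1 / q * (1 + q / x) + (1 - 1 / q) * 1"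
    using assms pos by (intro Youngs_inequality_0) auto
  also have "\<dots> = (x + 1) / x"
    using assms by (simp add: field_simps)
  finally have *: "((1 + q / x) powr (1 / q)) powr q \<le> ((x + 1) / x) powr q"
    using assms by (intro powr_mono2) auto
  then show ?thesis
    using * assms pos by (simp add: powr_powr)
qed

section \<open>The energy of the vertex set\<close>

text \<open>The weight decays like \<open>d\<^bsup>-s\<^esup>\<close>. The shift \<open>2k - 2\<close> makes the drift inequality
  \<open>riesz_weight_drift\<close> below an identity for \<open>d > 0\<close>.\<close>

definition riesz_weight :: "nat \<Rightarrow> real \<Rightarrow> nat \<Rightarrow> real" where
  "riesz_weight k s d = (\<Prod>i<d. 1 - s / (real i + 2 * real k - 2))"

text \<open>The sum runs over ordered pairs and includes the diagonal, which contributes the number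
  of vertices; for \<open>s < k\<close> this is of smaller order than
  \<open>n powr (2 - s / k)\<close>.\<close>

definition energy :: "nat \<Rightarrow> real \<Rightarrow> (nat \<times> nat) list \<Rightarrow> real" where
  "energy k s h = (\<Sum>x\<in>Range (htree k h). \<Sum>y\<in>Range (htree k h). riesz_weight k s (edist (htree k h) x y))"

lemma riesz_weight_0 [simp]: "riesz_weight k s 0 = 1"
  by (simp add: riesz_weight_def)

lemma riesz_weight_Suc:
  "riesz_weight k s (Suc d) = riesz_weight k s d * (1 - s / (real d + 2 * real k - 2))"
  by (simp add: riesz_weight_def)

context
  fixes k :: nat and s :: real
  assumes k: "k \<ge> 2" and s: "1 \<le> s" "s < real k"
begin

text \<open>\<open>s < k\<close> and \<open>k \<ge> 2\<close> give \<open>s < 2 * k - 2\<close>;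
  hence all factors of \<open>riesz_weight\<close> lie strictly between 0 and 1.\<close>

lemma denominator_gt: "s < real d + 2 * real k - 2"
proof -
  have "real k \<ge> 2"
    using k by simp
  then show ?thesis
    using s by linarith
qed

lemma riesz_weight_pos: "riesz_weight k s d > 0"
  unfolding riesz_weight_def
proof (intro prod_pos ballI)
  fix i
  show "0 < 1 - s / (real i + 2 * real k - 2)"
    using denominator_gt[of i] s by (simp add: field_simps)
qed

lemma riesz_weight_antimono: "d \<le> d' \<Longrightarrow> riesz_weight k s d' \<le> riesz_weight k s d"
proof (induction rule: dec_induct)
  case (step d')
  have "riesz_weight k s (Suc d') \<le> riesz_weight k s d' * 1"
    unfolding riesz_weight_Suc using denominator_gt[of d'] s riesz_weight_pos[of d']
    by (intro mult_left_mono) auto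
  then show ?case
    using step.IH by simp
qed simp

text \<open>The left side collects what a pair at distance \<open>d\<close> produces in one step:
  the change of its own weight and, in both orders, the weights of the pairs formed with
  \<open>mid\<close> and with the \<open>k - 1\<close> leaves. For \<open>d > 0\<close> it equals
  \<open>(d + 2k - 2) f(d + 1) + (2 - d) f(d)\<close>, which the recursion of the weight turns into
  the right side.\<close>

lemma riesz_weight_drift:
  fixes d defines "f \<equiv> riesz_weight k s"
  shows "real d * (f (d + 1) - f d) + 2 * (f (max 1 d) + real (k - 1) * f (d + 1)) \<le> (2 * real k - s) * f d"
proof (cases "d = 0")
  \<comment> \<open>At \<open>d = 0\<close> the vertex \<open>mid\<close> is at distance 1, so the
    left side is \<open>2k f(1)\<close>; here \<open>2k / (2k - 2) \<ge> 1\<close> yields an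
    inequality only.\<close>
  case True
  have "f 1 = 1 - s / (2 * real k - 2)"
    by (simp add: f_def riesz_weight_def)
  moreover have "s / (2 * real k - 2) * (2 * real k - 2) \<le> s / (2 * real k - 2) * (2 * real k)"
    using denominator_gt[of 0] s by (intro mult_left_mono) auto
  moreover have "s / (2 * real k - 2) * (2 * real k - 2) = s"
    using denominator_gt[of 0] s by simp
  ultimately have "f 1 = 1 - s / (2 * real k - 2)" "2 * real k * (1 - s / (2 * real k - 2)) \<le> 2 * real k - s"
    by (simp_all only: right_diff_distrib mult.commute[of "2 * real k"])
  then have "2 * real k * f 1 \<le> 2 * real k - s"
    by simp
  moreover have "f 0 = 1"
    by (simp add: f_def)
  ultimately show ?thesis
    using k True by (simp add: of_nat_diff algebra_simps)
next
  case False
  let ?D = "real d + 2 * real k - 2"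
  have "?D > 0"
    using denominator_gt[of d] s by linarith
  then have "f (d + 1) * ?D = f d * (?D - s)"
    by (simp add: f_def riesz_weight_Suc field_simps)
  moreover have "max 1 d = d"
    using False by simp
  ultimately show ?thesis
    using k by (simp add: of_nat_diff algebra_simps)
qed

text \<open>Polynomial decay from below, by telescoping: with \<open>x = d + a\<close> the factor
  \<open>1 - s / (x + s)\<close> equals \<open>1 / (1 + s / x)\<close>, and
  \<open>one_plus_le_powr\<close> bounds it below by \<open>(x / (x + 1)) powr s\<close>.\<close>

lemma riesz_weight_ge:
  defines "a \<equiv> 2 * real k - 2 - s"
  shows "(a / (real d + a)) powr s \<le> riesz_weight k s d"
proof (induction d)
  case 0
  have "a > 0" using denominator_gt[of 0] by (simp add: a_def)
  then show ?case by simp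
next
  case (Suc d)
  have a: "a > 0" using denominator_gt[of 0] by (simp add: a_def)
  let ?D = "real d + 2 * real k - 2" and ?x = "real d + a"
  have x: "?x > 0" and D: "?D = ?x + s" "?D > 0"
    using a s by (auto simp: a_def)
  have "(a / (real (Suc d) + a)) powr s = (a / ?x) powr s / ((?x + 1) / ?x) powr s"
  proof -
    have "a / (real (Suc d) + a) = (a / ?x) / ((?x + 1) / ?x)"
      using x by (simp add: add_ac)
    then show ?thesis
      using a x by (simp add: powr_divide add_ac)
  qed
  also have "\<dots> \<le> riesz_weight k s d / (1 + s / ?x)"
    using Suc.IH one_plus_le_powr[OF x s(1)] x s
    by (intro frac_le) (auto simp: add_pos_nonneg less_imp_le[OF riesz_weight_pos])
  also have "\<dots> = riesz_weight k s d * (1 / (1 + s / ?x))"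
    by simp
  also have "1 / (1 + s / ?x) = 1 - s / ?D"
    using x D s by (simp add: field_simps)
  also have "riesz_weight k s d * (1 - s / ?D) = riesz_weight k s (Suc d)"
    by (simp add: riesz_weight_Suc)
  finally show ?case .
qed

end

section \<open>The drift of the energy under one split\<close>

context split_tree
begin

lemma sum_Range_E':
  fixes F :: "nat \<Rightarrow> real"
  shows "(\<Sum>x\<in>Range E'. F x) = (\<Sum>x\<in>Range E. F x) + (\<Sum>x\<in>{mid..<mid + k}. F x)"
proof -
  have "x \<notin> {mid..<mid + k}" if "x \<in> Range E" for x
    using Range_less[OF that] by simp
  then have "Range E \<inter> {mid..<mid + k} = {}"
    by blast
  then show ?thesis
    unfolding Range_E' by (intro sum.union_disjoint) auto
qed

lemma sum_new_edist_le:
  fixes f :: "nat \<Rightarrow> real"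
  assumes f: "antimono f" and y: "y \<in> Range E"
  shows "(\<Sum>z\<in>{mid..<mid + k}. f (edist E' z y)) \<le>
    f (max 1 (edist E v y)) + real (k - 1) * f (edist E v y + 1)"
proof -
  have "(\<Sum>z\<in>{mid..<mid + k}. f (edist E' z y)) =
      f (edist E' mid y) + (\<Sum>z\<in>{Suc mid..<mid + k}. f (edist E' z y))"
    using k1 by (subst sum.atLeast_Suc_lessThan) auto
  also have "f (edist E' mid y) \<le> f (max 1 (edist E v y))"
    using f edist_mid_ge[OF y] by (rule antimonoD)
  also have "(\<Sum>z\<in>{Suc mid..<mid + k}. f (edist E' z y)) \<le>
      (\<Sum>z\<in>{Suc mid..<mid + k}. f (edist E v y + 1))"
  proof (intro sum_mono)
    fix z assume "z \<in> {Suc mid..<mid + k}"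
    then have "edist E' (mid + (z - mid)) y = edist E' mid y + 1"
      using y by (intro edist_leaf) auto
    then have "edist E v y + 1 \<le> edist E' z y"
      using edist_mid_ge[OF y] \<open>z \<in> _\<close> by simp
    then show "f (edist E' z y) \<le> f (edist E v y + 1)"
      using f by (simp add: antimonoD)
  qed
  finally show ?thesis
    by simp
qed

text \<open>The new vertex set is divided into old and new labels: pairs of old vertices are
  shifted, mixed pairs occur in both orders, and each of the \<open>k * k\<close> pairs of new
  vertices has weight at most 1.\<close>

lemma energy_split_le:
  fixes f :: "nat \<Rightarrow> real"
  assumes f: "antimono f" "\<And>d. f d \<le> 1"
  shows "(\<Sum>x\<in>Range E'. \<Sum>y\<in>Range E'. f (edist E' x y)) \<le>
    (\<Sum>x\<in>Range E. \<Sum>y\<in>Range E. f (edist E x y + (if v \<in> sym_diff (anc E x) (anc E y) then 1 else 0)))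
    + 2 * (\<Sum>y\<in>Range E. f (max 1 (edist E v y)) + real (k - 1) * f (edist E v y + 1)) + (real k)\<^sup>2"
proof -
  let ?N = "{mid..<mid + k}"
  let ?A = "\<Sum>x\<in>Range E. \<Sum>y\<in>Range E. f (edist E' x y)"
  let ?B = "\<Sum>y\<in>Range E. \<Sum>z\<in>?N. f (edist E' z y)"
  let ?C = "\<Sum>x\<in>?N. \<Sum>y\<in>?N. f (edist E' x y)"
  have 1: "(\<Sum>x\<in>Range E. \<Sum>y\<in>?N. f (edist E' x y)) = ?B"
    by (intro sum.cong refl, subst split.edist_commute, rule refl)
  have 2: "(\<Sum>x\<in>?N. \<Sum>y\<in>Range E. f (edist E' x y)) = ?B"
    by (rule sum.swap)
  have "(\<Sum>x\<in>Range E'. \<Sum>y\<in>Range E'. f (edist E' x y)) = ?A + ?B + (?B + ?C)"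
    by (simp only: sum_Range_E' sum.distrib 1 2)
  moreover have "?B \<le> (\<Sum>y\<in>Range E. f (max 1 (edist E v y)) + real (k - 1) * f (edist E v y + 1))"
    by (intro sum_mono sum_new_edist_le[OF f(1)])
  moreover have "?C \<le> (\<Sum>x\<in>?N. \<Sum>y\<in>?N. 1)"
    by (intro sum_mono f(2))
  moreover have "(\<Sum>x\<in>?N. \<Sum>y\<in>?N. 1) = (real k)\<^sup>2"
    by (simp add: power2_eq_square)
  moreover have "?A =
    (\<Sum>x\<in>Range E. \<Sum>y\<in>Range E. f (edist E x y + (if v \<in> sym_diff (anc E x) (anc E y) then 1 else 0)))"
    by (intro sum.cong refl) (simp only: edist_old)
  ultimately show ?thesis
    by linarith
qed

end

lemma (in grown_tree) split_treeI: "e \<in> E \<Longrightarrow> split_tree k n E (fst e) (snd e)"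
  by unfold_locales (metis prod.collapse)

text \<open>Summing over the split edge and exchanging sums, a pair at distance \<open>d\<close> is
  lengthened by \<open>d\<close> of the edges. The split edge is named by a vertex, so the mixed
  terms also form a sum over pairs of vertices, and \<open>riesz_weight_drift\<close> applies pair
  by pair.\<close>

lemma energy_step:
  assumes k: "k \<ge> 2" and s: "1 \<le> s" "s < real k" and h: "h \<in> histories k n"
  shows "(\<Sum>e\<in>htree k h. energy k s (e # h)) \<le>
    real (k * n + 1) * ((1 + (2 * real k - s) / real (k * n + 1)) * energy k s h + (real k)\<^sup>2)"
proof -
  define E where "E = htree k h"
  define f where "f = riesz_weight k s"
  have k1: "k \<ge> 1"
    using k by simp
  interpret grown_tree k n E
    unfolding E_def by (rule histories_grown_tree[OF k1 h])
  let ?P = "real (k * n + 1)"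
  have P: "?P > 0"
    by (simp only: of_nat_0_less_iff)
  have anti: "antimono f"
    unfolding f_def by (intro antimonoI riesz_weight_antimono[OF k s])
  have le1: "f d \<le> 1" for d
    using antimonoD[OF anti, of 0 d] by (simp add: f_def)
  let ?shift = "\<lambda>v. \<Sum>x\<in>Range E. \<Sum>y\<in>Range E.
      f (edist E x y + (if v \<in> sym_diff (anc E x) (anc E y) then 1 else 0))"
  let ?new = "\<lambda>v. \<Sum>y\<in>Range E. f (max 1 (edist E v y)) + real (k - 1) * f (edist E v y + 1)"
  let ?d = "edist E"
  have step: "energy k s (e # h) \<le> ?shift (snd e) + 2 * ?new (snd e) + (real k)\<^sup>2" if "e \<in> E" for e
  proof -
    interpret split_tree k n E "fst e" "snd e"
      using that by (rule split_treeI)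
    have "htree k (e # h) = E'"
      using histories_grown(1)[OF k1 h] by (simp add: E'_def mid_def flip: E_def)
    then show ?thesis
      unfolding energy_def f_def[symmetric] using energy_split_le[OF anti le1] by simp
  qed
  let ?drift = "\<lambda>d. real d * (f (d + 1) - f d)" and ?g = "\<lambda>d. f (max 1 d) + real (k - 1) * f (d + 1)"
  have split_sum: "(\<Sum>v\<in>V. a v + 2 * b v + c) = sum a V + 2 * sum b V + real (card V) * c"
    for a b :: "nat \<Rightarrow> real" and c V
    by (simp add: sum.distrib sum_distrib_left)
  have "(\<Sum>e\<in>E. energy k s (e # h)) \<le> (\<Sum>e\<in>E. ?shift (snd e) + 2 * ?new (snd e) + (real k)\<^sup>2)"
    by (intro sum_mono step)
  also have "\<dots> = (\<Sum>v\<in>Range E. ?shift v + 2 * ?new v + (real k)\<^sup>2)"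
    by (rule sum_edges)
  also have "\<dots> = (\<Sum>v\<in>Range E. ?shift v) + 2 * (\<Sum>v\<in>Range E. ?new v) + ?P * (real k)\<^sup>2"
    by (simp only: split_sum card_Range)
  finally have 1: "(\<Sum>e\<in>E. energy k s (e # h)) \<le>
      (\<Sum>v\<in>Range E. ?shift v) + 2 * (\<Sum>v\<in>Range E. ?new v) + ?P * (real k)\<^sup>2" .
  have "(\<Sum>v\<in>Range E. ?shift v) = (\<Sum>x\<in>Range E. \<Sum>y\<in>Range E. \<Sum>v\<in>Range E.
      f (edist E x y + (if v \<in> sym_diff (anc E x) (anc E y) then 1 else 0)))"
    by (rule trans[OF sum.swap sum.cong[OF refl sum.swap]])
  also have "\<dots> = (\<Sum>x\<in>Range E. \<Sum>y\<in>Range E. ?P * f (?d x y) + ?drift (?d x y))"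
    by (intro sum.cong refl sum_split_edist)
  finally have 2: "(\<Sum>v\<in>Range E. ?shift v) =
      (\<Sum>x\<in>Range E. \<Sum>y\<in>Range E. ?P * f (?d x y) + ?drift (?d x y))" .
  have 3: "(\<Sum>x\<in>Range E. \<Sum>y\<in>Range E. ?P * f (?d x y) + ?drift (?d x y)) + 2 * (\<Sum>v\<in>Range E. ?new v) =
      (\<Sum>x\<in>Range E. \<Sum>y\<in>Range E. ?P * f (?d x y) + (?drift (?d x y) + 2 * ?g (?d x y)))"
    by (simp only: sum_distrib_left sum.distrib[symmetric] add.assoc)
  have 4: "\<dots> \<le> (\<Sum>x\<in>Range E. \<Sum>y\<in>Range E. ?P * f (?d x y) + (2 * real k - s) * f (?d x y))"
    unfolding f_def by (intro sum_mono add_left_mono riesz_weight_drift[OF k s])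
  have 5: "(\<Sum>x\<in>Range E. \<Sum>y\<in>Range E. ?P * f (?d x y) + (2 * real k - s) * f (?d x y)) =
      (?P + (2 * real k - s)) * energy k s h"
    unfolding energy_def f_def[symmetric] E_def[symmetric]
    by (simp only: sum_distrib_left distrib_right[symmetric])
  have "(\<Sum>e\<in>E. energy k s (e # h)) \<le> (?P + (2 * real k - s)) * energy k s h + ?P * (real k)\<^sup>2"
    using 1 2 3 4 5 by linarith
  also have "\<dots> = ?P * ((1 + (2 * real k - s) / ?P) * energy k s h + (real k)\<^sup>2)"
    using P by (simp add: field_simps del: of_nat_add of_nat_mult)
  finally show ?thesis
    unfolding E_def .
qed

text \<open>The recursion of the means is solved by the supersolution
  \<open>A * x powr q - B * x\<close> with \<open>x = n + 1 / k\<close>.\<close>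

lemma avg_energy_le:
  assumes k: "k \<ge> 2" and s: "1 \<le> s" "s < real k"
  obtains A where "A > 0" "\<And>n. n \<ge> 1 \<Longrightarrow> avg k n (energy k s) \<le> A * real n powr (2 - s / real k)"
proof -
  have kr: "real k \<ge> 2"
    using k by simp
  \<comment> \<open>In terms of \<open>x n\<close> below, the relative drift
    \<open>(2k - s) / (kn + 1)\<close> is \<open>q / x n\<close>. The bound \<open>q > 1\<close> is
    where \<open>s < k\<close> enters.\<close>
  define q where "q = 2 - s / real k"
  have q: "q > 1" "q \<ge> 1"
    using s kr by (auto simp: q_def)
  define x where "x n = real n + 1 / real k" for n
  have x: "x n > 0" for n
    using kr by (simp add: x_def add_nonneg_pos)
  \<comment> \<open>The linear term has to absorb the constant \<open>k * k\<close> of each step,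
    which amounts to \<open>B * q = B + k * k\<close>.\<close>
  define B where "B = (real k)\<^sup>2 / (q - 1)"
  have B: "B > 0" "B * q = B + (real k)\<^sup>2"
    using q kr by (auto simp: B_def field_simps)
  \<comment> \<open>This choice makes the bound an equality at \<open>n = 0\<close>, where the
    energy is 1.\<close>
  define A where "A = (1 + B * x 0) / x 0 powr q"
  have A: "A > 0"
    using B x[of 0] by (simp add: A_def add_pos_pos)
  have "avg k n (energy k s) \<le> A * x n powr q - B * x n" for n
  proof (induction n)
    case 0
    have "Range {(0 :: nat, 1 :: nat)} = {1}"
      by auto
    then have "avg k 0 (energy k s) = 1"
      by (simp add: avg_def energy_def edist_def)
    then show ?case
      using x[of 0] by (simp add: A_def)
  next
    case (Suc n)
    have k0: "k \<ge> 1"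
      using k by simp
    have P: "(2 * real k - s) / real (k * n + 1) = q / x n"
    proof -
      have "2 * real k - s = real k * q" "real (k * n + 1) = real k * x n"
        using kr by (auto simp: q_def x_def field_simps)
      then show ?thesis
        using kr by simp
    qed
    have "avg k (Suc n) (energy k s) \<le> (1 + q / x n) * avg k n (energy k s) + (real k)\<^sup>2"
      unfolding P[symmetric] by (rule avg_step[OF k0]) (rule energy_step[OF k s])
    also have "\<dots> \<le> (1 + q / x n) * (A * x n powr q - B * x n) + (real k)\<^sup>2"
      using Suc.IH x[of n] q by (intro add_right_mono mult_left_mono) auto
    also have "\<dots> = A * (x n powr q * (1 + q / x n)) - B * x n - B * q + (real k)\<^sup>2"
      using x[of n] by (simp add: field_simps)
    also have "x n powr q * (1 + q / x n) \<le> x n powr q * ((x n + 1) / x n) powr q"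
      using one_plus_le_powr[OF x q(2)] by (intro mult_left_mono) auto
    also have "x n powr q * ((x n + 1) / x n) powr q = x (Suc n) powr q"
      using x[of n] by (simp add: powr_divide x_def add_ac)
    finally show ?case
      using A B by (simp add: x_def algebra_simps)
  qed
  moreover have "A * x n powr q - B * x n \<le> A * 2 powr q * real n powr q" if "n \<ge> 1" for n
  proof -
    have "1 / real k \<le> 1" "1 \<le> real n"
      using that kr by auto
    then have "x n \<le> 2 * real n"
      by (simp add: x_def)
    then have "x n powr q \<le> (2 * real n) powr q"
      using x[of n] q by (intro powr_mono2) auto
    then have "A * x n powr q \<le> A * 2 powr q * real n powr q"
      using A by (simp add: powr_mult)
    moreover have "B * x n > 0"
      using B x[of n] by simp
    ultimately show ?thesis
      by linarith
  qed
  ultimately show ?thesis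
    using A by (intro that[of "A * 2 powr q"]) (auto simp: q_def intro: order_trans)
qed

section \<open>Chaining through the vertices of earlier trees\<close>

text \<open>The product \<open>(d + 1)(d + 2)...(d + p)\<close> stands in for \<open>d ^ p\<close>:
  it dominates that power, and its increments satisfy the exact relation
  \<open>(d + 1) (F(d + 1) - F(d)) = p F(d)\<close>, so the drift has no lower-order terms.\<close>

definition rising :: "nat \<Rightarrow> nat \<Rightarrow> real" where
  "rising p d = pochhammer (real d + 1) p"

lemma rising_pos: "rising p d > 0"
  unfolding rising_def by (rule pochhammer_pos) simp

lemma rising_0: "rising p 0 = fact p"
  by (simp add: rising_def pochhammer_fact)

lemma rising_Suc: "(real d + 1) * rising p (Suc d) = rising p d * (real d + 1 + real p)"
  using pochhammer_rec[of "real d + 1" p] pochhammer_rec'[of "real d + 1" p]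
  by (simp add: rising_def add_ac mult_ac)

lemma rising_le_Suc: "rising p d \<le> rising p (Suc d)"
proof -
  have "(real d + 1) * rising p d \<le> (real d + 1) * rising p (Suc d)"
    unfolding rising_Suc using rising_pos[of p d] by (simp add: algebra_simps)
  then show ?thesis
    by simp
qed

lemma rising_mono: "d \<le> d' \<Longrightarrow> rising p d \<le> rising p d'"
  by (rule lift_Suc_mono_le[of "rising p"]) (rule rising_le_Suc)

lemma rising_drift: "real d * (rising p (d + 1) - rising p d) \<le> real p * rising p d"
proof -
  have "real d * (rising p (d + 1) - rising p d) \<le> (real d + 1) * (rising p (d + 1) - rising p d)"
    using rising_le_Suc[of p d] by (intro mult_right_mono) auto
  then show ?thesis
    using rising_Suc[of d p] by (simp add: algebra_simps)
qed

lemma rising_Suc_le: "rising p (Suc d) \<le> (1 + real p) * rising p d"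
proof -
  have "rising p d * (real d + 1 + real p) \<le> rising p d * ((real d + 1) * (1 + real p))"
    using rising_pos[of p d] by (intro mult_left_mono) (auto simp: algebra_simps)
  then have "(real d + 1) * rising p (Suc d) \<le> (real d + 1) * ((1 + real p) * rising p d)"
    unfolding rising_Suc by (simp add: mult_ac)
  then show ?thesis
    by simp
qed

lemma power_le_rising: "real d ^ p \<le> rising p d"
proof -
  have "(\<Prod>i = 0..<p. real d) \<le> (\<Prod>i = 0..<p. real d + 1 + real i)"
    by (intro prod_mono) auto
  then show ?thesis
    by (simp add: rising_def pochhammer_prod)
qed

definition near :: "(nat \<times> nat) set \<Rightarrow> nat set \<Rightarrow> nat \<Rightarrow> nat" where
  "near E W x = Min (edist E x ` W)"

lemma near_le: "finite W \<Longrightarrow> y \<in> W \<Longrightarrow> near E W x \<le> edist E x y"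
  by (simp add: near_def)

lemma near_attained:
  assumes "finite W" "W \<noteq> {}"
  obtains y where "y \<in> W" "near E W x = edist E x y"
proof -
  have "near E W x \<in> edist E x ` W"
    unfolding near_def using assms by (intro Min_in) auto
  then show ?thesis
    using that by blast
qed

text \<open>A new vertex is \<open>mid\<close> or adjacent to it, and by \<open>edist_mid\<close>
  the vertex \<open>mid\<close> is at most one edge further from a given old vertex than
  \<open>v\<close> was.\<close>

lemma (in split_tree) near_new_le:
  assumes W: "W \<subseteq> Range E" "W \<noteq> {}" and z: "z \<in> {mid..<mid + k}"
  shows "near E' W z \<le> near E W v + 2"
proof -
  have fin: "finite W"
    using W finite_Range_E finite_subset by blast
  obtain y where y: "y \<in> W" "near E W v = edist E v y"
    using near_attained[OF fin W(2)] by metis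
  have yE: "y \<in> Range E"
    using y W by blast
  have "edist E' z y \<le> edist E' mid y + 1"
  proof (cases "z = mid")
    case False
    then have "1 \<le> z - mid" "z - mid < k" "mid + (z - mid) = z"
      using z by auto
    then show ?thesis
      using edist_leaf[OF yE, of "z - mid"] by simp
  qed simp
  also have "edist E' mid y \<le> edist E v y + 1"
    using edist_mid[OF yE] by simp
  finally show ?thesis
    using near_le[OF fin y(1), of E' z] y(2) by simp
qed

section \<open>Moments of the distance to the vertices of an earlier tree\<close>

context grown_tree
begin

text \<open>The nearest point \<open>y\<close> of \<open>W\<close> is kept fixed: after the split
  the distance to \<open>W\<close> is at most the distance to this \<open>y\<close>, whose mean
  change is known from \<open>sum_split_edist\<close>.\<close>

lemma sum_near_split_le:
  assumes W: "W \<subseteq> Range E" "W \<noteq> {}" and x: "x \<in> Range E"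
  shows "(\<Sum>e\<in>E. rising p (near (split_edge k (2 + k * n) e E) W x)) \<le>
    (real (k * n + 1) + real p) * rising p (near E W x)"
proof -
  have fin: "finite W"
    using W finite_Range_E finite_subset by blast
  obtain y where y: "y \<in> W" "near E W x = edist E x y"
    using near_attained[OF fin W(2)] by metis
  have yE: "y \<in> Range E"
    using y W by blast
  let ?d = "edist E x y"
  let ?s = "\<lambda>v. ?d + (if v \<in> sym_diff (anc E x) (anc E y) then 1 else 0)"
  have "(\<Sum>e\<in>E. rising p (near (split_edge k (2 + k * n) e E) W x)) \<le> (\<Sum>e\<in>E. rising p (?s (snd e)))"
  proof (intro sum_mono rising_mono)
    fix e assume "e \<in> E"
    then interpret split_tree k n E "fst e" "snd e"
      by (rule split_treeI)
    have "near E' W x \<le> edist E' x y"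
      using fin y(1) by (rule near_le)
    then show "near (split_edge k (2 + k * n) e E) W x \<le> ?s (snd e)"
      unfolding edist_old[OF x yE] by (simp add: E'_def mid_def)
  qed
  also have "\<dots> = (\<Sum>v\<in>Range E. rising p (?s v))"
    by (rule sum_edges)
  also have "\<dots> = real (k * n + 1) * rising p ?d + real ?d * (rising p (?d + 1) - rising p ?d)"
    by (rule sum_split_edist[OF x yE])
  also have "\<dots> \<le> real (k * n + 1) * rising p ?d + real p * rising p ?d"
    by (intro add_left_mono rising_drift)
  finally show ?thesis
    by (simp only: y(2) distrib_right)
qed

end

text \<open>The vertices other than the root after the first \<open>m\<close> steps of
  \<open>h\<close>. Splitting keeps old labels, so these can be located inside the current
  tree.\<close>

definition vertices :: "nat \<Rightarrow> nat \<Rightarrow> (nat \<times> nat) list \<Rightarrow> nat set" where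
  "vertices k m h = Range (htree k (drop (length h - m) h))"

lemma vertices_Cons: "m \<le> length h \<Longrightarrow> vertices k m (e # h) = vertices k m h"
  by (simp add: vertices_def Suc_diff_le)

lemma vertices_self: "length h = n \<Longrightarrow> vertices k n h = Range (htree k h)"
  by (simp add: vertices_def)

lemma drop_histories:
  "k \<ge> 1 \<Longrightarrow> h \<in> histories k n \<Longrightarrow> m \<le> n \<Longrightarrow> drop (n - m) h \<in> histories k m"
proof (induction n arbitrary: h)
  case (Suc n)
  then show ?case
    by (cases "m = Suc n") (auto simp: Suc_diff_le)
qed simp

context
  fixes k :: nat
  assumes k: "k \<ge> 1"
begin

lemma vertices_subset:
  assumes "h \<in> histories k n" "m \<le> n"
  shows "vertices k m h \<subseteq> Range (htree k h)"
  using assms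
proof (induction n arbitrary: h)
  case 0
  then show ?case
    by (simp add: vertices_def)
next
  case (Suc n)
  then obtain e h' where h: "h = e # h'" "h' \<in> histories k n" "e \<in> htree k h'"
    by auto
  have len: "length h' = n"
    using histories_grown(1)[OF k h(2)] .
  show ?case
  proof (cases "m = Suc n")
    case True
    then show ?thesis
      using len h(1) by (simp add: vertices_self)
  next
    case False
    then have "vertices k m h \<subseteq> Range (htree k h')"
      using Suc.IH[OF h(2)] Suc.prems(2) len by (simp add: h(1) vertices_Cons)
    also have "\<dots> \<subseteq> Range (htree k h)"
      using Range_split_edge[OF h(3) k] by (auto simp: h(1))
    finally show ?thesis .
  qed
qed

lemma card_vertices:
  assumes "h \<in> histories k n" "m \<le> n"
  shows "card (vertices k m h) = k * m + 1" "finite (vertices k m h)" "vertices k m h \<noteq> {}"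
proof -
  have len: "length h = n"
    using histories_grown(1)[OF k assms(1)] .
  interpret grown_tree k m "htree k (drop (n - m) h)"
    using drop_histories[OF k assms] histories_grown_tree k by blast
  show *: "card (vertices k m h) = k * m + 1" "finite (vertices k m h)"
    using card_Range by (simp_all add: vertices_def len)
  then show "vertices k m h \<noteq> {}"
    by auto
qed

text \<open>An unnormalised \<open>p\<close>-th moment with three times: the net is that of time
  \<open>m\<close>, the points are those of time \<open>m'\<close>, and distances are measured in
  the tree of the whole history \<open>h\<close>.\<close>

definition near_sum :: "nat \<Rightarrow> nat \<Rightarrow> nat \<Rightarrow> (nat \<times> nat) list \<Rightarrow> real" where
  "near_sum p m m' h = (\<Sum>x\<in>vertices k m' h. rising p (near (htree k h) (vertices k m h) x))"

lemma near_sum_nonneg: "near_sum p m m' h \<ge> 0"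
  unfolding near_sum_def using rising_pos by (intro sum_nonneg) (simp add: less_imp_le)

lemma avg_near_sum_nonneg: "avg k n (near_sum p m m') \<ge> 0"
  unfolding avg_def using near_sum_nonneg by (intro divide_nonneg_nonneg sum_nonneg) auto

text \<open>Once time \<open>m'\<close> has passed, later steps change neither the net nor the
  points; only the distances grow, with relative rate at most
  \<open>p / (k * n + 1)\<close>.\<close>

lemma near_sum_frozen_step:
  assumes h: "h \<in> histories k n" and m: "m \<le> m'" "m' \<le> n"
  shows "(\<Sum>e\<in>htree k h. near_sum p m m' (e # h)) \<le> (real (k * n + 1) + real p) * near_sum p m m' h"
proof -
  have len: "length h = n"
    using histories_grown(1)[OF k h] .
  interpret grown_tree k n "htree k h"
    by (rule histories_grown_tree[OF k h])
  let ?W = "vertices k m h" and ?V = "vertices k m' h"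
  have sub: "?W \<subseteq> Range (htree k h)" "?V \<subseteq> Range (htree k h)" "?W \<noteq> {}"
    using vertices_subset[OF h] card_vertices(3)[OF h] m by auto
  have "(\<Sum>e\<in>htree k h. near_sum p m m' (e # h)) =
      (\<Sum>x\<in>?V. \<Sum>e\<in>htree k h. rising p (near (split_edge k (2 + k * n) e (htree k h)) ?W x))"
    using m by (subst sum.swap) (simp add: near_sum_def vertices_Cons len)
  also have "\<dots> \<le> (\<Sum>x\<in>?V. (real (k * n + 1) + real p) * rising p (near (htree k h) ?W x))"
    using sub by (intro sum_mono sum_near_split_le) auto
  finally show ?thesis
    by (simp only: near_sum_def sum_distrib_left)
qed

text \<open>While the points still grow, a split at \<open>v\<close> adds \<open>k\<close> points
  whose distance to the net exceeds that of \<open>v\<close> by at most 2. Two uses of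
  \<open>rising_Suc_le\<close> bound each new term by \<open>(1 + p) * (1 + p)\<close> times the
  term of \<open>v\<close>, and summing over \<open>v\<close> reproduces
  \<open>near_sum\<close>.\<close>

lemma near_sum_growing_step:
  assumes h: "h \<in> histories k n" and m: "m \<le> n"
  shows "(\<Sum>e\<in>htree k h. near_sum p m (Suc n) (e # h)) \<le>
    (real (k * n + 1) + (real p + real k * (1 + real p)\<^sup>2)) * near_sum p m n h"
proof -
  have len: "length h = n"
    using histories_grown(1)[OF k h] .
  define E where "E = htree k h"
  interpret grown_tree k n E
    unfolding E_def by (rule histories_grown_tree[OF k h])
  let ?W = "vertices k m h" and ?g = "real k * (1 + real p)\<^sup>2"
  have VE: "vertices k n h = Range E"
    using len by (simp add: vertices_self E_def)
  have sub: "?W \<subseteq> Range E" "?W \<noteq> {}"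
    using vertices_subset[OF h m] card_vertices(3)[OF h m] by (auto simp: E_def)
  have step: "near_sum p m (Suc n) (e # h) \<le> near_sum p m n (e # h) + ?g * rising p (near E ?W (snd e))"
    if e: "e \<in> E" for e
  proof -
    interpret split_tree k n E "fst e" "snd e"
      using e by (rule split_treeI)
    have E': "htree k (e # h) = E'"
      using len by (simp add: E'_def mid_def flip: E_def)
    have "near_sum p m (Suc n) (e # h) = (\<Sum>x\<in>Range E'. rising p (near E' ?W x))"
      using m len vertices_self[of "e # h" "Suc n" k]
      by (simp only: near_sum_def vertices_Cons E') simp
    also have "\<dots> = near_sum p m n (e # h) + (\<Sum>x\<in>{mid..<mid + k}. rising p (near E' ?W x))"
      unfolding sum_Range_E' using m len
      by (simp only: near_sum_def vertices_Cons E') (simp add: vertices_Cons VE)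
    also have "(\<Sum>x\<in>{mid..<mid + k}. rising p (near E' ?W x)) \<le>
        (\<Sum>x\<in>{mid..<mid + k}. rising p (near E ?W (snd e) + 2))"
      using sub by (intro sum_mono rising_mono near_new_le)
    also have "\<dots> = real k * rising p (near E ?W (snd e) + 2)"
      by simp
    also have "rising p (near E ?W (snd e) + 2) \<le> (1 + real p)\<^sup>2 * rising p (near E ?W (snd e))"
    proof -
      let ?d = "near E ?W (snd e)"
      have "rising p (Suc (Suc ?d)) \<le> (1 + real p) * rising p (Suc ?d)"
        by (rule rising_Suc_le)
      also have "\<dots> \<le> (1 + real p) * ((1 + real p) * rising p ?d)"
        by (intro mult_left_mono rising_Suc_le) auto
      finally show ?thesis
        by (simp add: power2_eq_square)
    qed
    finally show ?thesis
      by (simp add: mult_left_mono)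
  qed
  have "(\<Sum>e\<in>E. near_sum p m (Suc n) (e # h)) \<le>
      (\<Sum>e\<in>E. near_sum p m n (e # h)) + (\<Sum>e\<in>E. ?g * rising p (near E ?W (snd e)))"
    unfolding sum.distrib[symmetric] by (intro sum_mono step)
  also have "(\<Sum>e\<in>E. ?g * rising p (near E ?W (snd e))) = ?g * near_sum p m n h"
    unfolding near_sum_def VE E_def[symmetric] sum_distrib_left by (rule sum_edges)
  also have "(\<Sum>e\<in>E. near_sum p m n (e # h)) \<le> (real (k * n + 1) + real p) * near_sum p m n h"
    unfolding E_def using near_sum_frozen_step[OF h m order_refl] .
  finally show ?thesis
    unfolding E_def by (simp add: algebra_simps)
qed

end

text \<open>The factors are bounded by \<open>((x + 1) / x) powr q\<close> with
  \<open>x = i + 1 / k\<close>, and these telescope.\<close>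

lemma powr_growth:
  fixes a :: "nat \<Rightarrow> real"
  assumes k: "k \<ge> 1" and q: "q \<ge> 1" and nonneg: "\<And>i. a i \<ge> 0"
    and step: "\<And>i. m \<le> i \<Longrightarrow> a (Suc i) \<le> (1 + q / (real i + 1 / real k)) * a i"
    and n: "m \<le> n"
  shows "a n \<le> a m * ((real n + 1 / real k) / (real m + 1 / real k)) powr q"
  using n
proof (induction rule: dec_induct)
  case base
  have "real m + 1 / real k > 0"
    using k by (simp add: add_nonneg_pos)
  then show ?case
    by simp
next
  case (step i)
  define x where "x i = real i + 1 / real k" for i
  have x: "x i > 0" for i
    using k by (simp add: x_def add_nonneg_pos)
  have "a (Suc i) \<le> (1 + q / x i) * a i"
    using assms(4)[OF step.hyps(1)] by (simp add: x_def)
  also have "\<dots> \<le> ((x i + 1) / x i) powr q * (a m * (x i / x m) powr q)"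
    using one_plus_le_powr[OF x q] step.IH nonneg[of i] by (intro mult_mono) (auto simp: x_def)
  also have "\<dots> = a m * (x (Suc i) / x m) powr q"
    using x[of i] x[of m] by (simp add: powr_divide x_def add_ac)
  finally show ?case
    by (simp add: x_def)
qed

context
  fixes k p :: nat
  assumes k: "k \<ge> 1" and p: "p \<ge> k"
begin

text \<open>The rate while the point set grows, larger than the sharp rate \<open>p / k\<close>.
  This phase lasts only from \<open>m\<close> to at most \<open>2 * m\<close>, so the excess costs a
  constant factor.\<close>

definition growth_exponent :: real where
  "growth_exponent = (real p + real k * (1 + real p)\<^sup>2) / real k"

definition near_const :: real where
  "near_const = (real k + 1) * fact p * 2 powr growth_exponent * 2 powr (real p / real k)"

lemma near_const_pos: "near_const > 0"
  by (simp add: near_const_def)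

text \<open>Two phases: from \<open>m\<close> to \<open>m'\<close> the points grow with the tree,
  over at most a doubling of time; from \<open>m'\<close> to \<open>n\<close> they are frozen and
  the exponent \<open>p / k\<close> applies.\<close>

lemma avg_near_sum_le:
  assumes m: "1 \<le> m" "m \<le> m'" "m' \<le> 2 * m" "m' \<le> n"
  shows "avg k n (near_sum k p m m') \<le> near_const * real m * (real n / real m) powr (real p / real k)"
proof -
  define x where "x i = real i + 1 / real k" for i
  have x: "x i > 0" for i
    using k by (simp add: x_def add_nonneg_pos)
  have P: "real (k * i + 1) = real k * x i" for i
    using k by (simp add: x_def field_simps)
  have factor: "(real (k * i + 1) + r) * s = real (k * i + 1) * ((1 + (r / real k) / x i) * s + 0)" for i r s
    unfolding P using k x[of i] by (simp add: field_simps)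
  \<comment> \<open>At time \<open>m\<close> net and points coincide, so every distance is 0 and
    contributes \<open>rising p 0 = fact p\<close>.\<close>
  have base: "avg k m (near_sum k p m m) \<le> (real k + 1) * real m * fact p"
  proof -
    have "near_sum k p m m h \<le> (real k + 1) * real m * fact p" if h: "h \<in> histories k m" for h
    proof -
      have "near_sum k p m m h \<le> (\<Sum>v\<in>vertices k m h. rising p 0)"
        unfolding near_sum_def[OF k]
      proof (intro sum_mono rising_mono)
        fix v assume v: "v \<in> vertices k m h"
        interpret grown_tree k m "htree k h"
          by (rule histories_grown_tree[OF k h])
        show "near (htree k h) (vertices k m h) v \<le> 0"
          using near_le[OF card_vertices(2)[OF k h order_refl] v, of "htree k h" v] by simp
      qed
      also have "\<dots> = (real k * real m + 1) * fact p"
        using card_vertices(1)[OF k h order_refl] by (simp add: rising_0 add_ac)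
      also have "\<dots> \<le> (real k + 1) * real m * fact p"
        using m by (intro mult_right_mono) (auto simp: algebra_simps)
      finally show ?thesis .
    qed
    then have "avg k m (near_sum k p m m) \<le> avg k m (\<lambda>_. (real k + 1) * real m * fact p)"
      by (rule avg_mono)
    also have "\<dots> = (real k + 1) * real m * fact p"
      using card_histories_pos[OF k, of m] by (simp add: avg_def)
    finally show ?thesis .
  qed
  have g1: "growth_exponent \<ge> 1" "real p / real k \<ge> 1"
  proof -
    show *: "real p / real k \<ge> 1"
      using k p by simp
    have "growth_exponent = real p / real k + (1 + real p)\<^sup>2"
      using k by (simp add: growth_exponent_def field_simps)
    then show "growth_exponent \<ge> 1"
      using * by (smt (verit) zero_le_power2)
  qed
  have "avg k m' (near_sum k p m m') \<le> avg k m (near_sum k p m m) * (x m' / x m) powr growth_exponent"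
    unfolding x_def
  proof (rule powr_growth[where a = "\<lambda>i. avg k i (near_sum k p m i)", OF k g1(1) avg_near_sum_nonneg[OF k] _ m(2)])
    fix i assume i: "m \<le> i"
    have "avg k (Suc i) (near_sum k p m (Suc i)) \<le>
        (1 + growth_exponent / x i) * avg k i (near_sum k p m i) + 0"
    proof (rule avg_step[OF k])
      fix h assume "h \<in> histories k i"
      from near_sum_growing_step[OF k this i, of p]
      show "(\<Sum>e\<in>htree k h. near_sum k p m (Suc i) (e # h)) \<le>
          real (k * i + 1) * ((1 + growth_exponent / x i) * near_sum k p m i h + 0)"
        unfolding growth_exponent_def factor .
    qed
    then show "avg k (Suc i) (near_sum k p m (Suc i)) \<le>
        (1 + growth_exponent / (real i + 1 / real k)) * avg k i (near_sum k p m i)"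
      by (simp add: x_def)
  qed
  also have "\<dots> \<le> ((real k + 1) * real m * fact p) * 2 powr growth_exponent"
  proof -
    have "real m' \<le> 2 * real m"
      using of_nat_mono[OF m(3), where 'a = real] by simp
    moreover have "x m' - real m' = x m - real m" "x m - real m \<ge> 0"
      by (simp_all add: x_def)
    ultimately have "x m' \<le> 2 * x m"
      by linarith
    then have "x m' / x m \<le> 2"
      using x[of m] by (simp add: field_simps)
    then have "(x m' / x m) powr growth_exponent \<le> 2 powr growth_exponent"
      using g1 x by (intro powr_mono2) (auto intro: divide_nonneg_nonneg less_imp_le)
    then show ?thesis
      using base avg_near_sum_nonneg[OF k] by (intro mult_mono) auto
  qed
  finally have 1: "avg k m' (near_sum k p m m') \<le> (real k + 1) * real m * fact p * 2 powr growth_exponent" .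
  have "avg k n (near_sum k p m m') \<le> avg k m' (near_sum k p m m') * (x n / x m') powr (real p / real k)"
    unfolding x_def
  proof (rule powr_growth[where a = "\<lambda>i. avg k i (near_sum k p m m')", OF k g1(2) avg_near_sum_nonneg[OF k] _ m(4)])
    fix i assume i: "m' \<le> i"
    have "avg k (Suc i) (near_sum k p m m') \<le>
        (1 + (real p / real k) / x i) * avg k i (near_sum k p m m') + 0"
    proof (rule avg_step[OF k])
      fix h assume "h \<in> histories k i"
      from near_sum_frozen_step[OF k this m(2) i, of p]
      show "(\<Sum>e\<in>htree k h. near_sum k p m m' (e # h)) \<le>
          real (k * i + 1) * ((1 + (real p / real k) / x i) * near_sum k p m m' h + 0)"
        unfolding factor .
    qed
    then show "avg k (Suc i) (near_sum k p m m') \<le>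
        (1 + (real p / real k) / (real i + 1 / real k)) * avg k i (near_sum k p m m')"
      by (simp add: x_def)
  qed
  also have "\<dots> \<le> ((real k + 1) * real m * fact p * 2 powr growth_exponent) *
      (2 powr (real p / real k) * (real n / real m) powr (real p / real k))"
  proof -
    have "x n - real n \<le> 1" "1 \<le> real n" "real m \<le> real m'" "x m' - real m' \<ge> 0"
      using m k by (auto simp: x_def)
    then have "x n \<le> 2 * real n" "real m \<le> x m'"
      by linarith+
    then have "x n / x m' \<le> 2 * real n / real m"
      using m x by (intro frac_le) auto
    then have "(x n / x m') powr (real p / real k) \<le> (2 * (real n / real m)) powr (real p / real k)"
      using x by (intro powr_mono2) (auto intro: divide_nonneg_nonneg less_imp_le)
    then show ?thesis
      using 1 avg_near_sum_nonneg[OF k] unfolding powr_mult by (intro mult_mono) auto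
  qed
  finally show ?thesis
    by (simp add: near_const_def mult_ac)
qed

end

text \<open>Scale \<open>j\<close> is weighted so that a bound \<open>K\<close> on the sum puts the
  vertices of time \<open>2 ^ (j + 1)\<close> within
  \<open>K powr (1 / p) * n powr (1 / k) * 2 powr (- \<beta> * j)\<close> of those of time
  \<open>2 ^ j\<close>. The minimum cuts the last dyadic interval at \<open>n\<close>.\<close>

definition chain_weight :: "nat \<Rightarrow> real \<Rightarrow> nat \<Rightarrow> nat \<Rightarrow> (nat \<times> nat) list \<Rightarrow> real" where
  "chain_weight k \<beta> p n h = (\<Sum>j | 2 ^ j \<le> n.
     (2 powr (real j * \<beta> * real p) * real n powr (- (real p / real k))) *
     near_sum k p (2 ^ j) (min (2 ^ (j + 1)) n) h)"

lemma finite_dyadic: "finite {j :: nat. 2 ^ j \<le> (n :: nat)}"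
proof (rule finite_subset)
  show "{j. 2 ^ j \<le> n} \<subseteq> {..n}"
  proof
    fix j assume "j \<in> {j. 2 ^ j \<le> n}"
    then show "j \<in> {..n}"
      using less_le_trans[of j "2 ^ j" n] by simp
  qed
qed simp

text \<open>By \<open>avg_near_sum_le\<close> the powers of \<open>n\<close> cancel and scale
  \<open>j\<close> has mean at most a constant times
  \<open>2 powr (j * (\<beta> * p + 1 - p / k))\<close>. The second condition on \<open>p\<close>
  makes this power at most \<open>2 powr (- j)\<close>, and the scales sum geometrically.\<close>

lemma avg_chain_weight_le:
  assumes k: "k \<ge> 1" and p: "p \<ge> k" "real p * (1 / real k - \<beta>) \<ge> 2" and n: "n \<ge> 1"
  shows "avg k n (chain_weight k \<beta> p n) \<le> 2 * near_const k p"
proof -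
  let ?J = "{j. 2 ^ j \<le> n}" and ?C = "near_const k p"
  let ?c = "\<lambda>j. 2 powr (real j * \<beta> * real p) * real n powr (- (real p / real k))"
  have "avg k n (chain_weight k \<beta> p n) =
      (\<Sum>j\<in>?J. ?c j * avg k n (near_sum k p (2 ^ j) (min (2 ^ (j + 1)) n)))"
    unfolding chain_weight_def[abs_def] by (rule avg_sum)
  also have "\<dots> \<le> (\<Sum>j\<in>?J. ?C * (1 / 2) ^ j)"
  proof (intro sum_mono)
    fix j assume j: "j \<in> ?J"
    have "?c j * avg k n (near_sum k p (2 ^ j) (min (2 ^ (j + 1)) n)) \<le>
        ?c j * (?C * real (2 ^ j) * (real n / real (2 ^ j)) powr (real p / real k))"
      using j by (intro mult_left_mono avg_near_sum_le[OF k p(1)]) auto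
    also have "\<dots> = ?C * 2 powr (real j * (\<beta> * real p + 1 - real p / real k))"
    proof -
      have two: "real (2 ^ j) = 2 powr real j"
        by (simp add: powr_realpow)
      have "(real n / real (2 ^ j)) powr (real p / real k) =
          real n powr (real p / real k) * 2 powr (- (real j * (real p / real k)))"
        unfolding two by (simp add: powr_divide powr_powr powr_minus_divide)
      then have 1: "?c j * (?C * real (2 ^ j) * (real n / real (2 ^ j)) powr (real p / real k)) =
          ?C * (real n powr (- (real p / real k)) * real n powr (real p / real k)) *
          (2 powr (real j * \<beta> * real p) * 2 powr real j * 2 powr (- (real j * (real p / real k))))"
        unfolding two by (simp only: mult_ac)
      have 2: "real n powr (- (real p / real k)) * real n powr (real p / real k) = 1"
        using n by (simp flip: powr_add)
      have 3: "2 powr (real j * \<beta> * real p) * 2 powr real j * 2 powr (- (real j * (real p / real k))) =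
          2 powr (real j * (\<beta> * real p + 1 - real p / real k))"
        unfolding powr_add[symmetric] by (simp add: algebra_simps)
      show ?thesis
        unfolding 1 2 3 by simp
    qed
    also have "\<dots> \<le> ?C * 2 powr (- real j)"
    proof -
      have "real j * (\<beta> * real p + 1 - real p / real k) \<le> real j * (- 1)"
        using p(2) by (intro mult_left_mono) (auto simp: algebra_simps)
      then show ?thesis
        using near_const_pos[OF k p(1)] by (intro mult_left_mono powr_mono) auto
    qed
    also have "\<dots> = ?C * (1 / 2) ^ j"
      by (simp add: powr_minus powr_realpow power_one_over inverse_eq_divide)
    finally show "?c j * avg k n (near_sum k p (2 ^ j) (min (2 ^ (j + 1)) n)) \<le> ?C * (1 / 2) ^ j" .
  qed
  also have "\<dots> = ?C * (\<Sum>j\<in>?J. (1 / 2) ^ j)"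
    by (simp add: sum_distrib_left)
  also have "\<dots> \<le> ?C * 2"
  proof -
    have "(\<Sum>j\<in>?J. (1 / 2 :: real) ^ j) \<le> (\<Sum>j. (1 / 2) ^ j)"
      by (rule sum_le_suminf[OF summable_geometric finite_dyadic]) simp_all
    also have "\<dots> = 2"
      by (subst suminf_geometric) auto
    finally show ?thesis
      using near_const_pos[OF k p(1)] by (intro mult_left_mono) auto
  qed
  finally show ?thesis
    by (simp only: mult.commute)
qed

text \<open>Each single term of \<open>chain_weight\<close> is at most \<open>K\<close>, which
  bounds every step from scale \<open>j + 1\<close> to scale \<open>j\<close> by
  \<open>L * \<theta> ^ j\<close>; the steps down to scale \<open>j0\<close> add up to a geometric
  series.\<close>

lemma chain_weight_near:
  assumes k: "k \<ge> 1" and \<beta>: "\<beta> > 0" and p: "p \<ge> 1" and h: "h \<in> histories k n"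
    and K: "K > 0" "chain_weight k \<beta> p n h \<le> K" and j0: "2 ^ j0 \<le> n"
    and x: "x \<in> Range (htree k h)"
  shows "\<exists>y\<in>vertices k (2 ^ j0) h. real (edist (htree k h) x y) \<le>
    K powr (1 / real p) / (1 - 2 powr - \<beta>) * 2 powr (- \<beta> * real j0) * real n powr (1 / real k)"
proof -
  have len: "length h = n"
    using histories_grown(1)[OF k h] .
  interpret grown_tree k n "htree k h"
    by (rule histories_grown_tree[OF k h])
  define L where "L = K powr (1 / real p) * real n powr (1 / real k)"
  define \<theta> where "\<theta> = 2 powr - \<beta>"
  have \<theta>: "0 < \<theta>" "\<theta> < 1"
    using \<beta> by (auto simp: \<theta>_def powr_less_one)
  have n: "n \<ge> 1"
    using j0 by (metis le_trans one_le_numeral one_le_power)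
  have L: "L > 0"
    using K n by (simp add: L_def)
  let ?c = "\<lambda>j. 2 powr (real j * \<beta> * real p) * real n powr (- (real p / real k))"
  let ?V = "\<lambda>j. vertices k (min (2 ^ j) n) h"
  have level: "\<exists>y\<in>?V j. real (edist (htree k h) x y) \<le> L * \<theta> ^ j"
    if j: "2 ^ j \<le> n" and x: "x \<in> ?V (Suc j)" for j x
  proof -
    have V: "finite (?V i)" "?V i \<noteq> {}" for i
      using card_vertices[OF k h] by auto
    let ?d = "near (htree k h) (?V j) x"
    have "rising p ?d \<le> (\<Sum>v\<in>?V (Suc j). rising p (near (htree k h) (?V j) v))"
      by (rule member_le_sum[OF x less_imp_le[OF rising_pos] V(1)])
    moreover have "min (2 ^ j) n = 2 ^ j"
      using j by simp
    ultimately have "rising p ?d \<le> near_sum k p (2 ^ j) (min (2 ^ (j + 1)) n) h"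
      by (simp add: near_sum_def[OF k])
    then have "?c j * rising p ?d \<le> ?c j * near_sum k p (2 ^ j) (min (2 ^ (j + 1)) n) h"
      by (intro mult_left_mono) auto
    also have "\<dots> \<le> chain_weight k \<beta> p n h"
      unfolding chain_weight_def using j finite_dyadic near_sum_nonneg[OF k]
      by (intro member_le_sum) auto
    also have "\<dots> \<le> K"
      by (rule K)
    finally have "?c j * real ?d ^ p \<le> K"
      using power_le_rising[of ?d p] by (smt (verit) mult_left_mono powr_ge_zero mult_nonneg_nonneg)
    then have "real ?d ^ p \<le> K / ?c j"
      using n by (simp add: field_simps)
    also have "\<dots> = (L * \<theta> ^ j) ^ p"
    proof -
      have "(K powr (1 / real p)) ^ p = K" "(real n powr (1 / real k)) ^ p = real n powr (real p / real k)"
        using K n p by (simp_all add: powr_powr flip: powr_realpow)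
      moreover have "(\<theta> ^ j) ^ p = 2 powr - (real j * \<beta> * real p)"
        by (simp add: \<theta>_def powr_powr mult_ac flip: powr_realpow)
      ultimately show ?thesis
        by (simp add: L_def power_mult_distrib powr_minus_divide divide_simps)
    qed
    finally have "real ?d \<le> L * \<theta> ^ j"
      using L \<theta> p by (simp add: power_mono_iff)
    then show ?thesis
      using near_attained[OF V] by metis
  qed
  \<comment> \<open>The bound is the sum of \<open>L * \<theta> ^ l\<close> over
    \<open>j0 \<le> l < i\<close>, in closed form.\<close>
  have chain: "\<exists>y\<in>?V j0. real (edist (htree k h) x y) \<le> L * (\<theta> ^ j0 - \<theta> ^ i) / (1 - \<theta>)"
    if "j0 \<le> i" "x \<in> ?V i" for i x
    using that
  proof (induction arbitrary: x rule: dec_induct)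
    case base
    then show ?case
      by (auto intro!: bexI[of _ x])
  next
    case (step i)
    have "\<exists>y\<in>?V i. real (edist (htree k h) x y) \<le> L * \<theta> ^ i"
    proof (cases "2 ^ i \<le> n")
      case True
      then show ?thesis
        using level step.prems by blast
    next
      case False
      \<comment> \<open>Above \<open>n\<close> the minimum freezes the level, so no step is
        made.\<close>
      then have "?V i = ?V (Suc i)"
        by (auto simp: min_def)
      then show ?thesis
        using step.prems L \<theta> by (intro bexI[of _ x]) auto
    qed
    then obtain y where y: "y \<in> ?V i" "real (edist (htree k h) x y) \<le> L * \<theta> ^ i"
      by blast
    obtain z where z: "z \<in> ?V j0" "real (edist (htree k h) y z) \<le> L * (\<theta> ^ j0 - \<theta> ^ i) / (1 - \<theta>)"
      using step.IH[OF y(1)] by blast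
    have "real (edist (htree k h) x z) \<le> L * \<theta> ^ i + L * (\<theta> ^ j0 - \<theta> ^ i) / (1 - \<theta>)"
      using edist_triangle[of x z y] y(2) z(2) by linarith
    also have "\<dots> = L * (\<theta> ^ j0 - \<theta> ^ Suc i) / (1 - \<theta>)"
      using \<theta> by (simp add: field_simps)
    finally show ?case
      using z(1) by blast
  qed
  \<comment> \<open>The exponent \<open>max n j0\<close> is at least \<open>j0\<close>, as the chain
    requires, and so large that the truncated level is the whole vertex set.\<close>
  have "n \<le> 2 ^ max n j0"
    using less_exp[of "max n j0"] by linarith
  then have "min (2 ^ max n j0) n = n"
    by simp
  then have "x \<in> ?V (max n j0)"
    using x len by (simp add: vertices_self)
  then obtain y where y: "y \<in> ?V j0"
      "real (edist (htree k h) x y) \<le> L * (\<theta> ^ j0 - \<theta> ^ max n j0) / (1 - \<theta>)"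
    using chain[of "max n j0" x] by auto
  have "L * (\<theta> ^ j0 - \<theta> ^ max n j0) / (1 - \<theta>) \<le> L * \<theta> ^ j0 / (1 - \<theta>)"
    using L \<theta> by (intro divide_right_mono mult_left_mono) auto
  moreover have "\<theta> ^ j0 = 2 powr (- \<beta> * real j0)"
    by (simp add: \<theta>_def powr_powr flip: powr_realpow)
  ultimately have "real (edist (htree k h) x y) \<le> L * 2 powr (- \<beta> * real j0) / (1 - \<theta>)"
    using y(2) by simp
  then show ?thesis
    using y(1) j0 by (intro bexI[of _ y]) (auto simp: L_def \<theta>_def mult_ac)
qed

section \<open>Hausdorff measures and finite approximations\<close>

text \<open>\<open>R\<close> is a correspondence of distortion at most \<open>\<eta>\<close> between
  the vertices, with \<open>D\<close> as distance, and the space \<open>m\<close>. Both dimension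
  estimates use Gromov--Hausdorff closeness in this form.\<close>

definition approximates :: "nat set \<Rightarrow> (nat \<Rightarrow> nat \<Rightarrow> real) \<Rightarrow> 'a metric \<Rightarrow> real \<Rightarrow> bool" where
  "approximates V D m \<eta> \<longleftrightarrow>
     (\<exists>R. (\<forall>y\<in>mspace m. \<exists>v\<in>V. R v y) \<and> (\<forall>v\<in>V. \<exists>y\<in>mspace m. R v y) \<and>
       (\<forall>v\<in>V. \<forall>v'\<in>V. \<forall>y\<in>mspace m. \<forall>y'\<in>mspace m.
          R v y \<longrightarrow> R v' y' \<longrightarrow> \<bar>D v v' - mdist m y y'\<bar> \<le> \<eta>))"

lemma approximatesE:
  assumes "approximates V D m \<eta>"
  obtains R where "\<And>y. y \<in> mspace m \<Longrightarrow> \<exists>v\<in>V. R v y" "\<And>v. v \<in> V \<Longrightarrow> \<exists>y\<in>mspace m. R v y"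
    "\<And>v v' y y'. v \<in> V \<Longrightarrow> v' \<in> V \<Longrightarrow> y \<in> mspace m \<Longrightarrow> y' \<in> mspace m \<Longrightarrow> R v y \<Longrightarrow> R v' y' \<Longrightarrow>
      \<bar>D v v' - mdist m y y'\<bar> \<le> \<eta>"
proof -
  obtain R where R: "\<forall>y\<in>mspace m. \<exists>v\<in>V. R v y" "\<forall>v\<in>V. \<exists>y\<in>mspace m. R v y"
    "\<forall>v\<in>V. \<forall>v'\<in>V. \<forall>y\<in>mspace m. \<forall>y'\<in>mspace m. R v y \<longrightarrow> R v' y' \<longrightarrow>
      \<bar>D v v' - mdist m y y'\<bar> \<le> \<eta>"
    using assms unfolding approximates_def by (elim exE conjE)
  show ?thesis
    by (rule that[of R]) (use R in simp_all)
qed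

lemma approximates_mono:
  assumes "approximates V D m \<eta>" "\<eta> \<le> \<eta>'"
  shows "approximates V D m \<eta>'"
proof -
  obtain R where R: "\<And>y. y \<in> mspace m \<Longrightarrow> \<exists>v\<in>V. R v y" "\<And>v. v \<in> V \<Longrightarrow> \<exists>y\<in>mspace m. R v y"
    "\<And>v v' y y'. v \<in> V \<Longrightarrow> v' \<in> V \<Longrightarrow> y \<in> mspace m \<Longrightarrow> y' \<in> mspace m \<Longrightarrow> R v y \<Longrightarrow> R v' y' \<Longrightarrow>
      \<bar>D v v' - mdist m y y'\<bar> \<le> \<eta>"
    using assms(1) by - (erule approximatesE, rule that)
  show ?thesis
    unfolding approximates_def
  proof (intro exI[of _ R] conjI ballI impI)
    fix v v' y y'
    assume "v \<in> V" "v' \<in> V" "y \<in> mspace m" "y' \<in> mspace m" "R v y" "R v' y'"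
    then show "\<bar>D v v' - mdist m y y'\<bar> \<le> \<eta>'"
      using R(3) assms(2) order_trans by blast
  qed (use R in simp_all)
qed

lemma mdiameter_le:
  assumes "\<And>x y. x \<in> U \<Longrightarrow> y \<in> U \<Longrightarrow> mdist m x y \<le> \<delta>" "\<delta> \<ge> 0"
  shows "mdiameter m U \<le> \<delta>"
  unfolding mdiameter_def using assms by (auto intro!: cSUP_least)

lemma mdist_le_mdiameter:
  assumes "\<And>x y. x \<in> U \<Longrightarrow> y \<in> U \<Longrightarrow> mdist m x y \<le> \<delta>" "x \<in> U" "y \<in> U"
  shows "mdist m x y \<le> mdiameter m U"
proof -
  have "bdd_above ((\<lambda>p. mdist m (fst p) (snd p)) ` (U \<times> U))"
    using assms(1) by (auto intro!: bdd_aboveI2)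
  then show ?thesis
    unfolding mdiameter_def using assms(2,3) cSUP_upper[of "(x, y)" "U \<times> U" "\<lambda>p. mdist m (fst p) (snd p)"]
    by auto
qed

lemma mdiameter_nonneg:
  assumes "\<And>x y. x \<in> U \<Longrightarrow> y \<in> U \<Longrightarrow> mdist m x y \<le> \<delta>"
  shows "mdiameter m U \<ge> 0"
proof (cases "U = {}")
  case False
  then obtain x where "x \<in> U"
    by blast
  then show ?thesis
    using mdist_le_mdiameter[OF assms, of U x x] mdist_nonneg[of m x x] by linarith
qed (simp add: mdiameter_def)

text \<open>All diameters are at most \<open>\<delta> \<le> 1\<close>, so a larger exponent makes
  every term smaller.\<close>

lemma hausdorff_premeasure_mono:
  assumes "t \<le> s" "\<delta> \<le> 1"
  shows "hausdorff_premeasure m s \<delta> A \<le> hausdorff_premeasure m t \<delta> A"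
  unfolding hausdorff_premeasure_def
proof (rule Inf_mono)
  fix b
  assume "b \<in> {\<Sum>i. ennreal (mdiameter m (U i) powr t) | U :: nat \<Rightarrow> 'a set.
    (\<forall>i. U i \<subseteq> mspace m \<and> (\<forall>x\<in>U i. \<forall>y\<in>U i. mdist m x y \<le> \<delta>)) \<and> A \<subseteq> (\<Union>i. U i)}"
  then obtain U :: "nat \<Rightarrow> 'a set" where b: "b = (\<Sum>i. ennreal (mdiameter m (U i) powr t))"
    and U: "\<And>i. U i \<subseteq> mspace m" "\<And>i x y. x \<in> U i \<Longrightarrow> y \<in> U i \<Longrightarrow> mdist m x y \<le> \<delta>"
      "A \<subseteq> (\<Union>i. U i)"
    by blast
  have "mdiameter m (U i) powr s \<le> mdiameter m (U i) powr t" for i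
  proof -
    have "mdiameter m (U i) \<le> 1"
      using U(2)[of _ i] assms(2) by (intro mdiameter_le) (auto intro: order_trans)
    then show ?thesis
      using mdiameter_nonneg[of "U i" m \<delta>] U(2) assms(1) by (intro powr_mono') auto
  qed
  then have "(\<Sum>i. ennreal (mdiameter m (U i) powr s)) \<le> b"
    unfolding b by (intro suminf_le ennreal_leI) auto
  then show "\<exists>a\<in>{\<Sum>i. ennreal (mdiameter m (U i) powr s) | U :: nat \<Rightarrow> 'a set.
      (\<forall>i. U i \<subseteq> mspace m \<and> (\<forall>x\<in>U i. \<forall>y\<in>U i. mdist m x y \<le> \<delta>)) \<and> A \<subseteq> (\<Union>i. U i)}. a \<le> b"
    using U by blast
qed

text \<open>For the lower bound one scale is enough: positivity of the premeasure at
  \<open>\<delta> = 1\<close> passes to smaller exponents by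
  \<open>hausdorff_premeasure_mono\<close>, and the measure is at least this premeasure.\<close>

lemma hausdorff_dim_eqI:
  assumes upper: "\<And>t. t > r \<Longrightarrow> hausdorff_measure m t (mspace m) = 0"
    and lower: "\<And>t. 0 < t \<Longrightarrow> t < r \<Longrightarrow> \<exists>s\<ge>t. hausdorff_premeasure m s 1 (mspace m) > 0"
    and r: "r > 0"
  shows "hausdorff_dim m = ennreal r"
proof (rule antisym)
  show "hausdorff_dim m \<le> ennreal r"
  proof (rule ennreal_le_epsilon)
    fix e :: real assume "0 < e"
    then have "hausdorff_dim m \<le> ennreal (r + e)"
      unfolding hausdorff_dim_def using upper[of "r + e"] r
      by (intro Inf_lower CollectI exI[of _ "r + e"]) simp
    then show "hausdorff_dim m \<le> ennreal r + ennreal e"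
      using r \<open>0 < e\<close> by simp
  qed
  show "ennreal r \<le> hausdorff_dim m"
    unfolding hausdorff_dim_def
  proof (rule Inf_greatest, clarify)
    fix t :: real assume t: "t > 0" "hausdorff_measure m t (mspace m) = 0"
    show "ennreal r \<le> ennreal t"
    proof (rule ccontr)
      assume "\<not> ennreal r \<le> ennreal t"
      then have "t < r"
        using ennreal_leI not_le by blast
      then obtain s where s: "s \<ge> t" "hausdorff_premeasure m s 1 (mspace m) > 0"
        using lower t by blast
      then have "0 < hausdorff_premeasure m t 1 (mspace m)"
        using hausdorff_premeasure_mono[of t s 1 m "mspace m"] by auto
      also have "\<dots> \<le> hausdorff_measure m t (mspace m)"
        unfolding hausdorff_measure_def by (rule SUP_upper) simp
      finally show False
        using t(2) by simp
    qed
  qed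
qed

text \<open>The cells of the net at level \<open>j\<close> number at most \<open>B * 2 ^ j\<close>
  and have diameter at most \<open>4 * \<rho> j\<close>. The cover costs
  \<open>B * 2 ^ j * (4 * \<rho> j) powr t\<close>, which tends to 0 because
  \<open>t * \<beta> > 1\<close>. The approximation is taken at accuracy \<open>\<rho> j\<close> to
  match the mesh.\<close>

lemma hausdorff_measure_eq_0:
  fixes m :: "'a metric"
  assumes t: "t > 0" and A: "A > 0" and B: "B \<ge> 0" and \<beta>: "\<beta> > 0" "t * \<beta> > 1"
    and net: "\<And>j \<eta>. \<eta> > 0 \<Longrightarrow> \<exists>V D W. approximates V D m \<eta> \<and> W \<subseteq> V \<and> finite W \<and>
      real (card W) \<le> B * 2 ^ j \<and> (\<forall>v\<in>V. \<exists>w\<in>W. D v w \<le> A * 2 powr (- \<beta> * real j))"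
  shows "hausdorff_measure m t (mspace m) = 0"
proof -
  interpret Metric_space "mspace m" "mdist m"
    by simp
  define \<rho> where "\<rho> j = A * 2 powr (- \<beta> * real j)" for j
  have \<rho>: "\<rho> j > 0" for j
    using A by (simp add: \<rho>_def)
  have cover: "hausdorff_premeasure m t \<delta> (mspace m) \<le> ennreal (B * 2 ^ j * (4 * \<rho> j) powr t)"
    if \<delta>: "4 * \<rho> j \<le> \<delta>" for \<delta> j
  proof -
    obtain V D W where *: "approximates V D m (\<rho> j) \<and> W \<subseteq> V \<and> finite W \<and>
        real (card W) \<le> B * 2 ^ j \<and> (\<forall>v\<in>V. \<exists>w\<in>W. D v w \<le> \<rho> j)"
      using net[OF \<rho>, of j j] unfolding \<rho>_def[symmetric] by blast
    then have W: "W \<subseteq> V" "finite W" "real (card W) \<le> B * 2 ^ j" "\<And>v. v \<in> V \<Longrightarrow> \<exists>w\<in>W. D v w \<le> \<rho> j"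
      by simp_all
    from * have "approximates V D m (\<rho> j)" ..
    then obtain R where
      R: "\<And>y. y \<in> mspace m \<Longrightarrow> \<exists>v\<in>V. R v y" "\<And>v. v \<in> V \<Longrightarrow> \<exists>y\<in>mspace m. R v y"
        "\<And>v v' y y'. v \<in> V \<Longrightarrow> v' \<in> V \<Longrightarrow> y \<in> mspace m \<Longrightarrow> y' \<in> mspace m \<Longrightarrow> R v y \<Longrightarrow> R v' y' \<Longrightarrow>
          \<bar>D v v' - mdist m y y'\<bar> \<le> \<rho> j"
      by - (erule approximatesE, rule that)
    \<comment> \<open>The cell of \<open>w\<close> consists of the points related to a vertex within
      \<open>\<rho> j\<close> of \<open>w\<close>. With distortion \<open>\<rho> j\<close> it lies
      within \<open>2 * \<rho> j\<close> of any point related to \<open>w\<close>.\<close>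
    define P where "P w = {y \<in> mspace m. \<exists>v\<in>V. R v y \<and> D v w \<le> \<rho> j}" for w
    have diam: "mdist m y y' \<le> 4 * \<rho> j" if "w \<in> W" "y \<in> P w" "y' \<in> P w" for w y y'
    proof -
      obtain z where z: "z \<in> mspace m" "R w z"
        using R(2) W(1) \<open>w \<in> W\<close> by blast
      have *: "mdist m x z \<le> 2 * \<rho> j" if "x \<in> P w" for x
      proof -
        obtain v where v: "v \<in> V" "R v x" "D v w \<le> \<rho> j" "x \<in> mspace m"
          using \<open>x \<in> P w\<close> by (auto simp: P_def)
        have "\<bar>D v w - mdist m x z\<bar> \<le> \<rho> j"
          using R(3)[OF v(1) _ v(4) z(1) v(2) z(2)] W(1) \<open>w \<in> W\<close> by blast
        then show ?thesis
          using v(3) by linarith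
      qed
      have "y \<in> mspace m" "y' \<in> mspace m"
        using that by (auto simp: P_def)
      then have "mdist m y y' \<le> mdist m y z + mdist m y' z"
        using triangle''[of y z y'] z(1) commute by metis
      then show ?thesis
        using *[OF that(2)] *[OF that(3)] by linarith
    qed
    obtain xs where xs: "set xs = W" "length xs = card W"
      using finite_distinct_list[OF W(2)] distinct_card by metis
    \<comment> \<open>The finite family is padded to a sequence by empty sets, whose diameter is 0
      by definition.\<close>
    define U where "U i = (if i < length xs then P (xs ! i) else {})" for i
    have U: "mdist m x y \<le> 4 * \<rho> j" if "x \<in> U i" "y \<in> U i" for i x y
      using that diam[of "xs ! i" x y] nth_mem[of i xs] xs(1) by (auto simp: U_def split: if_splits)
    have "mspace m \<subseteq> (\<Union>i. U i)"
    proof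
      fix y assume y: "y \<in> mspace m"
      then obtain v where v: "v \<in> V" "R v y"
        using R(1) by blast
      obtain w where "w \<in> W" "D v w \<le> \<rho> j"
        using W(4)[OF v(1)] by blast
      then have "y \<in> P w" "w \<in> set xs"
        using v y xs(1) by (auto simp: P_def)
      moreover obtain i where "i < length xs" "xs ! i = w"
        using \<open>w \<in> set xs\<close> by (auto simp: in_set_conv_nth)
      ultimately show "y \<in> (\<Union>i. U i)"
        by (auto simp: U_def)
    qed
    moreover have "U i \<subseteq> mspace m" for i
      by (auto simp: U_def P_def)
    ultimately have "hausdorff_premeasure m t \<delta> (mspace m) \<le> (\<Sum>i. ennreal (mdiameter m (U i) powr t))"
      unfolding hausdorff_premeasure_def using order_trans[OF U \<delta>]
      by (intro Inf_lower CollectI exI[of _ U]) simp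
    also have "\<dots> = (\<Sum>i<length xs. ennreal (mdiameter m (U i) powr t))"
      using t by (intro suminf_finite) (auto simp: U_def mdiameter_def)
    also have "\<dots> \<le> (\<Sum>i<length xs. ennreal ((4 * \<rho> j) powr t))"
    proof (intro sum_mono ennreal_leI powr_mono2)
      fix i
      show "0 \<le> mdiameter m (U i)"
        using U by (rule mdiameter_nonneg)
      show "mdiameter m (U i) \<le> 4 * \<rho> j"
        using U \<rho>[of j] by (intro mdiameter_le) auto
    qed (use t in simp)
    also have "\<dots> = ennreal (real (card W) * (4 * \<rho> j) powr t)"
      using xs(2) by (simp add: ennreal_mult ennreal_of_nat_eq_real_of_nat)
    also have "\<dots> \<le> ennreal (B * 2 ^ j * (4 * \<rho> j) powr t)"
      using W(3) by (intro ennreal_leI mult_right_mono) auto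
    finally show ?thesis .
  qed
  have lim: "(\<lambda>j. 4 * \<rho> j) \<longlonglongrightarrow> 0"
  proof -
    have "(\<lambda>j. 4 * A * (2 powr - \<beta>) ^ j) \<longlonglongrightarrow> 4 * A * 0"
      using \<beta> by (intro tendsto_mult_left LIMSEQ_power_zero) (auto simp: powr_less_one)
    moreover have "4 * A * (2 powr - \<beta>) ^ j = 4 * \<rho> j" for j
      by (simp add: \<rho>_def powr_powr flip: powr_realpow)
    ultimately show ?thesis
      by (simp only: mult_zero_right)
  qed
  have lim': "(\<lambda>j. B * 2 ^ j * (4 * \<rho> j) powr t) \<longlonglongrightarrow> 0"
  proof -
    have "(\<lambda>j. B * (4 * A) powr t * (2 powr (1 - t * \<beta>)) ^ j) \<longlonglongrightarrow> B * (4 * A) powr t * 0"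
      using \<beta> by (intro tendsto_mult_left LIMSEQ_power_zero) (auto simp: powr_less_one)
    moreover have "B * (4 * A) powr t * (2 powr (1 - t * \<beta>)) ^ j = B * 2 ^ j * (4 * \<rho> j) powr t" for j
    proof -
      have "(4 * \<rho> j) powr t = (4 * A) powr t * 2 powr (- (t * \<beta> * real j))"
        using A by (simp add: \<rho>_def powr_mult powr_powr mult_ac)
      moreover have "(2 powr (1 - t * \<beta>)) ^ j = 2 powr (real j - t * \<beta> * real j)"
        by (simp add: powr_powr algebra_simps flip: powr_realpow)
      moreover have "(2 :: real) ^ j = 2 powr real j"
        by (simp add: powr_realpow)
      ultimately show ?thesis
        by (simp add: powr_diff powr_minus_divide)
    qed
    ultimately show ?thesis
      by simp
  qed
  have "hausdorff_premeasure m t \<delta> (mspace m) = 0" if "\<delta> > 0" for \<delta>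
  proof -
    have "eventually (\<lambda>j. 4 * \<rho> j < \<delta>) sequentially"
      using lim that by (rule order_tendstoD)
    then have "eventually (\<lambda>j. hausdorff_premeasure m t \<delta> (mspace m) \<le> ennreal (B * 2 ^ j * (4 * \<rho> j) powr t)) sequentially"
      by eventually_elim (auto intro: cover)
    moreover have "(\<lambda>j. ennreal (B * 2 ^ j * (4 * \<rho> j) powr t)) \<longlonglongrightarrow> ennreal 0"
      using lim' by (rule tendsto_ennrealI)
    ultimately have "hausdorff_premeasure m t \<delta> (mspace m) \<le> ennreal 0"
      by (intro tendsto_lowerbound[where F = sequentially]) auto
    then show ?thesis
      by simp
  qed
  then show ?thesis
    by (simp add: hausdorff_measure_def)
qed

text \<open>The energy method. If a cover had a sum below \<open>1 / (2 * K)\<close>, compactness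
  would reduce a slight open enlargement of it to finitely many sets. An approximation finer than
  the enlargement sorts the vertices into these sets, and the Cauchy--Schwarz inequality then
  contradicts the energy bound.\<close>

lemma hausdorff_premeasure_pos:
  fixes m :: "'a metric"
  assumes compact: "compact_space (mtopology_of m)" and s: "s > 0" and K: "K > 0"
    and energy: "\<And>\<eta>. \<eta> > 0 \<Longrightarrow> \<exists>V D \<epsilon>. approximates V D m \<eta> \<and> finite V \<and> V \<noteq> {} \<and>
      (\<forall>x\<in>V. \<forall>y\<in>V. D x y \<ge> 0) \<and> 0 < \<epsilon> \<and> \<epsilon> \<le> \<eta> \<and>
      (\<Sum>x\<in>V. \<Sum>y\<in>V. (D x y + \<epsilon>) powr - s) \<le> K * (real (card V))\<^sup>2"
  shows "hausdorff_premeasure m s \<delta> (mspace m) \<ge> ennreal (1 / (2 * K))"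
  unfolding hausdorff_premeasure_def
proof (rule Inf_greatest)
  interpret Metric_space "mspace m" "mdist m"
    by simp
  fix b
  assume "b \<in> {\<Sum>i. ennreal (mdiameter m (U i) powr s) | U :: nat \<Rightarrow> 'a set.
    (\<forall>i. U i \<subseteq> mspace m \<and> (\<forall>x\<in>U i. \<forall>y\<in>U i. mdist m x y \<le> \<delta>)) \<and> mspace m \<subseteq> (\<Union>i. U i)}"
  then obtain U :: "nat \<Rightarrow> 'a set" where b: "b = (\<Sum>i. ennreal (mdiameter m (U i) powr s))"
    and U: "\<And>i. U i \<subseteq> mspace m" "\<And>i x y. x \<in> U i \<Longrightarrow> y \<in> U i \<Longrightarrow> mdist m x y \<le> \<delta>"
      "mspace m \<subseteq> (\<Union>i. U i)"
    by blast
  define d where "d i = mdiameter m (U i)" for i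
  have d: "d i \<ge> 0" "\<And>x y. x \<in> U i \<Longrightarrow> y \<in> U i \<Longrightarrow> mdist m x y \<le> d i" for i
    unfolding d_def using U(2) by (auto intro: mdiameter_nonneg mdist_le_mdiameter)
  define c0 where "c0 = 1 / (2 * K)"
  have c0: "c0 > 0"
    using K by (simp add: c0_def)
  show "ennreal (1 / (2 * K)) \<le> b"
  proof (rule ccontr)
    assume "\<not> ennreal (1 / (2 * K)) \<le> b"
    then have b0: "b < ennreal c0"
      by (simp add: c0_def)
    \<comment> \<open>Enlarged diameters: \<open>L i\<close> is strictly larger than
      \<open>d i\<close>, even when \<open>d i = 0\<close>, and the total excess of the
      \<open>s\<close>-th powers is at most \<open>c0\<close>.\<close>
    define L where "L i = (d i powr s + c0 * (1 / 2) ^ Suc i) powr (1 / s)" for i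
    have Lpow: "L i powr s = d i powr s + c0 * (1 / 2) ^ Suc i" for i
      using s c0 by (simp add: L_def powr_powr add_nonneg_pos)
    have Lgt: "L i > d i" for i
    proof -
      have "d i = (d i powr s) powr (1 / s)"
        using s d(1)[of i] by (simp add: powr_powr)
      also have "\<dots> < L i"
        unfolding L_def using s c0 by (intro powr_less_mono2) auto
      finally show ?thesis .
    qed
    \<comment> \<open>A quarter of the gap: two parts go to the radius of the enlargement at both
      ends, one to the distortion and one to \<open>\<epsilon>\<close>, so that
      \<open>D v v' + \<epsilon> \<le> L i\<close> holds in \<open>near\<close>.\<close>
    define r where "r i = (L i - d i) / 4" for i
    have r: "r i > 0" for i
      using Lgt[of i] by (simp add: r_def)
    define Q where "Q i = (\<Union>u\<in>U i. mball u (r i))" for i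
    have Q_open: "openin mtopology (Q i)" for i
      unfolding Q_def by (intro openin_Union) auto
    have Q_cover: "mspace m \<subseteq> \<Union>(range Q)"
    proof
      fix y assume "y \<in> mspace m"
      then obtain i where "y \<in> U i"
        using U(3) by blast
      then have "y \<in> Q i"
        using r[of i] U(1)[of i] by (auto simp: Q_def intro!: bexI[of _ y])
      then show "y \<in> \<Union>(range Q)"
        by blast
    qed
    have "compactin mtopology (mspace m)"
      using compact by (simp add: compact_space_def mtopology_of_def)
    then obtain \<F> where \<F>: "finite \<F>" "\<F> \<subseteq> range Q" "mspace m \<subseteq> \<Union>\<F>"
      using Q_open Q_cover unfolding compactin_def by (metis (no_types, lifting) imageE)
    then obtain F where F: "finite F" "\<F> = Q ` F"
      by (metis finite_subset_image subset_UNIV)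
    \<comment> \<open>The accuracy is chosen after the cover; finiteness of \<open>F\<close> keeps
      it positive, and the element 1 covers an empty \<open>F\<close>.\<close>
    define \<eta> where "\<eta> = Min (insert 1 (r ` F))"
    have \<eta>: "\<eta> > 0" "\<And>i. i \<in> F \<Longrightarrow> \<eta> \<le> r i"
      using F(1) r by (auto simp: \<eta>_def)
    obtain V D \<epsilon> where *: "approximates V D m \<eta> \<and> finite V \<and> V \<noteq> {} \<and>
        (\<forall>x\<in>V. \<forall>y\<in>V. D x y \<ge> 0) \<and> 0 < \<epsilon> \<and> \<epsilon> \<le> \<eta> \<and>
        (\<Sum>x\<in>V. \<Sum>y\<in>V. (D x y + \<epsilon>) powr - s) \<le> K * (real (card V))\<^sup>2"
      using energy[OF \<eta>(1)] by blast
    then have V: "finite V" "V \<noteq> {}" "\<And>x y. x \<in> V \<Longrightarrow> y \<in> V \<Longrightarrow> D x y \<ge> 0"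
      and \<epsilon>: "0 < \<epsilon>" "\<epsilon> \<le> \<eta>"
      and en: "(\<Sum>x\<in>V. \<Sum>y\<in>V. (D x y + \<epsilon>) powr - s) \<le> K * (real (card V))\<^sup>2"
      by simp_all
    from * have "approximates V D m \<eta>" ..
    then obtain R where R: "\<And>y. y \<in> mspace m \<Longrightarrow> \<exists>v\<in>V. R v y"
        "\<And>v. v \<in> V \<Longrightarrow> \<exists>y\<in>mspace m. R v y"
        "\<And>v v' y y'. v \<in> V \<Longrightarrow> v' \<in> V \<Longrightarrow> y \<in> mspace m \<Longrightarrow> y' \<in> mspace m \<Longrightarrow> R v y \<Longrightarrow> R v' y' \<Longrightarrow>
          \<bar>D v v' - mdist m y y'\<bar> \<le> \<eta>"
      by - (erule approximatesE, rule that)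
    obtain f where f: "\<And>v. v \<in> V \<Longrightarrow> f v \<in> mspace m" "\<And>v. v \<in> V \<Longrightarrow> R v (f v)"
      using R(2) by metis
    have "\<exists>i\<in>F. f v \<in> Q i" if "v \<in> V" for v
      using \<F>(3) F(2) f(1)[OF that] by blast
    then obtain g where g: "\<And>v. v \<in> V \<Longrightarrow> g v \<in> F" "\<And>v. v \<in> V \<Longrightarrow> f v \<in> Q (g v)"
      by metis
    \<comment> \<open>Each vertex is assigned to a single set of the cover, so the cells partition
      \<open>V\<close>.\<close>
    define C where "C i = {v \<in> V. g v = i}" for i
    have C: "finite (C i)" for i
      using V(1) by (simp add: C_def)
    have near: "D v v' + \<epsilon> \<le> L i" if i: "i \<in> F" and v: "v \<in> C i" "v' \<in> C i" for i v v'
    proof -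
      have vV: "v \<in> V" "v' \<in> V" "f v \<in> Q i" "f v' \<in> Q i"
        using v g(2)[of v] g(2)[of v'] by (auto simp: C_def)
      then obtain u u' where u: "u \<in> U i" "u' \<in> U i" "mdist m u (f v) < r i" "mdist m u' (f v') < r i"
          "u \<in> mspace m" "u' \<in> mspace m"
        by (auto simp: Q_def in_mball)
      have "mdist m (f v) (f v') \<le> mdist m (f v) u + mdist m u u' + mdist m u' (f v')"
        using triangle[of "f v" u "f v'"] triangle[of u u' "f v'"] u f(1) vV by fastforce
      also have "\<dots> \<le> r i + d i + r i"
        using u d(2)[OF u(1,2)] by (simp add: commute)
      finally have "mdist m (f v) (f v') \<le> r i + d i + r i" .
      moreover have "\<bar>D v v' - mdist m (f v) (f v')\<bar> \<le> \<eta>"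
        using R(3) f vV by blast
      then have "D v v' \<le> mdist m (f v) (f v') + \<eta>"
        by (simp add: abs_le_iff)
      moreover have "L i = d i + 4 * r i"
        by (simp add: r_def field_simps)
      ultimately show ?thesis
        using \<epsilon> \<eta>(2)[OF i] by linarith
    qed
    have Lpos: "L i > 0" for i
      using Lgt[of i] d(1)[of i] by linarith
    \<comment> \<open>Only pairs inside one cell are kept; each has
      \<open>D v v' + \<epsilon> \<le> L i\<close> and so contributes at least
      \<open>L i powr - s\<close> to the energy.\<close>
    have cells: "(\<Sum>i\<in>F. (real (card (C i)))\<^sup>2 * L i powr - s) \<le> K * (real (card V))\<^sup>2"
    proof -
      have "(\<Sum>i\<in>F. (real (card (C i)))\<^sup>2 * L i powr - s) =
          (\<Sum>i\<in>F. \<Sum>v\<in>C i. \<Sum>v'\<in>C i. L i powr - s)"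
        by (simp add: power2_eq_square mult.assoc)
      also have "\<dots> \<le> (\<Sum>i\<in>F. \<Sum>v\<in>C i. \<Sum>v'\<in>V. (D v v' + \<epsilon>) powr - s)"
      proof (intro sum_mono)
        fix i v assume i: "i \<in> F" and v: "v \<in> C i"
        have "(\<Sum>v'\<in>C i. L i powr - s) \<le> (\<Sum>v'\<in>C i. (D v v' + \<epsilon>) powr - s)"
        proof (intro sum_mono powr_mono2')
          fix v' assume v': "v' \<in> C i"
          show "D v v' + \<epsilon> \<le> L i"
            using near i v v' .
          show "0 < D v v' + \<epsilon>"
            using V(3)[of v v'] v v' \<epsilon>(1) by (simp add: C_def add_nonneg_pos)
        qed (use s in simp)
        also have "\<dots> \<le> (\<Sum>v'\<in>V. (D v v' + \<epsilon>) powr - s)"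
          using V(1) by (intro sum_mono2) (auto simp: C_def)
        finally show "(\<Sum>v'\<in>C i. L i powr - s) \<le> (\<Sum>v'\<in>V. (D v v' + \<epsilon>) powr - s)" .
      qed
      also have "\<dots> = (\<Sum>v\<in>V. \<Sum>v'\<in>V. (D v v' + \<epsilon>) powr - s)"
        unfolding C_def using V(1) F(1) g(1) by (intro sum.group) auto
      finally show ?thesis
        using en by linarith
    qed
    have "g ` V \<subseteq> F"
      using g(1) by blast
    then have "real (card V) = (\<Sum>i\<in>F. real (card (C i)))"
      using sum.group[of V F g "\<lambda>_. 1 :: real"] V(1) F(1) by (simp add: C_def)
    \<comment> \<open>Arranged for Cauchy--Schwarz: the squares of the first factors are bounded by
      the energy through \<open>cells\<close>, those of the second sum to the quantity to be bounded
      below.\<close>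
    also have "\<dots> = (\<Sum>i\<in>F. (real (card (C i)) * L i powr (- s / 2)) * L i powr (s / 2))"
      using less_imp_neq[OF Lpos] by (intro sum.cong refl) (auto simp: mult.assoc simp flip: powr_add)
    finally have "(real (card V))\<^sup>2 =
        (\<Sum>i\<in>F. (real (card (C i)) * L i powr (- s / 2)) * L i powr (s / 2))\<^sup>2"
      by simp
    also have "\<dots> \<le> (\<Sum>i\<in>F. (real (card (C i)) * L i powr (- s / 2))\<^sup>2) * (\<Sum>i\<in>F. (L i powr (s / 2))\<^sup>2)"
      by (rule Cauchy_Schwarz_ineq_sum)
    also have "\<dots> = (\<Sum>i\<in>F. (real (card (C i)))\<^sup>2 * L i powr - s) * (\<Sum>i\<in>F. L i powr s)"
    proof -
      have "(L i powr (- s / 2))\<^sup>2 = L i powr - s" "(L i powr (s / 2))\<^sup>2 = L i powr s" for i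
        using Lpos[of i] by (simp_all add: power2_eq_square flip: powr_add)
      then show ?thesis
        by (simp only: power_mult_distrib)
    qed
    also have "\<dots> \<le> (K * (real (card V))\<^sup>2) * (\<Sum>i\<in>F. L i powr s)"
      by (intro mult_right_mono cells sum_nonneg) auto
    finally have "(real (card V))\<^sup>2 * 1 \<le> (real (card V))\<^sup>2 * (K * (\<Sum>i\<in>F. L i powr s))"
      by (simp add: mult_ac)
    moreover have "(real (card V))\<^sup>2 > 0"
      using V(1,2) by (simp add: card_gt_0_iff)
    ultimately have "1 \<le> K * (\<Sum>i\<in>F. L i powr s)"
      by (simp only: mult_le_cancel_left_pos)
    then have "2 * c0 \<le> (\<Sum>i\<in>F. L i powr s)"
      using K by (simp add: c0_def field_simps)
    also have "\<dots> = (\<Sum>i\<in>F. d i powr s) + c0 * (\<Sum>i\<in>F. (1 / 2) ^ Suc i)"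
      by (simp only: Lpow sum.distrib sum_distrib_left)
    finally have 1: "2 * c0 \<le> (\<Sum>i\<in>F. d i powr s) + c0 * (\<Sum>i\<in>F. (1 / 2) ^ Suc i)" .
    \<comment> \<open>The excess adds at most \<open>c0\<close> while the cover sum stays below
      \<open>c0\<close>; together they fall short of the required \<open>2 * c0\<close>.\<close>
    have "(\<Sum>i\<in>F. (1 / 2 :: real) ^ Suc i) \<le> 1"
      using sum_le_suminf[of "\<lambda>i. (1 / 2 :: real) ^ Suc i" F] power_half_series F(1)
      by (simp add: sums_iff)
    then have 2: "c0 * (\<Sum>i\<in>F. (1 / 2) ^ Suc i) \<le> c0"
      using c0 by (simp add: mult_left_le)
    have "ennreal (\<Sum>i\<in>F. d i powr s) = (\<Sum>i\<in>F. ennreal (d i powr s))"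
      by (simp add: sum_ennreal)
    also have "\<dots> \<le> b"
      unfolding b d_def using F(1) by (intro sum_le_suminf) auto
    finally have "ennreal (\<Sum>i\<in>F. d i powr s) < ennreal c0"
      using b0 by simp
    then have "(\<Sum>i\<in>F. d i powr s) < c0"
      using c0 by (simp add: ennreal_less_iff sum_nonneg)
    then show False
      using 1 2 by linarith
  qed
qed

section \<open>Gromov--Hausdorff--Prokhorov proximity\<close>

lemma mtopology_of_rescale:
  assumes c: "c > 0"
  shows "mtopology_of (metr (rescale c X)) = mtopology_of (metr X)"
proof -
  interpret X: Metric_space "mspace (metr X)" "mdist (metr X)"
    by simp
  interpret Y: Metric_space "mspace (metr X)" "\<lambda>x y. c * mdist (metr X) x y"
    using Metric_space_mspace_mdist[of "metr (rescale c X)"] by (simp add: rescale_metr[OF c])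
  have 1: "Y.mball x r = X.mball x (r / c)" for x r
    using c by (auto simp: X.in_mball Y.in_mball field_simps)
  have "(\<exists>r>0. Y.mball x r \<subseteq> U) \<longleftrightarrow> (\<exists>r>0. X.mball x r \<subseteq> U)" for x U
  proof
    assume "\<exists>r>0. Y.mball x r \<subseteq> U"
    then obtain r where "r > 0" "Y.mball x r \<subseteq> U"
      by blast
    then show "\<exists>r>0. X.mball x r \<subseteq> U"
      using c by (intro exI[of _ "r / c"]) (simp add: 1)
  next
    assume "\<exists>r>0. X.mball x r \<subseteq> U"
    then obtain r where "r > 0" "X.mball x r \<subseteq> U"
      by blast
    then show "\<exists>r>0. Y.mball x r \<subseteq> U"
      using c by (intro exI[of _ "c * r"]) (simp add: 1)
  qed
  then have "Y.mtopology = X.mtopology"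
    unfolding topology_eq X.openin_mtopology Y.openin_mtopology by simp
  then show ?thesis
    by (simp add: mtopology_of_def rescale_metr[OF c])
qed

lemma compact_rmm_rescale:
  assumes "c > 0" "compact_rmm X"
  shows "compact_rmm (rescale c X)"
  using assms(2) unfolding compact_rmm_def metric_borel_def
  by (simp add: mtopology_of_rescale[OF assms(1)] rescale_metr(1)[OF assms(1)])

section \<open>The finite trees as compact measured metric spaces\<close>

context grown_tree
begin

lemma vertex_point_eq: "vertex_point E v w = (if w \<in> anc E v then 1 else 0)"
  by (auto simp: vertex_point_def anc_def)

lemma vertex_point_edge:
  assumes "(u, v) \<in> E"
  shows "(vertex_point E u)(v := 1) = vertex_point E v" "(vertex_point E u)(v := 0) = vertex_point E u"
  using anc_edge[OF assms] not_anc_parent[OF assms] by (auto simp: vertex_point_eq fun_eq_iff)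

lemma vertex_point_in_tree_points:
  assumes "v \<in> Range E"
  shows "vertex_point E v \<in> tree_points E"
proof -
  obtain u where u: "(u, v) \<in> E"
    using assms by blast
  then have "vertex_point E v = (vertex_point E u)(v := 1)"
    by (simp add: vertex_point_edge)
  then show ?thesis
    using u unfolding tree_points_def by (intro CollectI exI[of _ u] exI[of _ v] exI[of _ 1]) simp
qed

lemma root_in_tree_points: "vertex_point E 0 \<in> tree_points E"
proof -
  obtain v where v: "(0, v) \<in> E"
    using grown by (auto simp: grown_def)
  then have "vertex_point E 0 = (vertex_point E 0)(v := 0)"
    by (simp add: vertex_point_edge)
  then show ?thesis
    using v unfolding tree_points_def by (intro CollectI exI[of _ 0] exI[of _ v] exI[of _ "0 :: real"]) simp
qed

lemma mspace_tree: "mspace (tree_metric E) = tree_points E"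
  by (rule tree_metric_sel) simp

lemma mdist_tree: "mdist (tree_metric E) x y = (\<Sum>v\<in>Range E. \<bar>x v - y v\<bar>)"
  by (simp add: tree_metric_sel(2)[OF finite_E])

lemma mdist_vertex_points: "mdist (tree_metric E) (vertex_point E x) (vertex_point E y) = real (edist E x y)"
proof -
  have "mdist (tree_metric E) (vertex_point E x) (vertex_point E y) =
      (\<Sum>v\<in>Range E. if v \<in> sym_diff (anc E x) (anc E y) then 1 else 0)"
    unfolding mdist_tree by (rule sum.cong) (auto simp: vertex_point_eq)
  also have "\<dots> = real (card (Range E \<inter> sym_diff (anc E x) (anc E y)))"
    by (simp add: sum.If_cases Int_def)
  also have "Range E \<inter> sym_diff (anc E x) (anc E y) = sym_diff (anc E x) (anc E y)"
    using anc_subset by auto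
  finally show ?thesis
    by (simp add: edist_def)
qed

lemma mdist_same_edge:
  assumes "(u, v) \<in> E"
  shows "mdist (tree_metric E) ((vertex_point E u)(v := s)) ((vertex_point E u)(v := t)) = \<bar>s - t\<bar>"
proof -
  have "mdist (tree_metric E) ((vertex_point E u)(v := s)) ((vertex_point E u)(v := t)) =
      (\<Sum>w\<in>Range E. if w = v then \<bar>s - t\<bar> else 0)"
    unfolding mdist_tree by (rule sum.cong) auto
  also have "\<dots> = \<bar>s - t\<bar>"
    using assms by (simp add: Range_iff) blast
  finally show ?thesis .
qed

lemma tree_point_near_vertex:
  assumes "x \<in> tree_points E"
  obtains v where "v \<in> Range E" "mdist (tree_metric E) x (vertex_point E v) \<le> 1"
proof -
  obtain u v t where x: "x = (vertex_point E u)(v := t)" "(u, v) \<in> E" "0 \<le> t" "t \<le> 1"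
    using assms by (auto simp: tree_points_def)
  have "mdist (tree_metric E) x (vertex_point E v) = \<bar>t - 1\<bar>"
    using mdist_same_edge[OF x(2), of t 1] vertex_point_edge[OF x(2)] x(1) by simp
  then show ?thesis
    using that[of v] x by auto
qed

text \<open>The tree is a finite union of edges, each the image of \<open>{0..1}\<close> under an
  isometric parametrisation.\<close>

lemma compact_tree: "compact_space (mtopology_of (tree_metric E))"
proof -
  interpret T: Metric_space "mspace (tree_metric E)" "mdist (tree_metric E)"
    by simp
  let ?f = "\<lambda>(u, v) t. (vertex_point E u)(v := t)"
  have in_pts: "?f e t \<in> tree_points E" if "e \<in> E" "t \<in> {0..1}" for e t
  proof -
    obtain u v where "e = (u, v)"
      by (cases e)
    then show ?thesis
      using that unfolding tree_points_def
      by (intro CollectI exI[of _ u] exI[of _ v] exI[of _ t]) simp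
  qed
  have "compactin T.mtopology (?f e ` {0..1})" if e: "e \<in> E" for e
  proof (rule image_compactin[of "top_of_set {0..1}"])
    show "compactin (top_of_set {0..1 :: real}) {0..1}"
      by (simp add: compactin_subtopology)
    obtain u v where uv: "e = (u, v)" "(u, v) \<in> E"
      using e by (cases e) auto
    show "continuous_map (top_of_set {0..1}) T.mtopology (?f e)"
      unfolding T.continuous_map_to_metric
    proof (intro ballI allI impI)
      fix t \<epsilon> :: real assume t: "t \<in> topspace (top_of_set {0..1})" and \<epsilon>: "0 < \<epsilon>"
      have "openin (top_of_set {0..1}) ({0..1} \<inter> ball t \<epsilon>)"
        by (simp add: openin_open_Int)
      moreover have "?f e s \<in> T.mball (?f e t) \<epsilon>" if "s \<in> {0..1} \<inter> ball t \<epsilon>" for s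
        using that t in_pts[OF e, of s] in_pts[OF e, of t] mdist_same_edge[OF uv(2), of t s]
        unfolding T.in_mball uv(1) by (simp add: mspace_tree dist_real_def)
      ultimately show "\<exists>U. openin (top_of_set {0..1}) U \<and> t \<in> U \<and> (\<forall>s\<in>U. ?f e s \<in> T.mball (?f e t) \<epsilon>)"
        using t \<epsilon> by (intro exI[of _ "{0..1} \<inter> ball t \<epsilon>"]) auto
    qed
  qed
  then have "compactin T.mtopology (\<Union>e\<in>E. ?f e ` {0..1})"
    by (intro compactin_Union) auto
  moreover have "(\<Union>e\<in>E. ?f e ` {0..1}) = tree_points E"
  proof
    show "(\<Union>e\<in>E. ?f e ` {0..1}) \<subseteq> tree_points E"
      using in_pts by blast
    show "tree_points E \<subseteq> (\<Union>e\<in>E. ?f e ` {0..1})"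
      unfolding tree_points_def by force
  qed
  ultimately show ?thesis
    by (simp add: compact_space_def mtopology_of_def) (simp add: mspace_tree)
qed

lemma compact_rmm_tree_space: "compact_rmm (tree_space E)"
proof -
  \<comment> \<open>The label 1 stays a leaf throughout, so the uniform measure on the leaves is a
    probability.\<close>
  have "leaves E \<subseteq> Range E" "1 \<in> leaves E"
    using grown by (auto simp: leaves_def grown_def)
  then have leaves: "finite (leaves E)" "leaves E \<noteq> {}" "leaves E \<subseteq> Range E"
    using finite_subset finite_Range_E by (blast, blast, blast)
  interpret L: prob_space "uniform_count_measure (leaves E)"
    using leaves by (intro prob_space_uniform_count_measure) auto
  have "vertex_point E \<in> measurable (uniform_count_measure (leaves E)) (metric_borel (tree_metric E))"
    using leaves vertex_point_in_tree_points
    by (intro measurableI)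
       (auto simp: space_uniform_count_measure sets_uniform_count_measure metric_borel_def
          space_measure_of_conv mspace_tree)
  then have "prob_space (distr (uniform_count_measure (leaves E)) (metric_borel (tree_metric E)) (vertex_point E))"
    by (rule L.prob_space_distr)
  then show ?thesis
    using compact_tree root_in_tree_points by (simp add: compact_rmm_def tree_space_def mspace_tree)
qed

end

section \<open>Correspondences from the Gromov--Hausdorff--Prokhorov distance\<close>

lemma compact_rmm_bounded:
  assumes "compact_rmm X"
  obtains B where "\<And>x y. x \<in> mspace (metr X) \<Longrightarrow> y \<in> mspace (metr X) \<Longrightarrow> mdist (metr X) x y \<le> B"
proof -
  interpret Metric_space "mspace (metr X)" "mdist (metr X)"
    by simp
  have "compactin mtopology (mspace (metr X))"
    using assms by (simp add: compact_rmm_def compact_space_def mtopology_of_def)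
  then have "mbounded (mspace (metr X))"
    by (rule compactin_imp_mbounded)
  then show ?thesis
    using that by (auto simp: mbounded_alt)
qed

text \<open>Glue two pointed spaces with a bridge of length one between the base points.\<close>

lemma common_embedding_exists:
  fixes m1 :: "'a metric" and m2 :: "'b metric"
  assumes "a \<in> mspace m1" "b \<in> mspace m2"
  obtains Z :: "('a + 'b) metric" where "isometric_embedding m1 Z Inl" "isometric_embedding m2 Z Inr"
proof -
  interpret X: Metric_space "mspace m1" "mdist m1"
    by simp
  interpret Y: Metric_space "mspace m2" "mdist m2"
    by simp
  define S :: "('a + 'b) set" where "S = mspace m1 <+> mspace m2"
  define d :: "'a + 'b \<Rightarrow> 'a + 'b \<Rightarrow> real" where
    "d p q = (case p of
        Inl x \<Rightarrow> (case q of Inl y \<Rightarrow> mdist m1 x y | Inr y \<Rightarrow> mdist m1 x a + 1 + mdist m2 b y)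
      | Inr x \<Rightarrow> (case q of Inl y \<Rightarrow> mdist m2 x b + 1 + mdist m1 a y | Inr y \<Rightarrow> mdist m2 x y))" for p q
  have d: "d (Inl x) (Inl y) = mdist m1 x y" "d (Inr u) (Inr v) = mdist m2 u v"
    "d (Inl x) (Inr v) = mdist m1 x a + 1 + mdist m2 b v"
    "d (Inr u) (Inl y) = mdist m2 u b + 1 + mdist m1 a y" for x y u v
    by (auto simp: d_def)
  have "Metric_space S d"
  proof
    fix p q r
    show "0 \<le> d p q"
      by (cases p; cases q) (auto simp: d)
    show "d p q = d q p"
      by (cases p; cases q) (auto simp: d X.commute Y.commute)
    assume pq: "p \<in> S" "q \<in> S"
    have pos: "mdist m1 x y + 1 + mdist m2 u v \<noteq> 0" "mdist m2 u v + 1 + mdist m1 x y \<noteq> 0" for x y u v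
      using X.nonneg[of x y] Y.nonneg[of u v] by linarith+
    show "d p q = 0 \<longleftrightarrow> p = q"
      using pq by (cases p; cases q) (auto simp: S_def d pos)
    assume r: "r \<in> S"
    note t1 = X.triangle and t2 = Y.triangle
    show "d p r \<le> d p q + d q r"
    proof (cases p; cases q; cases r)
      fix x y z assume *: "p = Inl x" "q = Inl y" "r = Inl z"
      then show ?thesis
        using pq r t1[of x y z] by (auto simp: S_def d)
    next
      fix x y z assume *: "p = Inl x" "q = Inl y" "r = Inr z"
      then show ?thesis
        using pq r t1[of x y a] assms by (auto simp: S_def d)
    next
      fix x y z assume *: "p = Inl x" "q = Inr y" "r = Inl z"
      then show ?thesis
        using pq r t1[of x a z] assms
        by (simp add: S_def d Plus_def image_iff) (use Y.nonneg[of b y] Y.nonneg[of y b] in linarith)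
    next
      fix x y z assume *: "p = Inl x" "q = Inr y" "r = Inr z"
      then show ?thesis
        using pq r t2[of b y z] assms by (auto simp: S_def d)
    next
      fix x y z assume *: "p = Inr x" "q = Inl y" "r = Inl z"
      then show ?thesis
        using pq r t1[of a y z] assms by (auto simp: S_def d)
    next
      fix x y z assume *: "p = Inr x" "q = Inl y" "r = Inr z"
      then show ?thesis
        using pq r t2[of x b z] assms
        by (simp add: S_def d Plus_def image_iff) (use X.nonneg[of a y] X.nonneg[of y a] in linarith)
    next
      fix x y z assume *: "p = Inr x" "q = Inr y" "r = Inl z"
      then show ?thesis
        using pq r t2[of x y b] assms by (auto simp: S_def d)
    next
      fix x y z assume *: "p = Inr x" "q = Inr y" "r = Inr z"
      then show ?thesis
        using pq r t2[of x y z] by (auto simp: S_def d)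
    qed
  qed
  then have Z: "mspace (metric (S, d)) = S" "mdist (metric (S, d)) = d"
    by (simp_all add: Metric_space.mspace_metric Metric_space.mdist_metric)
  show ?thesis
    by (rule that[of "metric (S, d)"]) (unfold isometric_embedding_def Z, auto simp: S_def d)
qed

lemma less_cInfE:
  fixes S :: "real set"
  assumes "S \<noteq> {}" "Inf S < \<epsilon>"
  obtains s where "s \<in> S" "s < \<epsilon>"
  using cInf_lessD[OF assms] by blast

text \<open>A real infimum below \<open>\<epsilon>\<close> is turned into an element below
  \<open>\<epsilon>\<close> by first showing that the set is nonempty. For the embeddings this is
  \<open>common_embedding_exists\<close>; for the Hausdorff distance a bound \<open>B\<close> on all
  cross distances is a member, because compact spaces are bounded.\<close>

lemma ghp_dist_less_imp:
  fixes X :: "'a rmm_space" and Y :: "'b rmm_space"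
  assumes X: "compact_rmm X" and Y: "compact_rmm Y" and less: "ghp_dist X Y < \<epsilon>"
  obtains Z :: "('a + 'b) metric" and \<phi> \<psi> where
    "isometric_embedding (metr X) Z \<phi>" "isometric_embedding (metr Y) Z \<psi>"
    "\<And>x. x \<in> mspace (metr X) \<Longrightarrow> \<exists>y\<in>mspace (metr Y). mdist Z (\<phi> x) (\<psi> y) < \<epsilon>"
    "\<And>y. y \<in> mspace (metr Y) \<Longrightarrow> \<exists>x\<in>mspace (metr X). mdist Z (\<phi> x) (\<psi> y) < \<epsilon>"
proof -
  let ?X = "mspace (metr X)" and ?Y = "mspace (metr Y)"
  have rt: "rt X \<in> ?X" "rt Y \<in> ?Y"
    using X Y by (auto simp: compact_rmm_def)
  let ?v = "\<lambda>(Z :: ('a + 'b) metric) \<phi> \<psi>. max (hausdorff_dist Z (\<phi> ` ?X) (\<psi> ` ?Y))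
      (max (mdist Z (\<phi> (rt X)) (\<psi> (rt Y)))
         (prokhorov_dist Z (distr (mass X) (metric_borel Z) \<phi>) (distr (mass Y) (metric_borel Z) \<psi>)))"
  let ?S = "{?v Z \<phi> \<psi> | (Z :: ('a + 'b) metric) \<phi> \<psi>.
      isometric_embedding (metr X) Z \<phi> \<and> isometric_embedding (metr Y) Z \<psi>}"
  obtain Z0 :: "('a + 'b) metric" where "isometric_embedding (metr X) Z0 Inl" "isometric_embedding (metr Y) Z0 Inr"
    using common_embedding_exists[OF rt] by blast
  then have "?v Z0 Inl Inr \<in> ?S"
    by (intro CollectI exI[of _ Z0] exI[of _ Inl] exI[of _ Inr] conjI refl)
  then have "?S \<noteq> {}"
    by blast
  moreover have "Inf ?S < \<epsilon>"
    using less by (simp add: ghp_dist_def)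
  ultimately obtain s where "s \<in> ?S" "s < \<epsilon>"
    by - (erule (1) less_cInfE, rule that)
  then obtain Z :: "('a + 'b) metric" and \<phi> \<psi> where emb: "isometric_embedding (metr X) Z \<phi>"
      "isometric_embedding (metr Y) Z \<psi>" and "s = ?v Z \<phi> \<psi>"
    by (elim CollectE exE conjE)
  then have v: "?v Z \<phi> \<psi> < \<epsilon>"
    using \<open>s < \<epsilon>\<close> by (simp only:)
  interpret Z: Metric_space "mspace Z" "mdist Z"
    by simp
  let ?H = "{\<epsilon>. \<epsilon> > 0 \<and> (\<forall>a\<in>\<phi> ` ?X. \<exists>b\<in>\<psi> ` ?Y. mdist Z a b < \<epsilon>) \<and>
      (\<forall>b\<in>\<psi> ` ?Y. \<exists>a\<in>\<phi> ` ?X. mdist Z a b < \<epsilon>)}"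
  have inZ: "\<phi> x \<in> mspace Z" "\<psi> y \<in> mspace Z" if "x \<in> ?X" "y \<in> ?Y" for x y
    using emb that by (auto simp: isometric_embedding_def)
  obtain B1 where B1: "\<And>x y. x \<in> ?X \<Longrightarrow> y \<in> ?X \<Longrightarrow> mdist (metr X) x y \<le> B1"
    using compact_rmm_bounded[OF X] by blast
  obtain B2 where B2: "\<And>x y. x \<in> ?Y \<Longrightarrow> y \<in> ?Y \<Longrightarrow> mdist (metr Y) x y \<le> B2"
    using compact_rmm_bounded[OF Y] by blast
  define B where "B = \<bar>B1\<bar> + mdist Z (\<phi> (rt X)) (\<psi> (rt Y)) + \<bar>B2\<bar> + 1"
  have B: "mdist Z (\<phi> x) (\<psi> y) < B" if xy: "x \<in> ?X" "y \<in> ?Y" for x y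
  proof -
    have "mdist Z (\<phi> x) (\<psi> y) \<le> mdist Z (\<phi> x) (\<phi> (rt X)) + mdist Z (\<phi> (rt X)) (\<psi> y)"
      using Z.triangle inZ xy rt by blast
    also have "mdist Z (\<phi> (rt X)) (\<psi> y) \<le> mdist Z (\<phi> (rt X)) (\<psi> (rt Y)) + mdist Z (\<psi> (rt Y)) (\<psi> y)"
      using Z.triangle inZ xy rt by blast
    also have "mdist Z (\<phi> x) (\<phi> (rt X)) \<le> B1"
      using emb(1) B1 xy rt by (simp add: isometric_embedding_def)
    also have "mdist Z (\<psi> (rt Y)) (\<psi> y) \<le> B2"
      using emb(2) B2 xy rt by (simp add: isometric_embedding_def)
    finally show ?thesis
      by (simp add: B_def)
  qed
  have "B > 0"
    using Z.nonneg[of "\<phi> (rt X)" "\<psi> (rt Y)"] unfolding B_def by linarith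
  then have "B \<in> ?H"
    using B rt by auto
  then have "?H \<noteq> {}"
    by blast
  moreover have "Inf ?H < \<epsilon>"
    using v by (simp add: hausdorff_dist_def)
  ultimately obtain \<delta> where \<delta>: "\<delta> \<in> ?H" "\<delta> < \<epsilon>"
    by - (erule (1) less_cInfE, rule that)
  from \<delta>(1) have "\<forall>x\<in>?X. \<exists>y\<in>?Y. mdist Z (\<phi> x) (\<psi> y) < \<delta>" "\<forall>y\<in>?Y. \<exists>x\<in>?X. mdist Z (\<phi> x) (\<psi> y) < \<delta>"
    by simp_all
  note \<delta>' = this[THEN bspec]
  show ?thesis
  proof (rule that[OF emb])
    show "\<exists>y\<in>?Y. mdist Z (\<phi> x) (\<psi> y) < \<epsilon>" if "x \<in> ?X" for x
      using \<delta>'(1)[OF that] \<delta>(2) less_trans by blast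
    show "\<exists>x\<in>?X. mdist Z (\<phi> x) (\<psi> y) < \<epsilon>" if "y \<in> ?Y" for y
      using \<delta>'(2)[OF that] \<delta>(2) less_trans by blast
  qed
qed

section \<open>From growing trees to the limit\<close>

text \<open>A vertex and a point of \<open>Y\<close> correspond when their images are closer than
  \<open>\<epsilon> + c\<close>: a point of the tree is within one edge, of length \<open>c\<close>
  after rescaling, of a vertex. The triangle inequality at both ends doubles this in the
  distortion.\<close>

lemma (in grown_tree) ghp_approximates:
  fixes Y :: "'b rmm_space"
  assumes c: "c > 0" and Y: "compact_rmm Y" and less: "ghp_dist (rescale c (tree_space E)) Y < \<epsilon>"
  shows "approximates (Range E) (\<lambda>x y. c * real (edist E x y)) (metr Y) (2 * (\<epsilon> + c))"
proof -
  let ?X = "rescale c (tree_space E)"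
  have X: "compact_rmm ?X"
    using compact_rmm_rescale[OF c compact_rmm_tree_space] .
  have metr_tree: "metr (tree_space E) = tree_metric E"
    by (simp add: tree_space_def)
  have pts: "mspace (metr ?X) = tree_points E"
    and dst: "mdist (metr ?X) x y = c * mdist (tree_metric E) x y" for x y
    by (simp_all add: rescale_metr[OF c] metr_tree mspace_tree)
  show ?thesis
  proof (rule ghp_dist_less_imp[OF X Y less, unfolded pts])
    fix Z :: "((nat \<Rightarrow> real) + 'b) metric" and \<phi> \<psi>
    assume emb: "isometric_embedding (metr ?X) Z \<phi>" "isometric_embedding (metr Y) Z \<psi>"
      and near: "\<And>x. x \<in> tree_points E \<Longrightarrow> \<exists>y\<in>mspace (metr Y). mdist Z (\<phi> x) (\<psi> y) < \<epsilon>"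
        "\<And>y. y \<in> mspace (metr Y) \<Longrightarrow> \<exists>x\<in>tree_points E. mdist Z (\<phi> x) (\<psi> y) < \<epsilon>"
    interpret Z: Metric_space "mspace Z" "mdist Z"
      by simp
    have \<phi>: "\<phi> x \<in> mspace Z" "mdist Z (\<phi> x) (\<phi> y) = c * mdist (tree_metric E) x y"
      if "x \<in> tree_points E" "y \<in> tree_points E" for x y
      using emb(1) that by (auto simp: isometric_embedding_def pts dst)
    have \<psi>: "\<psi> x \<in> mspace Z" "mdist Z (\<psi> x) (\<psi> y) = mdist (metr Y) x y"
      if "x \<in> mspace (metr Y)" "y \<in> mspace (metr Y)" for x y
      using emb(2) that by (auto simp: isometric_embedding_def)
    define R where "R v y \<longleftrightarrow> mdist Z (\<phi> (vertex_point E v)) (\<psi> y) < \<epsilon> + c" for v y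
    note vp = vertex_point_in_tree_points
    have 1: "\<exists>v\<in>Range E. R v y" if y: "y \<in> mspace (metr Y)" for y
    proof -
      obtain x where x: "x \<in> tree_points E" "mdist Z (\<phi> x) (\<psi> y) < \<epsilon>"
        using near(2)[OF y] by blast
      obtain v where v: "v \<in> Range E" "mdist (tree_metric E) x (vertex_point E v) \<le> 1"
        using tree_point_near_vertex[OF x(1)] by blast
      have "mdist Z (\<phi> (vertex_point E v)) (\<psi> y) \<le>
          mdist Z (\<phi> x) (\<phi> (vertex_point E v)) + mdist Z (\<phi> x) (\<psi> y)"
        using Z.triangle''[of "\<phi> (vertex_point E v)" "\<phi> x" "\<psi> y"] \<phi>(1) \<psi>(1) x(1) y vp[OF v(1)]
          Z.commute by metis
      moreover have "mdist Z (\<phi> x) (\<phi> (vertex_point E v)) \<le> c * 1"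
        using \<phi>(2)[OF x(1) vp[OF v(1)]] v(2) c by (simp add: mult_left_le)
      ultimately have "R v y"
        using x(2) by (simp add: R_def)
      then show ?thesis
        using v(1) by blast
    qed
    have 2: "\<exists>y\<in>mspace (metr Y). R v y" if v: "v \<in> Range E" for v
      proof -
      obtain y where "y \<in> mspace (metr Y)" "mdist Z (\<phi> (vertex_point E v)) (\<psi> y) < \<epsilon>"
        using near(1)[OF vp[OF v]] by blast
      then show ?thesis
        using c by (intro bexI[of _ y]) (auto simp: R_def)
    qed
    have 3: "\<bar>c * real (edist E v v') - mdist (metr Y) y y'\<bar> \<le> 2 * (\<epsilon> + c)"
      if v: "v \<in> Range E" "v' \<in> Range E" and y: "y \<in> mspace (metr Y)" "y' \<in> mspace (metr Y)"
        and R: "R v y" "R v' y'" for v v' y y'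
    proof -
      let ?p = "\<phi> (vertex_point E v)" and ?p' = "\<phi> (vertex_point E v')"
      have Zpts: "?p \<in> mspace Z" "?p' \<in> mspace Z" "\<psi> y \<in> mspace Z" "\<psi> y' \<in> mspace Z"
        using \<phi>(1) \<psi>(1) vp v y by blast+
      have arith: "\<bar>a - b\<bar> \<le> 2 * r"
        if "a \<le> p + q" "q \<le> b + t" "b \<le> p + u" "u \<le> a + t" "p < r" "t < r" for a b p q t u r :: real
        using that by linarith
      have "\<bar>mdist Z ?p ?p' - mdist Z (\<psi> y) (\<psi> y')\<bar> \<le> 2 * (\<epsilon> + c)"
      proof (rule arith)
        show "mdist Z ?p ?p' \<le> mdist Z ?p (\<psi> y) + mdist Z (\<psi> y) ?p'"
          "mdist Z (\<psi> y) ?p' \<le> mdist Z (\<psi> y) (\<psi> y') + mdist Z ?p' (\<psi> y')"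
          "mdist Z (\<psi> y) (\<psi> y') \<le> mdist Z ?p (\<psi> y) + mdist Z ?p (\<psi> y')"
          "mdist Z ?p (\<psi> y') \<le> mdist Z ?p ?p' + mdist Z ?p' (\<psi> y')"
          using Z.triangle Zpts Z.commute by metis+
      qed (use R in \<open>simp_all only: R_def\<close>)
      then show ?thesis
        using \<phi>(2)[OF vp[OF v(1)] vp[OF v(2)]] \<psi>(2)[OF y] by (simp only: mdist_vertex_points)
    qed
    show "approximates (Range E) (\<lambda>x y. c * real (edist E x y)) (metr Y) (2 * (\<epsilon> + c))"
      unfolding approximates_def using 1 2 3 by (intro exI[of _ R]) blast
  qed
qed

text \<open>On the bad event \<open>B K i\<close>, every \<open>n > i\<close> violates the bound
  \<open>Suc K\<close> on \<open>W\<close> or the accuracy \<open>1 / Suc i\<close> for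
  \<open>G\<close>. Its probability is bounded by that of any single late \<open>n\<close>, hence by
  \<open>C / Suc K\<close>, since the contribution of \<open>G\<close> vanishes in the limit. The
  events increase in \<open>i\<close>, so the bound survives the union, and the intersection over
  \<open>K\<close> is null.\<close>

lemma (in prob_space) bounded_along_convergence:
  fixes W G :: "nat \<Rightarrow> 'a \<Rightarrow> real"
  assumes W: "\<And>n K. {\<omega> \<in> space M. W n \<omega> > K} \<in> events"
      "\<And>n K. n \<ge> 1 \<Longrightarrow> K > 0 \<Longrightarrow> prob {\<omega> \<in> space M. W n \<omega> > K} \<le> C / K"
    and G: "\<And>n \<epsilon>. n \<ge> 1 \<Longrightarrow> {\<omega> \<in> space M. G n \<omega> > \<epsilon>} \<in> events"
      "\<And>\<epsilon>. \<epsilon> > 0 \<Longrightarrow> (\<lambda>n. prob {\<omega> \<in> space M. G n \<omega> > \<epsilon>}) \<longlonglongrightarrow> 0"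
  shows "AE \<omega> in M. \<exists>K>0. \<forall>\<epsilon>>0. \<forall>N. \<exists>n\<ge>N. W n \<omega> \<le> K \<and> G n \<omega> \<le> \<epsilon>"
proof -
  let ?W = "\<lambda>n K. {\<omega> \<in> space M. W n \<omega> > K}" and ?G = "\<lambda>n \<epsilon>. {\<omega> \<in> space M. G n \<omega> > \<epsilon>}"
  define B where "B K i = (\<Inter>n\<in>{Suc i..}. ?W n (real (Suc K)) \<union> ?G n (1 / real (Suc i)))" for K i
  define S where "S = (\<Inter>K. \<Union>i. B K i)"
  have B_meas: "B K i \<in> events" for K i
    unfolding B_def using W(1) G(1) by (intro sets.countable_INT' sets.Un) auto
  then have S_meas: "S \<in> events"
    unfolding S_def by (intro sets.countable_INT' sets.countable_UN) auto
  have B_le: "prob (B K i) \<le> C / real (Suc K)" for K i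
  proof (rule tendsto_lowerbound[where F = sequentially])
    show "(\<lambda>n. C / real (Suc K) + prob (?G n (1 / real (Suc i)))) \<longlonglongrightarrow> C / real (Suc K)"
      using tendsto_add[OF tendsto_const G(2)[of "1 / real (Suc i)"], of "C / real (Suc K)"] by simp
    have "prob (B K i) \<le> C / real (Suc K) + prob (?G n (1 / real (Suc i)))" if n: "n \<ge> Suc i" for n
    proof -
      have n1: "n \<ge> 1"
        using n by simp
      have "prob (B K i) \<le> prob (?W n (real (Suc K)) \<union> ?G n (1 / real (Suc i)))"
        using n W(1) G(1)[OF n1] by (intro finite_measure_mono sets.Un) (auto simp: B_def)
      also have "\<dots> \<le> prob (?W n (real (Suc K))) + prob (?G n (1 / real (Suc i)))"
        using W(1) G(1)[OF n1] by (rule measure_Un_le)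
      also have "prob (?W n (real (Suc K))) \<le> C / real (Suc K)"
        using W(2)[OF n1] by simp
      finally show ?thesis
        by simp
    qed
    then show "\<forall>\<^sub>F n in sequentially. prob (B K i) \<le> C / real (Suc K) + prob (?G n (1 / real (Suc i)))"
      unfolding eventually_sequentially by blast
  qed simp
  \<comment> \<open>A larger \<open>i\<close> leaves fewer \<open>n\<close> to test and lowers the
    threshold for \<open>G\<close>, so the event grows.\<close>
  have "incseq (B K)" for K
  proof (rule incseq_SucI)
    fix i
    have "1 / real (Suc (Suc i)) \<le> 1 / real (Suc i)"
      by (simp add: field_simps)
    then show "B K i \<subseteq> B K (Suc i)"
      unfolding B_def by fastforce
  qed
  then have lim: "(\<lambda>i. prob (B K i)) \<longlonglongrightarrow> prob (\<Union>i. B K i)" for K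
    using B_meas by (intro finite_Lim_measure_incseq) auto
  have U_le: "prob (\<Union>i. B K i) \<le> C / real (Suc K)" for K
    by (intro tendsto_upperbound[OF lim] always_eventually allI B_le) simp
  have "prob S \<le> C / real (Suc K)" for K
    using U_le[of K] B_meas
    by (intro order_trans[OF finite_measure_mono, of S "\<Union>i. B K i"]) (auto simp: S_def)
  moreover have "(\<lambda>K. C / real (Suc K)) \<longlonglongrightarrow> 0"
    using LIMSEQ_Suc[OF lim_const_over_n[of C]] by simp
  ultimately have "prob S \<le> 0"
    by (intro tendsto_lowerbound[where F = sequentially]) auto
  then have "prob S = 0"
    using measure_nonneg[of M S] by linarith
  then have null: "S \<in> null_sets M"
    using S_meas by (simp add: null_sets_def emeasure_eq_measure)
  show ?thesis
  proof (rule AE_I'[OF null], rule subsetI)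
    fix \<omega>
    assume \<omega>: "\<omega> \<in> {\<omega> \<in> space M. \<not> (\<exists>K>0. \<forall>\<epsilon>>0. \<forall>N. \<exists>n\<ge>N. W n \<omega> \<le> K \<and> G n \<omega> \<le> \<epsilon>)}"
    show "\<omega> \<in> S"
      unfolding S_def
    proof
      fix K
      have "\<not> (\<forall>\<epsilon>>0. \<forall>N. \<exists>n\<ge>N. W n \<omega> \<le> real (Suc K) \<and> G n \<omega> \<le> \<epsilon>)"
        using \<omega> of_nat_0_less_iff[of "Suc K"] by blast
      then obtain \<epsilon> N where \<epsilon>: "\<epsilon> > 0" and N: "\<And>n. n \<ge> N \<Longrightarrow> W n \<omega> > real (Suc K) \<or> G n \<omega> > \<epsilon>"
        by (meson not_le)
      obtain i0 where i0: "1 / real (Suc i0) < \<epsilon>"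
        using nat_approx_posE[OF \<epsilon>] by blast
      define i where "i = max i0 N"
      have i: "1 / real (Suc i) < \<epsilon>" "i \<ge> N"
      proof -
        have "1 / real (Suc i) \<le> 1 / real (Suc i0)"
          by (intro divide_left_mono) (auto simp: i_def)
        then show "1 / real (Suc i) < \<epsilon>"
          using i0 by linarith
      qed (simp add: i_def)
      have "\<omega> \<in> B K i"
        unfolding B_def
      proof
        fix n assume "n \<in> {Suc i..}"
        then have "W n \<omega> > real (Suc K) \<or> G n \<omega> > \<epsilon>"
          using N i(2) by simp
        then show "\<omega> \<in> ?W n (real (Suc K)) \<union> ?G n (1 / real (Suc i))"
          using \<omega> i(1) by auto
      qed
      then show "\<omega> \<in> (\<Union>i. B K i)"
        by blast
    qed
  qed
qed

section \<open>The law of the random history\<close>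

definition history :: "(nat \<Rightarrow> nat \<times> nat) \<Rightarrow> nat \<Rightarrow> (nat \<times> nat) list" where
  "history h n = rev (map h [0..<n])"

lemma history_simps: "history h 0 = []" "history h (Suc n) = h n # history h n" "length (history h n) = n"
  by (simp_all add: history_def)

lemma history_cong_iff: "history h n = history g n \<longleftrightarrow> (\<forall>i<n. h i = g i)"
  by (auto simp: history_def)

lemma growing_tree_eq_htree: "growing_tree k h n = htree k (history h n)"
  by (induction n) (simp_all add: history_simps)

lemma history_in_histories:
  "(\<And>i. i < n \<Longrightarrow> h i \<in> growing_tree k h i) \<Longrightarrow> history h n \<in> histories k n"
  by (induction n) (force simp: history_simps growing_tree_eq_htree)+

lemma histories_obtain:
  assumes "k \<ge> 1" "xs \<in> histories k n"
  obtains g where "xs = history g n" "\<And>i. i < n \<Longrightarrow> g i \<in> growing_tree k g i"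
proof -
  have "\<exists>g. xs = history g n \<and> (\<forall>i<n. g i \<in> growing_tree k g i)"
    using assms(2)
  proof (induction n arbitrary: xs)
    case (Suc n)
    then obtain x ys where xs: "xs = x # ys" "ys \<in> histories k n" "x \<in> htree k ys"
      by auto
    obtain g where g: "ys = history g n" "\<forall>i<n. g i \<in> growing_tree k g i"
      using Suc.IH[OF xs(2)] by blast
    define g' where "g' = g(n := x)"
    have g': "g' n = x" "\<And>i. i < n \<Longrightarrow> g' i = g i" "\<And>i. i \<le> n \<Longrightarrow> history g' i = history g i"
      by (auto simp: g'_def history_cong_iff)
    show ?case
      using xs g g' by (intro exI[of _ g']) (auto simp: history_simps growing_tree_eq_htree less_Suc_eq)
  qed (simp add: history_simps)
  then show ?thesis
    using that by blast
qed

context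
  fixes k :: nat and M :: "'w measure" and e :: "nat \<Rightarrow> 'w \<Rightarrow> nat \<times> nat"
  assumes k: "k \<ge> 1" and growth: "uniform_growth k M e"
begin

interpretation prob_space M
  using growth by (simp add: uniform_growth_def)

abbreviation "hist n \<omega> \<equiv> history (\<lambda>i. e i \<omega>) n"

lemma hist_in_histories: "\<omega> \<in> space M \<Longrightarrow> hist n \<omega> \<in> histories k n"
  using growth by (intro history_in_histories) (simp add: uniform_growth_def)

lemma hist_event: "{\<omega> \<in> space M. hist n \<omega> = h} \<in> events"
proof (induction n arbitrary: h)
  case (Suc n)
  have meas: "e n \<in> measurable M (count_space UNIV)"
    using growth by (simp add: uniform_growth_def)
  show ?case
  proof (cases h)
    case (Cons x h')
    have "{\<omega> \<in> space M. e n \<omega> = x} \<in> events"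
      using measurable_sets[OF meas, of "{x}"] by (simp add: vimage_def Int_def conj_commute)
    then have "{\<omega> \<in> space M. e n \<omega> = x} \<inter> {\<omega> \<in> space M. hist n \<omega> = h'} \<in> events"
      using Suc.IH by blast
    moreover have "{\<omega> \<in> space M. hist (Suc n) \<omega> = h} =
        {\<omega> \<in> space M. e n \<omega> = x} \<inter> {\<omega> \<in> space M. hist n \<omega> = h'}"
      by (auto simp: history_simps Cons)
    ultimately show ?thesis
      by simp
  qed (simp add: history_simps)
qed (simp add: history_simps)

text \<open>By uniform growth each step divides the probability of an initial segment by
  \<open>k * n + 1\<close>, the factor by which the number of histories grows.\<close>

lemma prob_hist:
  assumes "h \<in> histories k n"
  shows "prob {\<omega> \<in> space M. hist n \<omega> = h} = 1 / real (card (histories k n))"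
proof -
  obtain g where g: "h = history g n" "\<And>i. i < n \<Longrightarrow> g i \<in> growing_tree k g i"
    using histories_obtain[OF k assms] by blast
  have "prob {\<omega> \<in> space M. \<forall>i<n. e i \<omega> = g i} = 1 / real (card (histories k n))"
    using g(2)
  proof (induction n)
    case 0
    show ?case
      by (simp add: prob_space)
  next
    case (Suc n)
    have in_H: "history g n \<in> histories k n"
      using Suc.prems by (intro history_in_histories) simp
    have "prob {\<omega> \<in> space M. \<forall>i<Suc n. e i \<omega> = g i} = prob {\<omega> \<in> space M. \<forall>i\<le>n. e i \<omega> = g i}"
      by (simp add: less_Suc_eq_le)
    also have "\<dots> = prob {\<omega> \<in> space M. \<forall>i<n. e i \<omega> = g i} / real (card (growing_tree k g n))"
      using growth Suc.prems[of n] by (simp add: uniform_growth_def)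
    also have "card (growing_tree k g n) = k * n + 1"
      using grown_tree.card_E[OF histories_grown_tree[OF k in_H]] by (simp add: growing_tree_eq_htree)
    also have "prob {\<omega> \<in> space M. \<forall>i<n. e i \<omega> = g i} = 1 / real (card (histories k n))"
      using Suc by simp
    finally show ?case
      unfolding card_histories_Suc[OF k] of_nat_mult by (simp add: mult.commute)
  qed
  then show ?thesis
    by (simp add: g(1) history_cong_iff)
qed

lemma hist_sublevel:
  "{\<omega> \<in> space M. hist n \<omega> \<in> A} = (\<Union>h\<in>histories k n \<inter> A. {\<omega> \<in> space M. hist n \<omega> = h})"
  using hist_in_histories by auto

lemma hist_in_event: "{\<omega> \<in> space M. hist n \<omega> \<in> A} \<in> events"
  unfolding hist_sublevel using finite_histories[OF k] hist_event by (intro sets.finite_UN) auto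

text \<open>Markov's inequality for the uniform law on the finitely many histories.\<close>

lemma prob_hist_gt_le:
  assumes nonneg: "\<And>h. h \<in> histories k n \<Longrightarrow> \<Phi> h \<ge> 0" and K: "K > 0"
  shows "prob {\<omega> \<in> space M. \<Phi> (hist n \<omega>) > K} \<le> avg k n \<Phi> / K"
proof -
  let ?A = "histories k n \<inter> {h. \<Phi> h > K}" and ?N = "real (card (histories k n))"
  have fin: "finite (histories k n)"
    using finite_histories[OF k] .
  have N: "?N > 0"
    using card_histories_pos[OF k] by simp
  have "{\<omega> \<in> space M. \<Phi> (hist n \<omega>) > K} = (\<Union>h\<in>?A. {\<omega> \<in> space M. hist n \<omega> = h})"
    using hist_sublevel[of n "{h. \<Phi> h > K}"] by simp
  also have "prob \<dots> \<le> (\<Sum>h\<in>?A. prob {\<omega> \<in> space M. hist n \<omega> = h})"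
    using fin hist_event by (intro finite_measure_subadditive_finite) auto
  also have "\<dots> = (\<Sum>h\<in>?A. 1 / ?N)"
    by (intro sum.cong refl prob_hist) auto
  also have "\<dots> \<le> (\<Sum>h\<in>?A. \<Phi> h / K / ?N)"
    using K N by (intro sum_mono divide_right_mono) auto
  also have "\<dots> \<le> (\<Sum>h\<in>histories k n. \<Phi> h / K / ?N)"
    using fin nonneg K by (intro sum_mono2) auto
  also have "\<dots> = avg k n \<Phi> / K"
    by (simp add: avg_def mult.commute flip: sum_divide_distrib)
  finally show ?thesis .
qed

text \<open>The history takes finitely many values, and for each of them the rescaled tree is a
  fixed compact space, whose distance to the random tree is measurable by
  \<open>random_real_tree\<close>.\<close>

lemma ghp_measurable:
  fixes \<T> :: "'w \<Rightarrow> 'a rmm_space"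
  assumes T: "random_real_tree M \<T>" and n: "n \<ge> 1"
  shows "(\<lambda>\<omega>. ghp_dist (rescale (real n powr (- 1 / real k)) (tree_space (growing_tree k (\<lambda>i. e i \<omega>) n))) (\<T> \<omega>))
    \<in> borel_measurable M"
  unfolding growing_tree_eq_htree
proof (rule measurable_compose_countable'[where g = "\<lambda>\<omega>. hist n \<omega>" and I = "histories k n" and
      f = "\<lambda>h \<omega>. ghp_dist (rescale (real n powr (- 1 / real k)) (tree_space (htree k h))) (\<T> \<omega>)"])
  show "countable (histories k n)"
    using finite_histories[OF k] by (rule countable_finite)
  show "(\<lambda>\<omega>. hist n \<omega>) \<in> measurable M (count_space (histories k n))"
    using hist_in_histories hist_event finite_histories[OF k]
    by (intro measurable_count_space_eq2[THEN iffD2]) (auto simp: vimage_def Int_def conj_commute)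
  fix h assume h: "h \<in> histories k n"
  interpret grown_tree k n "htree k h"
    by (rule histories_grown_tree[OF k h])
  have "compact_rmm (rescale (real n powr (- 1 / real k)) (tree_space (htree k h)))"
    using n by (intro compact_rmm_rescale compact_rmm_tree_space) simp
  then show "(\<lambda>\<omega>. ghp_dist (rescale (real n powr (- 1 / real k)) (tree_space (htree k h))) (\<T> \<omega>))
      \<in> borel_measurable M"
    using T by (simp add: random_real_tree_def)
qed

end

text \<open>What a single outcome retains of the convergence in probability: one bound
  \<open>K\<close> serves all accuracies \<open>\<eta>\<close> and all starting indices
  \<open>N\<close>.\<close>

definition bounded_approximations ::
    "nat \<Rightarrow> (nat \<Rightarrow> (nat \<times> nat) list \<Rightarrow> real) \<Rightarrow> 'a metric \<Rightarrow> bool" where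
  "bounded_approximations k \<Phi> m \<longleftrightarrow>
     (\<exists>K>0. \<forall>\<eta>>0. \<forall>N. \<exists>n\<ge>N. \<exists>h\<in>histories k n. \<Phi> n h \<le> K \<and> real n powr (- 1 / real k) \<le> \<eta> \<and>
       approximates (Range (htree k h)) (\<lambda>x y. real n powr (- 1 / real k) * real (edist (htree k h) x y)) m \<eta>)"

lemma AE_bounded_approximations:
  fixes \<T> :: "'w \<Rightarrow> 'a rmm_space"
  assumes k: "k \<ge> 1" and growth: "uniform_growth k M e" and T: "random_real_tree M \<T>"
    and conv: "ghp_tendsto_in_prob M
      (\<lambda>n \<omega>. rescale (real n powr (- 1 / real k)) (tree_space (growing_tree k (\<lambda>i. e i \<omega>) n))) \<T>"
    and \<Phi>: "\<And>n h. h \<in> histories k n \<Longrightarrow> \<Phi> n h \<ge> 0" "\<And>n. n \<ge> 1 \<Longrightarrow> avg k n (\<Phi> n) \<le> C"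
  shows "AE \<omega> in M. bounded_approximations k \<Phi> (metr (\<T> \<omega>))"
proof -
  interpret prob_space M
    using growth by (simp add: uniform_growth_def)
  let ?hist = "\<lambda>n \<omega>. history (\<lambda>i. e i \<omega>) n"
  let ?c = "\<lambda>n. real n powr (- 1 / real k)"
  let ?G = "\<lambda>n \<omega>. ghp_dist (rescale (?c n) (tree_space (growing_tree k (\<lambda>i. e i \<omega>) n))) (\<T> \<omega>)"
  have lim: "?c \<longlonglongrightarrow> 0"
    using k by (intro tendsto_neg_powr filterlim_real_sequentially) auto
  have "AE \<omega> in M. \<exists>K>0. \<forall>\<epsilon>>0. \<forall>N. \<exists>n\<ge>N. \<Phi> n (?hist n \<omega>) \<le> K \<and> ?G n \<omega> \<le> \<epsilon>"
  proof (rule bounded_along_convergence)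
    show "{\<omega> \<in> space M. \<Phi> n (?hist n \<omega>) > K} \<in> events" for n K
      using hist_in_event[OF k growth, of n "{h. \<Phi> n h > K}"] by simp
    show "prob {\<omega> \<in> space M. \<Phi> n (?hist n \<omega>) > K} \<le> C / K" if "n \<ge> 1" "K > 0" for n K
      using prob_hist_gt_le[OF k growth, of n "\<Phi> n" K] \<Phi> that by (smt (verit) divide_right_mono)
    show "{\<omega> \<in> space M. ?G n \<omega> > \<epsilon>} \<in> events" if "n \<ge> 1" for n \<epsilon>
      using ghp_measurable[OF k growth T that] by simp
    show "(\<lambda>n. prob {\<omega> \<in> space M. ?G n \<omega> > \<epsilon>}) \<longlonglongrightarrow> 0" if "\<epsilon> > 0" for \<epsilon>
      using conv that by (simp add: ghp_tendsto_in_prob_def)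
  qed
  then show ?thesis
  proof (rule AE_mp, intro AE_I2 impI)
    fix \<omega> assume \<omega>: "\<omega> \<in> space M"
      and "\<exists>K>0. \<forall>\<epsilon>>0. \<forall>N. \<exists>n\<ge>N. \<Phi> n (?hist n \<omega>) \<le> K \<and> ?G n \<omega> \<le> \<epsilon>"
    then obtain K where K: "K > 0" "\<And>\<epsilon> N. \<epsilon> > 0 \<Longrightarrow> \<exists>n\<ge>N. \<Phi> n (?hist n \<omega>) \<le> K \<and> ?G n \<omega> \<le> \<epsilon>"
      by blast
    have Y: "compact_rmm (\<T> \<omega>)"
      using T \<omega> by (simp add: random_real_tree_def)
    show "bounded_approximations k \<Phi> (metr (\<T> \<omega>))"
      unfolding bounded_approximations_def
    proof (intro exI[of _ K] conjI K(1) allI impI)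
      fix \<eta> :: real and N assume \<eta>: "\<eta> > 0"
      have "eventually (\<lambda>n. ?c n < \<eta> / 4) sequentially"
        using lim \<eta> by (intro order_tendstoD(2)[OF lim]) simp
      then obtain N' where N': "\<And>n. n \<ge> N' \<Longrightarrow> ?c n < \<eta> / 4"
        unfolding eventually_sequentially by blast
      \<comment> \<open>Since \<open>?c n < \<eta> / 4\<close>, the value \<open>\<eta> / 8\<close>
        is strictly below \<open>\<eta> / 2 - ?c n\<close>; with the latter as proximity,
        \<open>ghp_approximates\<close> gives distortion exactly \<open>\<eta>\<close>.\<close>
      obtain n where n: "n \<ge> max (max N N') 1" "\<Phi> n (?hist n \<omega>) \<le> K" "?G n \<omega> \<le> \<eta> / 8"
        using K(2)[of "\<eta> / 8" "max (max N N') 1"] \<eta> by auto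
      have h: "?hist n \<omega> \<in> histories k n"
        by (rule hist_in_histories[OF k growth \<omega>])
      interpret grown_tree k n "htree k (?hist n \<omega>)"
        by (rule histories_grown_tree[OF k h])
      have c: "?c n > 0" "?c n < \<eta> / 4"
        using n(1) N'[of n] by auto
      have "approximates (Range (htree k (?hist n \<omega>))) (\<lambda>x y. ?c n * real (edist (htree k (?hist n \<omega>)) x y))
          (metr (\<T> \<omega>)) (2 * ((\<eta> / 2 - ?c n) + ?c n))"
        using n(3) \<eta> c(2) by (intro ghp_approximates[OF c(1) Y]) (simp add: growing_tree_eq_htree)
      then have "approximates (Range (htree k (?hist n \<omega>))) (\<lambda>x y. ?c n * real (edist (htree k (?hist n \<omega>)) x y))
          (metr (\<T> \<omega>)) \<eta>"
        by simp
      then show "\<exists>n\<ge>N. \<exists>h\<in>histories k n. \<Phi> n h \<le> K \<and> ?c n \<le> \<eta> \<and>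
          approximates (Range (htree k h)) (\<lambda>x y. ?c n * real (edist (htree k h) x y)) (metr (\<T> \<omega>)) \<eta>"
        using n h c(2) \<eta> by (intro exI[of _ n] conjI bexI[of _ "?hist n \<omega>"]) auto
    qed
  qed
qed

section \<open>The two almost sure bounds for the limit tree\<close>

lemma growth_hausdorff_measure_eq_0:
  fixes \<T> :: "'w \<Rightarrow> 'a rmm_space"
  assumes k: "k \<ge> 1" and growth: "uniform_growth k M e" and T: "random_real_tree M \<T>"
    and conv: "ghp_tendsto_in_prob M
      (\<lambda>n \<omega>. rescale (real n powr (- 1 / real k)) (tree_space (growing_tree k (\<lambda>i. e i \<omega>) n))) \<T>"
    and \<beta>: "0 < \<beta>" "\<beta> < 1 / real k"
  shows "AE \<omega> in M. \<forall>t>1 / \<beta>. hausdorff_measure (metr (\<T> \<omega>)) t (mspace (metr (\<T> \<omega>))) = 0"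
proof -
  \<comment> \<open>A moment so high that \<open>p * (1 / k - \<beta>) \<ge> 2\<close>, as the
    summation over scales in \<open>avg_chain_weight_le\<close> requires.\<close>
  define p where "p = max k (nat \<lceil>2 / (1 / real k - \<beta>)\<rceil>)"
  have p: "p \<ge> k" "real p * (1 / real k - \<beta>) \<ge> 2"
  proof -
    show "p \<ge> k"
      by (simp add: p_def)
    have "2 / (1 / real k - \<beta>) \<le> real p"
      unfolding p_def by linarith
    then show "real p * (1 / real k - \<beta>) \<ge> 2"
      using \<beta> by (simp add: pos_divide_le_eq)
  qed
  have nonneg: "chain_weight k \<beta> p n h \<ge> 0" for n h
    unfolding chain_weight_def using near_sum_nonneg[OF k] by (intro sum_nonneg mult_nonneg_nonneg) auto
  have "AE \<omega> in M. bounded_approximations k (chain_weight k \<beta> p) (metr (\<T> \<omega>))"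
    by (rule AE_bounded_approximations[OF k growth T conv nonneg avg_chain_weight_le[OF k p]])
  then show ?thesis
  proof (rule AE_mp, intro AE_I2 impI allI)
    fix \<omega> t
    let ?m = "metr (\<T> \<omega>)"
    assume t: "t > 1 / \<beta>" and "bounded_approximations k (chain_weight k \<beta> p) ?m"
    then obtain K where K: "K > 0" "\<And>\<eta> N. \<eta> > 0 \<Longrightarrow> \<exists>n\<ge>N. \<exists>h\<in>histories k n. chain_weight k \<beta> p n h \<le> K \<and>
        real n powr (- 1 / real k) \<le> \<eta> \<and> approximates (Range (htree k h))
          (\<lambda>x y. real n powr (- 1 / real k) * real (edist (htree k h) x y)) ?m \<eta>"
      unfolding bounded_approximations_def by blast
    define A where "A = K powr (1 / real p) / (1 - 2 powr - \<beta>)"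
    have A: "A > 0"
      using K(1) \<beta> by (simp add: A_def powr_less_one)
    have t0: "t > 0" "t * \<beta> > 1"
    proof -
      show "t * \<beta> > 1"
        using t \<beta> by (simp add: pos_divide_less_eq)
      have "0 < 1 / \<beta>"
        using \<beta> by simp
      then show "t > 0"
        using t by linarith
    qed
    show "hausdorff_measure ?m t (mspace ?m) = 0"
    proof (rule hausdorff_measure_eq_0[OF t0(1) A _ \<beta>(1) t0(2)])
      show "0 \<le> real (k + 1)"
        by simp
      fix j and \<eta> :: real assume \<eta>: "\<eta> > 0"
      \<comment> \<open>Starting at \<open>N = 2 ^ j\<close> ensures that the tree already contains
        the level \<open>2 ^ j\<close> used as net.\<close>
      obtain n h where n: "n \<ge> 2 ^ j" and h: "h \<in> histories k n" and W: "chain_weight k \<beta> p n h \<le> K"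
        and app: "approximates (Range (htree k h))
          (\<lambda>x y. real n powr (- 1 / real k) * real (edist (htree k h) x y)) ?m \<eta>"
        using K(2)[OF \<eta>, of "2 ^ j"] by blast
      let ?c = "real n powr (- 1 / real k)" and ?W = "vertices k (2 ^ j) h"
      have n0: "n > 0"
        using n by (metis le_zero_eq not_gr_zero power_not_zero zero_neq_numeral)
      note W_props = vertices_subset[OF k h n] card_vertices[OF k h n]
      have "\<exists>y\<in>?W. ?c * real (edist (htree k h) x y) \<le> A * 2 powr (- \<beta> * real j)"
        if x: "x \<in> Range (htree k h)" for x
      proof -
        have "p \<ge> 1"
          using p(1) k by simp
        then obtain y where y: "y \<in> ?W"
            "real (edist (htree k h) x y) \<le> A * 2 powr (- \<beta> * real j) * real n powr (1 / real k)"
          using chain_weight_near[OF k \<beta>(1) _ h K(1) W n x] unfolding A_def by blast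
        have "?c * real (edist (htree k h) x y) \<le> ?c * (A * 2 powr (- \<beta> * real j) * real n powr (1 / real k))"
          using y(2) by (rule mult_left_mono) simp
        also have "\<dots> = A * 2 powr (- \<beta> * real j) * (real n powr (1 / real k) * ?c)"
          by (simp only: mult_ac)
        also have "real n powr (1 / real k) * ?c = 1"
          using n0 by (simp flip: powr_add)
        finally show ?thesis
          using y(1) by auto
      qed
      moreover have "real (card ?W) \<le> real (k + 1) * 2 ^ j"
        using W_props(2) by (simp add: algebra_simps)
      ultimately show "\<exists>V D W. approximates V D ?m \<eta> \<and> W \<subseteq> V \<and> finite W \<and>
          real (card W) \<le> real (k + 1) * 2 ^ j \<and> (\<forall>v\<in>V. \<exists>w\<in>W. D v w \<le> A * 2 powr (- \<beta> * real j))"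
        using app W_props
        by (intro exI[of _ "Range (htree k h)"] exI[of _ "\<lambda>x y. ?c * real (edist (htree k h) x y)"]
            exI[of _ ?W] conjI ballI) auto
    qed
  qed
qed

text \<open>The normalised energy has bounded mean by \<open>avg_energy_le\<close>, so along good
  \<open>n\<close> the energy hypothesis of \<open>hausdorff_premeasure_pos\<close> holds with a
  constant independent of the accuracy.\<close>

lemma growth_hausdorff_premeasure_pos:
  fixes \<T> :: "'w \<Rightarrow> 'a rmm_space"
  assumes k: "k \<ge> 2" and growth: "uniform_growth k M e" and T: "random_real_tree M \<T>"
    and conv: "ghp_tendsto_in_prob M
      (\<lambda>n \<omega>. rescale (real n powr (- 1 / real k)) (tree_space (growing_tree k (\<lambda>i. e i \<omega>) n))) \<T>"
    and s: "1 \<le> s" "s < real k"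
  shows "AE \<omega> in M. hausdorff_premeasure (metr (\<T> \<omega>)) s 1 (mspace (metr (\<T> \<omega>))) > 0"
proof -
  have k1: "k \<ge> 1"
    using k by simp
  define q where "q = 2 - s / real k"
  \<comment> \<open>The shift in \<open>riesz_weight_ge\<close>; rescaled by \<open>?c\<close>, it
    becomes the offset \<open>a * ?c\<close> that plays the part of \<open>\<epsilon>\<close> in the
    energy.\<close>
  define a where "a = 2 * real k - 2 - s"
  have a: "a > 0"
    using denominator_gt[OF k s, of 0] by (simp add: a_def)
  obtain A where A: "A > 0" "\<And>n. n \<ge> 1 \<Longrightarrow> avg k n (energy k s) \<le> A * real n powr q"
    unfolding q_def using avg_energy_le[OF k s] by blast
  define \<Phi> where "\<Phi> n h = real n powr - q * energy k s h" for n h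
  have nonneg: "\<Phi> n h \<ge> 0" for n h
    unfolding \<Phi>_def energy_def using riesz_weight_pos[OF k s]
    by (simp add: sum_nonneg less_imp_le)
  have avg: "avg k n (\<Phi> n) \<le> A" if n: "n \<ge> 1" for n
  proof -
    have "avg k n (\<Phi> n) = real n powr - q * avg k n (energy k s)"
      unfolding \<Phi>_def by (rule avg_cmult)
    also have "\<dots> \<le> real n powr - q * (A * real n powr q)"
      using A(2)[OF n] by (rule mult_left_mono) simp
    also have "\<dots> = A"
      using n by (simp add: powr_minus)
    finally show ?thesis .
  qed
  have "AE \<omega> in M. compact_rmm (\<T> \<omega>)"
    using T by (simp add: random_real_tree_def)
  moreover have "AE \<omega> in M. bounded_approximations k \<Phi> (metr (\<T> \<omega>))"
    by (rule AE_bounded_approximations[OF k1 growth T conv nonneg avg])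
  ultimately show ?thesis
  proof eventually_elim
    fix \<omega>
    let ?m = "metr (\<T> \<omega>)"
    assume "bounded_approximations k \<Phi> ?m"
    then obtain K where K: "K > 0" "\<And>\<eta> N. \<eta> > 0 \<Longrightarrow> \<exists>n\<ge>N. \<exists>h\<in>histories k n. \<Phi> n h \<le> K \<and>
        real n powr (- 1 / real k) \<le> \<eta> \<and> approximates (Range (htree k h))
          (\<lambda>x y. real n powr (- 1 / real k) * real (edist (htree k h) x y)) ?m \<eta>"
      unfolding bounded_approximations_def by blast
    assume "compact_rmm (\<T> \<omega>)"
    then have compact: "compact_space (mtopology_of ?m)"
      by (simp add: compact_rmm_def)
    define K' where "K' = a powr - s * K"
    have K': "K' > 0"
      using K(1) a by (simp add: K'_def)
    have "ennreal (1 / (2 * K')) \<le> hausdorff_premeasure ?m s 1 (mspace ?m)"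
    proof (rule hausdorff_premeasure_pos[OF compact _ K'])
      show "s > 0"
        using s by simp
      fix \<eta> :: real assume \<eta>: "\<eta> > 0"
      \<comment> \<open>Chosen so that both the distortion and the offset \<open>a * ?c\<close> are
        at most \<open>\<eta>\<close>.\<close>
      define \<eta>' where "\<eta>' = min \<eta> (\<eta> / a)"
      have \<eta>': "\<eta>' > 0" "\<eta>' \<le> \<eta>" "a * \<eta>' \<le> \<eta>"
      proof -
        show "\<eta>' > 0" "\<eta>' \<le> \<eta>"
          using \<eta> a by (auto simp: \<eta>'_def)
        have "a * \<eta>' \<le> a * (\<eta> / a)"
          using a by (intro mult_left_mono) (auto simp: \<eta>'_def)
        then show "a * \<eta>' \<le> \<eta>"
          using a by simp
      qed
      obtain n h where n: "n \<ge> 1" and h: "h \<in> histories k n" and en: "\<Phi> n h \<le> K"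
        and c_le: "real n powr (- 1 / real k) \<le> \<eta>'"
        and app: "approximates (Range (htree k h))
          (\<lambda>x y. real n powr (- 1 / real k) * real (edist (htree k h) x y)) ?m \<eta>'"
        using K(2)[OF \<eta>'(1), of 1] by blast
      interpret grown_tree k n "htree k h"
        by (rule histories_grown_tree[OF k1 h])
      let ?c = "real n powr (- 1 / real k)" and ?V = "Range (htree k h)" and ?d = "edist (htree k h)"
      have c: "?c > 0"
        using n by simp
      have term_le: "(?c * real d + a * ?c) powr - s \<le> (a * ?c) powr - s * riesz_weight k s d" for d
      proof -
        define y where "y = a / (real d + a)"
        have y: "y > 0" "?c * real d + a * ?c = (a * ?c) / y"
          using a by (auto simp: y_def field_simps)
        have "(?c * real d + a * ?c) powr - s = (a * ?c) powr - s / y powr - s"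
          unfolding y(2) by (rule powr_divide)
        also have "\<dots> = (a * ?c) powr - s * y powr s"
          by (simp add: powr_minus divide_inverse)
        also have "\<dots> \<le> (a * ?c) powr - s * riesz_weight k s d"
          using riesz_weight_ge[OF k s, of d] by (intro mult_left_mono) (auto simp: a_def y_def)
        finally show ?thesis .
      qed
      have "(\<Sum>x\<in>?V. \<Sum>y\<in>?V. (?c * real (?d x y) + a * ?c) powr - s) \<le>
          (\<Sum>x\<in>?V. \<Sum>y\<in>?V. (a * ?c) powr - s * riesz_weight k s (?d x y))"
        by (intro sum_mono term_le)
      also have "\<dots> = (a * ?c) powr - s * energy k s h"
        by (simp add: energy_def sum_distrib_left)
      also have "\<dots> \<le> (a * ?c) powr - s * (K * real n powr q)"
      proof -
        have "energy k s h \<le> K * real n powr q"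
          using en n by (simp add: \<Phi>_def powr_minus field_simps)
        then show ?thesis
          by (rule mult_left_mono) simp
      qed
      also have "\<dots> = K' * (real n)\<^sup>2"
      proof -
        \<comment> \<open>The exponents add up to \<open>s / k + (2 - s / k) = 2\<close>, matching
          the square of the number of vertices.\<close>
        have "?c powr - s * real n powr q = real n powr 2"
          by (simp add: powr_powr q_def flip: powr_add)
        then show ?thesis
          using n by (simp add: K'_def powr_mult mult_ac)
      qed
      also have "\<dots> \<le> K' * (real (card ?V))\<^sup>2"
      proof -
        have "n \<le> k * n + 1"
          using mult_le_mono1[OF k1, of n] unfolding mult_1 by (rule trans_le_add1)
        then have "real n \<le> real (card ?V)"
          unfolding card_Range by (rule of_nat_mono)
        then show ?thesis
          using K' by (intro mult_left_mono power_mono) auto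
      qed
      finally have "(\<Sum>x\<in>?V. \<Sum>y\<in>?V. (?c * real (?d x y) + a * ?c) powr - s) \<le> K' * (real (card ?V))\<^sup>2" .
      moreover have "?V \<noteq> {}"
        using card_Range by auto
      moreover have "a * ?c \<le> \<eta>"
        using mult_left_mono[OF c_le less_imp_le[OF a]] \<eta>'(3) by (rule order_trans)
      moreover have "approximates ?V (\<lambda>x y. ?c * real (?d x y)) ?m \<eta>"
        using app \<eta>'(2) by (rule approximates_mono)
      ultimately show "\<exists>V D \<epsilon>. approximates V D ?m \<eta> \<and> finite V \<and> V \<noteq> {} \<and>
          (\<forall>x\<in>V. \<forall>y\<in>V. D x y \<ge> 0) \<and> 0 < \<epsilon> \<and> \<epsilon> \<le> \<eta> \<and>
          (\<Sum>x\<in>V. \<Sum>y\<in>V. (D x y + \<epsilon>) powr - s) \<le> K' * (real (card V))\<^sup>2"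
        using a c
        by (intro exI[of _ ?V] exI[of _ "\<lambda>x y. ?c * real (?d x y)"] exI[of _ "a * ?c"] conjI) auto
    qed
    then show "hausdorff_premeasure ?m s 1 (mspace ?m) > 0"
      using K' by (simp add: less_le_trans[of 0 "ennreal (1 / (2 * K'))"] ennreal_less_zero_iff)
  qed
qed

theorem corollary1p2:
  fixes k :: nat
    and M :: "'w measure"
    and e :: "nat \<Rightarrow> 'w \<Rightarrow> nat \<times> nat"
    and \<T> :: "'w \<Rightarrow> 'a rmm_space"
  assumes "k \<ge> 2"
    and "uniform_growth k M e"
    and "random_real_tree M \<T>"
    and "ghp_tendsto_in_prob M
           (\<lambda>n \<omega>. rescale (real n powr (- 1 / real k)) (tree_space (growing_tree k (\<lambda>i. e i \<omega>) n))) \<T>"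
  shows "AE \<omega> in M. hausdorff_dim (metr (\<T> \<omega>)) = of_nat k"
proof -
  have k1: "k \<ge> 1"
    using assms(1) by simp
  have kr: "real k \<ge> 2"
    using assms(1) by simp
  \<comment> \<open>Countably many exponents on each side of \<open>k\<close> suffice, so that the
    exceptional null sets can be united.\<close>
  have "AE \<omega> in M. \<forall>t>real k + 1 / real (Suc i).
      hausdorff_measure (metr (\<T> \<omega>)) t (mspace (metr (\<T> \<omega>))) = 0" for i
  proof -
    \<comment> \<open>With this value the threshold \<open>1 / \<beta>\<close> is exactly
      \<open>k + 1 / Suc i\<close>.\<close>
    let ?\<beta> = "1 / (real k + 1 / real (Suc i))"
    have "real k + 1 / real (Suc i) > real k"
      by simp
    then have "0 < ?\<beta>" "?\<beta> < 1 / real k"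
      using kr by (auto intro!: divide_strict_left_mono mult_pos_pos add_pos_pos)
    from growth_hausdorff_measure_eq_0[OF k1 assms(2-4) this] show ?thesis
      by simp
  qed
  then have upper: "AE \<omega> in M. \<forall>i. \<forall>t>real k + 1 / real (Suc i).
      hausdorff_measure (metr (\<T> \<omega>)) t (mspace (metr (\<T> \<omega>))) = 0"
    by (simp only: AE_all_countable) blast
  have "AE \<omega> in M. hausdorff_premeasure (metr (\<T> \<omega>)) (real k - 1 / real (Suc i)) 1 (mspace (metr (\<T> \<omega>))) > 0" for i
  proof -
    \<comment> \<open>Since \<open>k \<ge> 2\<close>, the exponent \<open>k - 1 / Suc i\<close> is
      at least 1 already for \<open>i = 0\<close>.\<close>
    have "0 < 1 / real (Suc i)" "1 / real (Suc i) \<le> 1"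
      by simp_all
    then have "1 \<le> real k - 1 / real (Suc i)" "real k - 1 / real (Suc i) < real k"
      using kr by linarith+
    from growth_hausdorff_premeasure_pos[OF assms this] show ?thesis .
  qed
  then have "AE \<omega> in M. \<forall>i. hausdorff_premeasure (metr (\<T> \<omega>)) (real k - 1 / real (Suc i)) 1 (mspace (metr (\<T> \<omega>))) > 0"
    by (simp only: AE_all_countable) blast
  with upper show ?thesis
  proof eventually_elim
    fix \<omega>
    let ?m = "metr (\<T> \<omega>)"
    assume upper: "\<forall>i. \<forall>t>real k + 1 / real (Suc i). hausdorff_measure ?m t (mspace ?m) = 0"
      and lower: "\<forall>i. hausdorff_premeasure ?m (real k - 1 / real (Suc i)) 1 (mspace ?m) > 0"
    have "hausdorff_dim ?m = ennreal (real k)"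
    proof (rule hausdorff_dim_eqI)
      fix t assume "t > real k"
      then obtain i where "1 / real (Suc i) < t - real k"
        using nat_approx_posE[of "t - real k"] by auto
      then show "hausdorff_measure ?m t (mspace ?m) = 0"
        using upper by (simp add: algebra_simps)
    next
      fix t assume "t < real k"
      then obtain i where "1 / real (Suc i) < real k - t"
        using nat_approx_posE[of "real k - t"] by auto
      then have "t \<le> real k - 1 / real (Suc i)"
        by linarith
      then show "\<exists>s\<ge>t. hausdorff_premeasure ?m s 1 (mspace ?m) > 0"
        using lower by blast
    qed (use kr in linarith)
    then show "hausdorff_dim ?m = of_nat k"
      by (simp add: ennreal_of_nat_eq_real_of_nat)
  qed
qed

end
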